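(* Let $N\ge1$ and $\tau\in\mathbb C$ with $\mathrm{Im}\,\tau>0$. Let $R^{\mathrm B}$ be the Baxter–Belavin elliptic $R$-matrix and $g(z,u)$ the IRF-Vertex transformation matrix defined in the context. Put $$\breve g(0,u)=\mathop{\mathrm{Res}}_{z=0}\,g^{-1}(z,u),\qquad \mathcal O_{12}=\sum_{i,j=1}^NE_{ii}\otimes E_{ji}.$$ Then, as an identity of meromorphic functions of $\hbar,z,u_1,\dots,u_N$ with values in $\mathrm{Mat}(N,\mathbb C)^{\otimes 2}$, $$\breve g_2(0,u)\,R^{\mathrm B}_{12}(\hbar,z)=g_1(z+\hbar,u)\,\mathcal O_{12}\,g_2^{-1}(\hbar,u)\,g_1^{-1}(z,u).$$
   Context: Theta functions with characteristics: $\theta\left[{a\atop b}\right](z|\tau)=\sum_{j\in\mathbb Z}\exp\left(\pi\imath\tau(j+a)^2+2\pi\imath(j+a)(z+b)\right)$; $\vartheta(z)=\theta\left[{1/2\atop 1/2}\right](z|\tau)$. Kronecker function $\phi(\eta,z)=\dfrac{\vartheta'(0)\vartheta(\eta+z)}{\vartheta(\eta)\vartheta(z)}$. $E_{ij}$ is the standard matrix-unit basis of $\mathrm{Mat}(N,\mathbb C)$ and $u=(u_1,\dots,u_N)$. All matrix indices run over $1,\dots,N$. Baxter–Belavin $R$-matrix: let $Q_{kl}=\delta_{kl}e^{2\pi\imath k/N}$, $\Lambda_{kl}=1$ if $k-l+1\equiv0\bmod N$ and $0$ otherwise, $T_a=e^{\pi\imath a_1a_2/N}Q^{a_1}\Lambda^{a_2}$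 for $a=(a_1,a_2)$, and $\varphi^\hbar_a(z)=e^{2\pi\imath a_2z/N}\,\phi\!\left(z,\frac{\hbar+a_1+a_2\tau}{N}\right)$. Then $$R^{\mathrm B}_{12}(\hbar,z)=\frac1N\sum_{a\in\mathbb Z_N\times\mathbb Z_N}\varphi^\hbar_a(z)\,T_a\otimes T_{-a},$$ where each $a$ is represented by a pair of integers and $-a=(-a_1,-a_2)$ (each summand does not depend on the choice of representative). IRF-Vertex transformation matrix $g(z,u)\in\mathrm{Mat}(N,\mathbb C)$: $$g_{ij}(z,u)=\theta\left[{\frac12-\frac iN\atop \frac N2}\right]\!\Bigl(z+Nu_j-\sum_{m=1}^Nu_m\Big|\,N\tau\Bigr)\,\frac{1}{\prod_{k\ne j}\vartheta(u_k-u_j)}.$$ Notation: for a matrix $A\in\mathrm{Mat}(N,\mathbb C)$, $A_1=A\otimes1$ and $A_2=1\otimes A$. For generic $u$, $g^{-1}(z,u)$ has a simple pole at $z=0$. *)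

theory Defs
  imports "HOL-Complex_Analysis.Complex_Analysis"
begin

(* Matrices in Mat(N,C) are complex^'n^'n with N = CARD('n).  Since the formulas below use the
   numerical value of the matrix indices 1,...,N, the definitions that depend on it take a labelling
   ix :: 'n => nat, intended to be a bijection onto {1..N}. *)

subsection \<open>Theta functions\<close>

definition theta_char :: "complex \<Rightarrow> complex \<Rightarrow> complex \<Rightarrow> complex \<Rightarrow> complex" where
  "theta_char a b z \<tau> =
     (\<Sum>\<^sub>\<infinity>j\<in>(UNIV :: int set).
        exp (of_real pi * \<i> * \<tau> * (of_int j + a)^2
             + 2 * of_real pi * \<i> * (of_int j + a) * (z + b)))"

definition vartheta :: "complex \<Rightarrow> complex \<Rightarrow> complex" where
  "vartheta \<tau> z = theta_char (1/2) (1/2) z \<tau>"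

definition kronecker_phi :: "complex \<Rightarrow> complex \<Rightarrow> complex \<Rightarrow> complex" where
  "kronecker_phi \<tau> \<eta> z =
     deriv (vartheta \<tau>) 0 * vartheta \<tau> (\<eta> + z) / (vartheta \<tau> \<eta> * vartheta \<tau> z)"

(* The zero set of vartheta (for Im tau > 0). *)
definition period_lattice :: "complex \<Rightarrow> complex set" where
  "period_lattice \<tau> = {of_int m + of_int n * \<tau> | m n. True}"

subsection \<open>Matrices and tensor products\<close>

(* Mat(N,C) tensor Mat(N,C) is realised on the index type 'n * 'n, the first component belonging to
   the first tensor factor. *)
definition tensor_mat :: "complex^'n^'n \<Rightarrow> complex^'n^'n \<Rightarrow> complex^('n \<times> 'n)^('n \<times> 'n)"
    (infixr "\<otimes>\<^sub>K" 75) where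
  "A \<otimes>\<^sub>K B = (\<chi> p q. A $ fst p $ fst q * B $ snd p $ snd q)"

definition in_first :: "complex^'n^'n \<Rightarrow> complex^('n \<times> 'n)^('n \<times> 'n)" where
  "in_first A = A \<otimes>\<^sub>K mat 1"

definition in_second :: "complex^'n^'n \<Rightarrow> complex^('n \<times> 'n)^('n \<times> 'n)" where
  "in_second A = mat 1 \<otimes>\<^sub>K A"

definition mat_unit :: "'n \<Rightarrow> 'n \<Rightarrow> complex^'n^'n" where
  "mat_unit i j = (\<chi> k l. if k = i \<and> l = j then 1 else 0)"

definition mat_scale :: "complex \<Rightarrow> complex^'n^'m \<Rightarrow> complex^'n^'m" where
  "mat_scale c A = (\<chi> i j. c * A $ i $ j)"

(* Integer powers with respect to the matrix product; the library's power operations on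
   complex^'n^'n are componentwise. *)
definition mat_powi :: "complex^'n^'n \<Rightarrow> int \<Rightarrow> complex^'n^'n" where
  "mat_powi A k =
     (if 0 \<le> k then (((**) A) ^^ nat k) (mat 1)
      else (((**) (matrix_inv A)) ^^ nat (- k)) (mat 1))"

subsection \<open>The Baxter--Belavin R-matrix\<close>

definition Q_mat :: "('n::finite \<Rightarrow> nat) \<Rightarrow> complex^'n^'n" where
  "Q_mat ix =
     (\<chi> k l. if k = l then exp (2 * of_real pi * \<i> * of_nat (ix k) / of_nat CARD('n)) else 0)"

definition Lambda_mat :: "('n::finite \<Rightarrow> nat) \<Rightarrow> complex^'n^'n" where
  "Lambda_mat ix =
     (\<chi> k l. if (int (ix k) - int (ix l) + 1) mod int CARD('n) = 0 then 1 else 0)"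

definition T_mat :: "('n::finite \<Rightarrow> nat) \<Rightarrow> int \<Rightarrow> int \<Rightarrow> complex^'n^'n" where
  "T_mat ix a1 a2 =
     mat_scale (exp (of_real pi * \<i> * of_int a1 * of_int a2 / of_nat CARD('n)))
       (mat_powi (Q_mat ix) a1 ** mat_powi (Lambda_mat ix) a2)"

definition varphi_N :: "nat \<Rightarrow> complex \<Rightarrow> int \<Rightarrow> int \<Rightarrow> complex \<Rightarrow> complex \<Rightarrow> complex" where
  "varphi_N N \<tau> a1 a2 h z =
     exp (2 * of_real pi * \<i> * of_int a2 * z / of_nat N)
     * kronecker_phi \<tau> z ((h + of_int a1 + of_int a2 * \<tau>) / of_nat N)"

(* The summands depend on a1, a2 only modulo N; {0..<N} is the chosen set of representatives. *)
definition R_BB ::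
    "('n::finite \<Rightarrow> nat) \<Rightarrow> complex \<Rightarrow> complex \<Rightarrow> complex \<Rightarrow> complex^('n \<times> 'n)^('n \<times> 'n)" where
  "R_BB ix \<tau> h z =
     mat_scale (1 / of_nat CARD('n))
       (\<Sum>(a1, a2) \<in> {0..<int CARD('n)} \<times> {0..<int CARD('n)}.
          mat_scale (varphi_N (CARD('n)) \<tau> a1 a2 h z)
            (T_mat ix a1 a2 \<otimes>\<^sub>K T_mat ix (- a1) (- a2)))"

subsection \<open>The IRF-Vertex transformation\<close>

definition g_mat :: "('n::finite \<Rightarrow> nat) \<Rightarrow> complex \<Rightarrow> complex \<Rightarrow> complex^'n \<Rightarrow> complex^'n^'n" where
  "g_mat ix \<tau> z u =
     (\<chi> i j. theta_char (1/2 - of_nat (ix i) / of_nat CARD('n)) (of_nat CARD('n) / 2)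
               (z + of_nat CARD('n) * u $ j - (\<Sum>m\<in>UNIV. u $ m)) (of_nat CARD('n) * \<tau>)
             * (1 / (\<Prod>k\<in>UNIV - {j}. vartheta \<tau> (u $ k - u $ j))))"

definition g_breve :: "('n::finite \<Rightarrow> nat) \<Rightarrow> complex \<Rightarrow> complex^'n \<Rightarrow> complex^'n^'n" where
  "g_breve ix \<tau> u = (\<chi> i j. residue (\<lambda>z. matrix_inv (g_mat ix \<tau> z u) $ i $ j) 0)"

definition O_mat :: "complex^('n::finite \<times> 'n)^('n \<times> 'n)" where
  "O_mat = (\<Sum>i\<in>UNIV. \<Sum>j\<in>UNIV. mat_unit i i \<otimes>\<^sub>K mat_unit j i)"

end

theory Submission
  imports Defs
begin

text \<open>The residue of \<open>g\<^sup>-\<^sup>1\<close> at \<open>z = 0\<close> has equal rows \<open>\<rho>\<close>, because Lagrange interpolation of theta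
  functions of order \<open>N\<close> at the nodes \<open>(z + N u\<^sub>j - \<Sum>u) / N\<close> gives \<open>\<vartheta>(z) g\<^sup>-\<^sup>1(z)\<close> explicitly as an entire
  function; the same formula shows that the columns of \<open>g(0)\<close> sum to zero. Fix \<open>z\<close> and a vector
  \<open>v\<close>. As a function of \<open>\<hbar>\<close>, the vector \<open>\<rho>\<^sub>2 R(\<hbar>, z) (v \<otimes> g\<^sub>i(\<hbar>))\<close>, with \<open>g\<^sub>i\<close> the \<open>i\<close>-th column of \<open>g\<close>, has the
  same multipliers under \<open>\<hbar> \<mapsto> \<hbar> + 1\<close> and \<open>\<hbar> \<mapsto> \<hbar> + \<tau>\<close> as \<open>g\<^sub>i(z + \<hbar>)\<close>, and its only possible poles, at the
  lattice points, are removable since \<open>\<rho> g(0) = 0\<close>. Hence it equals \<open>C\<^sub>i(v) g\<^sub>i(z + \<hbar>)\<close>. Summing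
  over \<open>i\<close> and letting \<open>\<hbar> \<rightarrow> 0\<close> yields \<open>v = \<Sum>i. C\<^sub>i(v) g\<^sub>i(z)\<close>, i.e. \<open>C(v) = g\<^sup>-\<^sup>1(z) v\<close>, which is the claim.\<close>

subsection \<open>Entire functions with multipliers\<close>

text \<open>The analytic core is that \<open>vartheta\<close> vanishes exactly on the lattice, and
  to first order. Every uniqueness statement divides an entire function by theta functions and
  applies Liouville to the quotient, which requires the zeros of the divisor. They come from
  comparison with an infinite product whose zeros are visible. A single constant serves all N
  components of the vector because the shift by tau permutes the components cyclically: component 0
  determines the others, and it is an order-one theta function for the lattice Z + N tau, hence
  unique up to a factor. The limit in hbar has the form infinity times zero. The residue of R at
  hbar = 0 is the identity, while the sum of the columns of g(hbar) vanishes there with some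
  derivative gamma. What survives is the pairing of rho and gamma times v; this pairing is 1 because
  rho is the residue of the inverse of the same matrix g.\<close>

lemma entire_extension:
  assumes P: "P holomorphic_on UNIV" and P0: "P z0 \<noteq> 0"
    and f: "f holomorphic_on {z. P z \<noteq> 0}"
    and lim: "\<And>s. P s = 0 \<Longrightarrow> ((\<lambda>z. (z - s) * f z) \<longlongrightarrow> 0) (at s)"
  obtains g where "g holomorphic_on UNIV" "\<And>z. P z \<noteq> 0 \<Longrightarrow> g z = f z"
proof -
  \<comment> \<open>Filling every zero of \<open>P\<close> with the limit of \<open>f\<close> gives
    one global function, so the local extensions from Riemann's theorem only have to be matched with
    it disc by disc.\<close>
  define g where "g = (\<lambda>z. if P z = 0 then Lim (at z) f else f z)"
  have op: "open {z. P z \<noteq> 0}"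
    using open_Collect_neq[of P "\<lambda>_. 0"] P holomorphic_on_imp_continuous_on by auto
  have "g field_differentiable (at s)" for s
  proof (cases "P s = 0")
    case False
    have "g holomorphic_on {z. P z \<noteq> 0}"
      using f by (rule holomorphic_transform) (auto simp: g_def)
    with False op show ?thesis
      by (auto simp: holomorphic_on_open field_differentiable_def)
  next
    case True
    obtain r where r: "r > 0" "\<And>z. z \<in> ball s r - {s} \<Longrightarrow> P z \<noteq> 0"
      using isolated_zeros[OF P open_UNIV connected_UNIV UNIV_I True UNIV_I P0] by metis
    have "f holomorphic_on ball s r - {s}"
      using f by (rule holomorphic_on_subset) (use r in auto)
    then obtain h where h: "h holomorphic_on ball s r" "\<forall>z \<in> ball s r - {s}. h z = f z"
      using holomorphic_on_extend_lim[of f "ball s r" s] lim[OF True] r by auto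
    have "(h \<longlongrightarrow> h s) (at s)"
      using h(1) r(1) holomorphic_on_imp_continuous_on[of h "ball s r"]
      by (metis centre_in_ball continuous_on_def open_ball at_within_open)
    moreover have "eventually (\<lambda>z. h z = f z) (at s)"
      using h(2) eventually_at_in_open[of "ball s r" s] r(1) by (auto elim: eventually_mono)
    ultimately have "(f \<longlongrightarrow> h s) (at s)"
      by (rule Lim_transform_eventually)
    then have "Lim (at s) f = h s"
      by (intro tendsto_Lim) auto
    then have "h z = g z" if "z \<in> ball s r" for z
      using that r(2)[of z] h(2) True by (cases "z = s") (auto simp: g_def)
    then have "g holomorphic_on ball s r"
      using h(1) by (rule holomorphic_transform[rotated])
    then show ?thesis
      using r(1) by (auto simp: holomorphic_on_open field_differentiable_def)
  qed
  then have "g holomorphic_on UNIV"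
    by (simp add: holomorphic_on_def)
  then show ?thesis
    by (rule that) (simp add: g_def)
qed

text \<open>At a simple zero \<open>s\<close> the ratio \<open>P z / (z - s)\<close> has a nonzero
  limit, so \<open>(z - s) * (f z / P z)\<close> inherits the limit 0 of \<open>f\<close>.\<close>

lemma entire_quotient:
  assumes P: "P holomorphic_on UNIV" and P0: "P z0 \<noteq> 0"
    and f: "f holomorphic_on UNIV"
    and simple: "\<And>s. P s = 0 \<Longrightarrow> deriv P s \<noteq> 0"
    and zeros: "\<And>s. P s = 0 \<Longrightarrow> f s = 0"
  obtains q where "q holomorphic_on UNIV" "\<And>z. f z = q z * P z"
proof -
  have "((\<lambda>z. (z - s) * (f z / P z)) \<longlongrightarrow> 0) (at s)" if s: "P s = 0" for s
  proof -
    have "(P has_field_derivative deriv P s) (at s)"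
      using P by (auto intro: holomorphic_derivI)
    then have "((\<lambda>z. P z / (z - s)) \<longlongrightarrow> deriv P s) (at s)"
      using s by (simp add: has_field_derivative_iff)
    moreover have "(f \<longlongrightarrow> 0) (at s)"
      using f zeros[OF s] holomorphic_on_imp_continuous_on[OF f]
      by (metis UNIV_I continuous_on_def)
    ultimately have "((\<lambda>z. f z / (P z / (z - s))) \<longlongrightarrow> 0 / deriv P s) (at s)"
      using simple[OF s] by (intro tendsto_divide)
    then show ?thesis
      by (simp add: mult.commute)
  qed
  moreover have "(\<lambda>z. f z / P z) holomorphic_on {z. P z \<noteq> 0}"
    by (intro holomorphic_intros holomorphic_on_subset[OF f] holomorphic_on_subset[OF P]) auto
  ultimately obtain q where q: "q holomorphic_on UNIV" "\<And>z. P z \<noteq> 0 \<Longrightarrow> q z = f z / P z"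
    using entire_extension[OF P P0, of "\<lambda>z. f z / P z"] by blast
  show ?thesis
    by (rule that[OF q(1)]) (metis q(2) zeros mult_zero_right nonzero_eq_divide_eq)
qed

text \<open>The value type is arbitrary because this is applied to moduli and to predicates on
  points, such as being a zero.\<close>

lemma shift_of_int:
  fixes F :: "complex \<Rightarrow> 'a"
  assumes "\<And>w. F (w + c) = F w"
  shows "F (w + of_int n * c) = F w"
proof (induction n rule: int_induct[where k = 0])
  case (step1 i)
  then show ?case using assms[of "w + of_int i * c"] by (simp add: algebra_simps)
next
  case (step2 i)
  then show ?case using assms[of "w + of_int (i - 1) * c"] by (simp add: algebra_simps)
qed simp

section \<open>The period lattice and Liouville arguments\<close>

lemma complex_lattice_coords:
  assumes "Im \<tau> > 0"
  obtains a b where "w = of_real a + of_real b * \<tau>"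
proof
  show "w = of_real (Re w - Im w / Im \<tau> * Re \<tau>) + of_real (Im w / Im \<tau>) * \<tau>"
    using assms by (auto simp: complex_eq_iff)
qed

lemma period_lattice_iff: "x \<in> period_lattice \<tau> \<longleftrightarrow> (\<exists>m n. x = of_int m + of_int n * \<tau>)"
  by (auto simp: period_lattice_def)

lemma period_lattice_add:
  assumes "x \<in> period_lattice \<tau>" "y \<in> period_lattice \<tau>"
  shows "x + y \<in> period_lattice \<tau>"
proof -
  obtain m n m' n' where "x = of_int m + of_int n * \<tau>" "y = of_int m' + of_int n' * \<tau>"
    using assms by (auto simp: period_lattice_iff)
  then have "x + y = of_int (m + m') + of_int (n + n') * \<tau>"
    by (simp add: algebra_simps)
  then show ?thesis unfolding period_lattice_iff by blast
qed

lemma period_lattice_minus_iff: "- x \<in> period_lattice \<tau> \<longleftrightarrow> x \<in> period_lattice \<tau>"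
proof -
  have "- x \<in> period_lattice \<tau>" if x: "x \<in> period_lattice \<tau>" for x
  proof -
    obtain m n where "x = of_int m + of_int n * \<tau>"
      using x by (auto simp: period_lattice_iff)
    then have "- x = of_int (- m) + of_int (- n) * \<tau>"
      by (simp add: algebra_simps)
    then show ?thesis unfolding period_lattice_iff by blast
  qed
  from this[of x] this[of "- x"] show ?thesis by auto
qed

lemma period_lattice_diff:
  "x \<in> period_lattice \<tau> \<Longrightarrow> y \<in> period_lattice \<tau> \<Longrightarrow> x - y \<in> period_lattice \<tau>"
  using period_lattice_add[of x \<tau> "- y"] by (simp add: period_lattice_minus_iff)

text \<open>Since \<beta> is real, \<open>exp (- (\<i> * \<beta> * w))\<close> keeps its modulus
  under \<open>w + 1\<close>; its value is tuned so that the modulus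
  \<open>exp (- 2 * pi * Im s)\<close> of the other multiplier is compensated. Thus
  \<open>norm (r w)\<close> is doubly periodic, hence bounded by its values on a period
  parallelogram, and Liouville applies to \<open>r\<close>.\<close>

lemma quasi_periodic_entire_exp:
  assumes tau: "Im \<tau> > 0" and q: "q holomorphic_on UNIV"
    and q1: "\<And>w. q (w + 1) = q w" and qt: "\<And>w. q (w + \<tau>) = exp (2 * of_real pi * \<i> * s) * q w"
  obtains C \<beta> where "\<And>w. q w = C * exp (\<i> * of_real \<beta> * w)" "\<beta> = 2 * pi * Im s / Im \<tau>"
proof -
  define \<beta> where "\<beta> = 2 * pi * Im s / Im \<tau>"
  define r where "r = (\<lambda>w. q w * exp (- (\<i> * of_real \<beta> * w)))"
  have "norm (r (w + 1)) = norm (r w)" for w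
    by (simp add: r_def q1 norm_mult)
  then have r1: "norm (r (w + of_int n)) = norm (r w)" for w n
    using shift_of_int[of "norm \<circ> r" 1] by simp
  have "norm (r (w + \<tau>)) = norm (r w)" for w
  proof -
    have "norm (r (w + \<tau>)) = norm (q w) * (exp (- 2 * pi * Im s) * exp (\<beta> * (Im w + Im \<tau>)))"
      by (simp add: r_def qt norm_mult)
    also have "exp (- 2 * pi * Im s) * exp (\<beta> * (Im w + Im \<tau>)) = exp (\<beta> * Im w)"
      using tau by (simp add: \<beta>_def distrib_left flip: exp_add)
    finally show ?thesis by (simp add: r_def norm_mult)
  qed
  then have rt: "norm (r (w + of_int n * \<tau>)) = norm (r w)" for w n
    using shift_of_int[of "norm \<circ> r" \<tau>] by simp
  define K where "K = (\<lambda>(a, b). of_real a + of_real b * \<tau>) ` ({0..1::real} \<times> {0..1::real})"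
  have hr: "r holomorphic_on UNIV"
    unfolding r_def by (intro holomorphic_intros q)
  have "compact K"
    unfolding K_def case_prod_unfold
    by (intro compact_continuous_image compact_Times continuous_intros) auto
  then have "bounded (r ` K)"
    by (intro compact_imp_bounded compact_continuous_image)
       (use hr holomorphic_on_imp_continuous_on continuous_on_subset in blast)+
  then obtain B where B: "\<And>w. w \<in> K \<Longrightarrow> norm (r w) \<le> B"
    by (auto simp: bounded_iff)
  have "norm (r w) \<le> B" for w
  proof -
    obtain a b where ab: "w = of_real a + of_real b * \<tau>"
      using complex_lattice_coords[OF tau] by metis
    define w' where "w' = of_real (frac a) + of_real (frac b) * \<tau>"
    have "w = w' + of_int \<lfloor>b\<rfloor> * \<tau> + of_int \<lfloor>a\<rfloor>"
      by (simp add: ab w'_def frac_def algebra_simps)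
    then have "norm (r w) = norm (r w')"
      by (simp only: r1 rt)
    moreover have "w' \<in> K"
      unfolding K_def w'_def
      by (rule image_eqI[of _ _ "(frac a, frac b)"])
         (auto simp: frac_lt_1 less_imp_le)
    ultimately show ?thesis using B by simp
  qed
  then have "bounded (range r)"
    by (auto simp: bounded_iff)
  then obtain C where C: "\<And>w. r w = C"
    using Liouville_theorem[OF hr] by (auto simp: constant_on_def)
  have "q w = C * exp (\<i> * of_real \<beta> * w)" for w
    using C[of w] by (auto simp: r_def exp_minus field_simps)
  then show ?thesis
    using that \<beta>_def by blast
qed

lemma periodic_entire_const:
  assumes tau: "Im \<tau> > 0" and q: "q holomorphic_on UNIV"
    and q1: "\<And>w. q (w + 1) = q w" and qt: "\<And>w. q (w + \<tau>) = q w"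
  shows "q w = q 0"
proof -
  obtain C \<beta> where "\<And>w. q w = C * exp (\<i> * of_real \<beta> * w)" "\<beta> = 2 * pi * Im 0 / Im \<tau>"
    by (rule quasi_periodic_entire_exp[OF tau q q1, of 0]) (use qt in auto)
  then show ?thesis by simp
qed

text \<open>A nonzero exponential of period 1 has frequency \<beta> equal to 2 pi n. Its multiplier
  under \<tau> is then that of \<open>s = n * \<tau>\<close>, and comparing exponents puts
  \<open>s\<close> into the lattice.\<close>

lemma quasi_periodic_entire_zero:
  assumes tau: "Im \<tau> > 0" and q: "q holomorphic_on UNIV"
    and q1: "\<And>w. q (w + 1) = q w" and qt: "\<And>w. q (w + \<tau>) = exp (2 * of_real pi * \<i> * s) * q w"
    and s: "s \<notin> period_lattice \<tau>"
  shows "q w = 0"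
proof -
  obtain C \<beta> where C: "\<And>w. q w = C * exp (\<i> * of_real \<beta> * w)"
    by (rule quasi_periodic_entire_exp[OF tau q q1 qt]) blast
  have "C = 0"
  proof (rule ccontr)
    assume "C \<noteq> 0"
    have "exp (\<i> * of_real \<beta>) = 1"
      using q1[of 0] C \<open>C \<noteq> 0\<close> by simp
    then obtain n where "\<beta> = of_int (2 * n) * pi"
      by (auto simp: exp_eq_1)
    then have n: "complex_of_real \<beta> = of_int n * (2 * of_real pi)"
      by simp
    have "exp (\<i> * of_real \<beta> * \<tau>) = exp (2 * of_real pi * \<i> * s)"
      using qt[of 0] C \<open>C \<noteq> 0\<close> by simp
    then obtain k where "\<i> * of_real \<beta> * \<tau> = 2 * of_real pi * \<i> * s + of_int (2 * k) * of_real pi * \<i>"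
      by (auto simp: exp_eq)
    then have "2 * of_real pi * \<i> * s = 2 * of_real pi * \<i> * (of_int (- k) + of_int n * \<tau>)"
      using n by (simp add: algebra_simps)
    then have "s = of_int (- k) + of_int n * \<tau>"
      by (subst (asm) mult_cancel_left) simp
    then show False
      using s unfolding period_lattice_iff by blast
  qed
  then show ?thesis using C by simp
qed

lemma holomorphic_on_compose_entire:
  assumes "q holomorphic_on UNIV" "f holomorphic_on A"
  shows "(\<lambda>z. q (f z)) holomorphic_on A"
  using holomorphic_on_compose_gen[OF assms(2,1)] by (simp add: o_def)

text \<open>Carries identities that are checked only after multiplication by \<open>P\<close> over
  to the zeros of \<open>P\<close>, by the identity theorem.\<close>

lemma entire_cancel:
  assumes "P holomorphic_on UNIV" "P z0 \<noteq> 0" "f holomorphic_on UNIV" "g holomorphic_on UNIV"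
    and eq: "\<And>z. f z * P z = g z * P z"
  shows "f z = g z"
proof -
  have "open {z. P z \<noteq> 0}"
    using open_Collect_neq[of P "\<lambda>_. 0"] assms(1) holomorphic_on_imp_continuous_on by auto
  then show ?thesis
    using analytic_continuation_open[of "{z. P z \<noteq> 0}" UNIV f g z] assms by auto
qed

text \<open>The nonconstant multiplier \<open>B\<close> shared by \<open>f\<close> and
  \<open>P\<close> cancels in the quotient and leaves the constant \<open>k\<close>.\<close>

lemma quotient_multiplier:
  assumes P: "P holomorphic_on UNIV" "P z0 \<noteq> 0" and q: "q holomorphic_on UNIV"
    and f: "\<And>w. f w = q w * P w" "\<And>w. f (w + c) = k * (B w * f w)"
    and Pc: "\<And>w. P (w + c) = B w * P w" and B: "\<And>w. B w \<noteq> 0"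
  shows "q (w + c) = k * q w"
proof (rule entire_cancel[OF P, where f = "\<lambda>w. q (w + c)" and g = "\<lambda>w. k * q w"])
  show "(\<lambda>w. q (w + c)) holomorphic_on UNIV"
    by (intro holomorphic_on_compose_entire[OF q] holomorphic_intros)
  show "(\<lambda>w. k * q w) holomorphic_on UNIV"
    by (intro holomorphic_intros q)
  show "q (w + c) * P w = k * q w * P w" for w
  proof -
    have "B w * (q (w + c) * P w) = B w * (k * q w * P w)"
      using f(2)[of w] unfolding f(1) Pc by (simp only: mult_ac)
    then show ?thesis using B[of w] by simp
  qed
qed

lemma zero_iff_mod_lattice:
  fixes f :: "complex \<Rightarrow> complex"
  assumes "\<And>w. f (w + 1) = 0 \<longleftrightarrow> f w = 0" "\<And>w. f (w + \<tau>) = 0 \<longleftrightarrow> f w = 0"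
    and "x - y \<in> period_lattice \<tau>"
  shows "f x = 0 \<longleftrightarrow> f y = 0"
proof -
  obtain m n where "x = (y + of_int m * 1) + of_int n * \<tau>"
    using assms(3) unfolding period_lattice_iff by (metis add.assoc add.commute diff_add_cancel mult.right_neutral)
  then show ?thesis
    using shift_of_int[of "\<lambda>w. f w = 0" 1 y m] shift_of_int[of "\<lambda>w. f w = 0" \<tau> "y + of_int m * 1" n] assms
    by simp
qed

text \<open>At a zero of \<open>P\<close> the term with the derivative of \<open>e\<close> drops out
  of the product rule, which leaves \<open>deriv P (s + c) = e s * deriv P s\<close>.\<close>

lemma simple_zero_shift:
  assumes P: "P holomorphic_on UNIV" and e: "e holomorphic_on UNIV" and nz: "\<And>w. e w \<noteq> 0"
    and Pc: "\<And>w. P (w + c) = e w * P w"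
  shows "(P (s + c) = 0 \<and> deriv P (s + c) \<noteq> 0) = (P s = 0 \<and> deriv P s \<noteq> (0::complex))"
proof -
  have "((\<lambda>w. P (w + c)) has_field_derivative deriv P (s + c)) (at s)"
    by (rule DERIV_shift[THEN iffD1]) (auto intro!: holomorphic_derivI[OF P])
  moreover have "((\<lambda>w. e w * P w) has_field_derivative (deriv e s * P s + deriv P s * e s)) (at s)"
    by (auto intro!: DERIV_mult holomorphic_derivI[OF P] holomorphic_derivI[OF e])
  ultimately have "deriv P (s + c) = deriv e s * P s + deriv P s * e s"
    unfolding Pc by (rule DERIV_unique)
  then show ?thesis
    using nz Pc by auto
qed

subsection \<open>Theta series\<close>

text \<open>Expanding the square moves the cross term into the argument. Holomorphy and not being
  identically zero thus need proof only for zero characteristics.\<close>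

lemma theta_char_reduce:
  "theta_char a b z \<tau> = exp (of_real pi * \<i> * \<tau> * a\<^sup>2 + 2 * of_real pi * \<i> * a * (z + b))
     * theta_char 0 0 (z + b + a * \<tau>) \<tau>"
  unfolding theta_char_def infsum_cmult_right'[symmetric]
  by (intro infsum_cong) (simp add: algebra_simps power2_eq_square flip: exp_add)

text \<open>Here \<open>c\<close> may be any complex number: \<open>c = 1\<close> gives the
  quasi-period, and \<open>c = 1 / N\<close> links neighbouring components of a column of
  \<open>g\<close>.\<close>

lemma theta_char_shift:
  "theta_char a b (z + c * \<tau>) \<tau> =
     exp (- (of_real pi * \<i> * \<tau> * c\<^sup>2 + 2 * of_real pi * \<i> * c * (z + b))) * theta_char (a + c) b z \<tau>"
  unfolding theta_char_def infsum_cmult_right'[symmetric]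
  by (intro infsum_cong) (simp add: algebra_simps power2_eq_square flip: exp_add)

lemma theta_char_add_char: "theta_char a (b + d) z \<tau> = theta_char a b (z + d) \<tau>"
  unfolding theta_char_def by (intro infsum_cong) (simp add: algebra_simps)

lemma theta_char_int_char: "theta_char (a + of_int n) b z \<tau> = theta_char a b z \<tau>"
  unfolding theta_char_def
  by (rule infsum_reindex_bij_witness[where j = "\<lambda>j. j + n" and i = "\<lambda>j. j - n"])
     (auto simp: algebra_simps)

lemma theta_char_add_int:
  "theta_char a b (z + of_int m) \<tau> = exp (2 * of_real pi * \<i> * a * of_int m) * theta_char a b z \<tau>"
proof -
  have "exp (of_real pi * \<i> * \<tau> * (of_int j + a)\<^sup>2 + 2 * of_real pi * \<i> * (of_int j + a) * (z + of_int m + b)) =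
        exp (2 * of_real pi * \<i> * a * of_int m) *
        exp (of_real pi * \<i> * \<tau> * (of_int j + a)\<^sup>2 + 2 * of_real pi * \<i> * (of_int j + a) * (z + b))" for j :: int
  proof -
    have "exp (2 * of_real pi * \<i> * of_int (j * m)) = 1"
      using exp_integer_2pi[of "of_int (j * m)"] by (simp add: mult_ac)
    moreover have "of_real pi * \<i> * \<tau> * (of_int j + a)\<^sup>2 + 2 * of_real pi * \<i> * (of_int j + a) * (z + of_int m + b) =
        2 * of_real pi * \<i> * of_int (j * m) + (2 * of_real pi * \<i> * a * of_int m +
        (of_real pi * \<i> * \<tau> * (of_int j + a)\<^sup>2 + 2 * of_real pi * \<i> * (of_int j + a) * (z + b)))"
      by (simp add: algebra_simps)
    ultimately show ?thesis
      by (simp only: exp_add mult_1)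
  qed
  then show ?thesis
    unfolding theta_char_def infsum_cmult_right'[symmetric] by (intro infsum_cong)
qed

lemma theta_char_minus: "theta_char (- a) (- b) (- z) \<tau> = theta_char a b z \<tau>"
  unfolding theta_char_def
  by (rule infsum_reindex_bij_witness[where j = uminus and i = uminus])
     (auto simp: algebra_simps power2_eq_square)

section \<open>Locally uniform convergence of the theta series\<close>

lemma summable_on_exp_minus_abs: "(\<lambda>j::int. exp (- \<bar>real_of_int j\<bar>)) summable_on UNIV"
proof -
  have "summable (\<lambda>n. exp (- real n))"
    using summable_geometric[of "exp (-1 :: real)"] by (simp flip: exp_of_nat_mult)
  then have *: "(\<lambda>n. exp (- real n)) summable_on UNIV"
    by (subst summable_on_UNIV_nonneg_real_iff) auto
  have "(\<lambda>j::int. exp (- \<bar>real_of_int j\<bar>)) summable_on range int"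
    using * by (subst summable_on_reindex) (auto simp: o_def inj_on_def)
  moreover have "(\<lambda>j::int. exp (- \<bar>real_of_int j\<bar>)) summable_on range (\<lambda>n. - int n)"
    using * by (subst summable_on_reindex) (auto simp: o_def inj_on_def)
  ultimately have "(\<lambda>j::int. exp (- \<bar>real_of_int j\<bar>)) summable_on (range int \<union> range (\<lambda>n. - int n))"
    by (rule summable_on_union)
  also have "range int \<union> range (\<lambda>n. - int n) = UNIV"
    by (auto simp: image_iff) (metis int_cases2)
  finally show ?thesis .
qed

text \<open>With \<open>x = \<bar>j\<bar>\<close> the exponent has real part at most
  \<open>- t * x\<^sup>2 + 2 * pi * Y * x\<close>. The extra 1 in \<open>c\<close> reserves a decay
  of \<open>- x\<close>, and completing the square bounds the rest by
  \<open>c\<^sup>2 / (4 * t)\<close>.\<close>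

lemma theta_term_bound:
  assumes tau: "Im \<tau> > 0" and "\<bar>Im z\<bar> \<le> Y"
  shows "norm (exp (of_real pi * \<i> * \<tau> * (of_int j)\<^sup>2 + 2 * of_real pi * \<i> * of_int j * z))
          \<le> exp ((2 * pi * Y + 1)\<^sup>2 / (4 * pi * Im \<tau>)) * exp (- \<bar>real_of_int j\<bar>)"
proof -
  define x c t where "x = \<bar>real_of_int j\<bar>" and "c = 2 * pi * Y + 1" and "t = pi * Im \<tau>"
  have t: "t > 0" using tau by (simp add: t_def)
  have "0 \<le> (t * x - c / 2)\<^sup>2 / t" using t by simp
  also have "\<dots> = t * x\<^sup>2 - c * x + c\<^sup>2 / (4 * t)"
    using t by (simp add: field_simps power2_eq_square)
  finally have *: "- t * x\<^sup>2 + 2 * pi * Y * x \<le> c\<^sup>2 / (4 * t) - x"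
    by (simp add: c_def algebra_simps)
  have "- (real_of_int j * Im z) \<le> x * Y"
  proof -
    have "- (real_of_int j * Im z) \<le> \<bar>real_of_int j\<bar> * \<bar>Im z\<bar>"
      by (metis abs_ge_minus_self abs_mult)
    also have "\<dots> \<le> x * Y"
      unfolding x_def using assms(2) by (intro mult_left_mono) auto
    finally show ?thesis .
  qed
  then have "- (2 * pi * (real_of_int j * Im z)) \<le> 2 * pi * Y * x"
    using mult_left_mono[of "- (real_of_int j * Im z)" "x * Y" "2 * pi"] by (simp add: algebra_simps)
  moreover have "Re (of_real pi * \<i> * \<tau> * (of_int j)\<^sup>2 + 2 * of_real pi * \<i> * of_int j * z) =
      - t * x\<^sup>2 - 2 * pi * (real_of_int j * Im z)"
    by (simp add: t_def x_def power2_eq_square algebra_simps)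
  ultimately have "Re (of_real pi * \<i> * \<tau> * (of_int j)\<^sup>2 + 2 * of_real pi * \<i> * of_int j * z) \<le> c\<^sup>2 / (4 * t) - x"
    using * by linarith
  then show ?thesis
    by (simp add: c_def t_def x_def mult.assoc flip: exp_add)
qed

text \<open>Stated along a map \<open>f\<close> because it serves two purposes: discs in the plane
  for holomorphy, and the real segment from 0 to 1 for the Fourier coefficient.\<close>

lemma theta_uniform_limit:
  assumes tau: "Im \<tau> > 0" and Y: "\<And>y. y \<in> A \<Longrightarrow> \<bar>Im (f y)\<bar> \<le> Y"
  shows "uniform_limit A
     (\<lambda>X y. \<Sum>j\<in>X. exp (of_real pi * \<i> * \<tau> * (of_int j)\<^sup>2 + 2 * of_real pi * \<i> * of_int j * f y))
     (\<lambda>y. theta_char 0 0 (f y) \<tau>) (finite_subsets_at_top UNIV)"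
  unfolding theta_char_def add_0_right
  by (rule Weierstrass_m_test_general[OF theta_term_bound[OF tau Y]])
     (assumption | intro summable_on_cmult_right summable_on_exp_minus_abs)+

lemma holomorphic_theta_char [holomorphic_intros]:
  assumes tau: "Im \<tau> > 0" and f: "f holomorphic_on A"
  shows "(\<lambda>z. theta_char a b (f z) \<tau>) holomorphic_on A"
proof -
  have "(\<lambda>z. theta_char 0 0 z \<tau>) field_differentiable (at z)" for z
  proof -
    have "(\<lambda>z. theta_char 0 0 z \<tau>) holomorphic_on ball z 1"
    proof (rule holomorphic_uniform_limit)
      show "uniform_limit (cball z 1)
        (\<lambda>X y. \<Sum>j\<in>X. exp (of_real pi * \<i> * \<tau> * (of_int j)\<^sup>2 + 2 * of_real pi * \<i> * of_int j * y))
        (\<lambda>y. theta_char 0 0 y \<tau>) (finite_subsets_at_top UNIV)"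
      proof (rule theta_uniform_limit[OF tau])
        fix y assume "y \<in> cball z 1"
        then have "\<bar>Im y - Im z\<bar> \<le> 1"
          using abs_Im_le_cmod[of "y - z"] by (simp add: dist_norm norm_minus_commute)
        then show "\<bar>Im y\<bar> \<le> \<bar>Im z\<bar> + 1" by linarith
      qed
    qed (auto intro!: always_eventually holomorphic_intros continuous_intros)
    then show ?thesis
      by (auto simp: holomorphic_on_open field_differentiable_def)
  qed
  then have "(\<lambda>z. theta_char 0 0 z \<tau>) holomorphic_on UNIV"
    by (simp add: holomorphic_on_def)
  then have "(\<lambda>z. theta_char 0 0 (f z + b + a * \<tau>) \<tau>) holomorphic_on A"
    by (rule holomorphic_on_compose_entire) (intro holomorphic_intros f)
  then show ?thesis
    by (subst theta_char_reduce) (intro holomorphic_intros f)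
qed

lemma has_integral_exp_period:
  assumes "j \<noteq> (0::int)"
  shows "((\<lambda>x. exp (2 * of_real pi * \<i> * of_int j * complex_of_real x)) has_integral 0) {0..1}"
proof -
  define c where "c = 2 * of_real pi * \<i> * complex_of_int j"
  have c: "c \<noteq> 0" using assms by (simp add: c_def)
  have "exp c = 1"
    using exp_integer_2pi[of "of_int j"] by (simp add: c_def mult_ac)
  have "((\<lambda>x. exp (c * of_real x)) has_integral (exp (c * of_real 1) / c - exp (c * of_real 0) / c)) {0..1}"
  proof (rule fundamental_theorem_of_calculus)
    fix x :: real
    have "((\<lambda>z. exp (c * z) / c) has_field_derivative exp (c * of_real x)) (at (of_real x))"
      using c by (auto intro!: derivative_eq_intros)
    then show "((\<lambda>x. exp (c * of_real x) / c) has_vector_derivative exp (c * of_real x)) (at x within {0..1})"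
      by (rule has_vector_derivative_real_field)
  qed simp
  then show ?thesis
    using \<open>exp c = 1\<close> by (simp add: c_def)
qed

text \<open>The zeroth Fourier coefficient is \<open>1\<close>.\<close>
lemma theta_char_0_0_nonzero:
  assumes tau: "Im \<tau> > 0"
  obtains z where "theta_char 0 0 z \<tau> \<noteq> 0"
proof (rule ccontr)
  assume "\<not> thesis"
  then have zero: "theta_char 0 0 z \<tau> = 0" for z using that by blast
  let ?f = "\<lambda>X x. \<Sum>j\<in>X. exp (of_real pi * \<i> * \<tau> * (of_int j)\<^sup>2 + 2 * of_real pi * \<i> * of_int j * complex_of_real x)"
  have "uniform_limit {0..1::real} ?f (\<lambda>x. theta_char 0 0 (complex_of_real x) \<tau>) (finite_subsets_at_top UNIV)"
    by (rule theta_uniform_limit[OF tau, where Y = 0]) simp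
  then obtain I J where I: "\<And>X. (?f X has_integral I X) {0..1}"
    and J: "((\<lambda>x. theta_char 0 0 (complex_of_real x) \<tau>) has_integral J) {0..1}"
    and IJ: "(I \<longlongrightarrow> J) (finite_subsets_at_top UNIV)"
    by (rule uniform_limit_integral) (auto intro!: continuous_intros)
  have "J = 0"
    using J unfolding zero by (metis has_integral_0_eq)
  have "((\<lambda>x. exp (of_real pi * \<i> * \<tau> * (of_int j)\<^sup>2 + 2 * of_real pi * \<i> * of_int j * complex_of_real x))
      has_integral (if j = 0 then 1 else 0)) {0..1}" for j :: int
  proof (cases "j = 0")
    case True
    then show ?thesis using has_integral_const_real[of "1::complex" 0 1] by simp
  next
    case False
    then show ?thesis
      using has_integral_mult_right[OF has_integral_exp_period[OF False], of "exp (of_real pi * \<i> * \<tau> * (of_int j)\<^sup>2)"]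
      by (simp add: exp_add)
  qed
  then have "(?f X has_integral (\<Sum>j\<in>X. if j = 0 then 1 else 0)) {0..1}" if "finite X" for X
    by (intro has_integral_sum that)
  then have "I X = 1" if "finite X" "0 \<in> X" for X
    using that has_integral_unique[OF I[of X]] by fastforce
  \<comment> \<open>Every finite partial sum that contains \<open>j = 0\<close> has integral exactly
    1, so the net of integrals is eventually constant.\<close>
  then have "eventually (\<lambda>X. I X = 1) (finite_subsets_at_top UNIV)"
    unfolding eventually_finite_subsets_at_top by (intro exI[of _ "{0}"]) auto
  then have "(I \<longlongrightarrow> 1) (finite_subsets_at_top UNIV)"
    by (rule tendsto_eventually)
  then have "J = 1"
    using IJ tendsto_unique[of "finite_subsets_at_top UNIV"] by fastforce
  then show False using \<open>J = 0\<close> by simp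
qed

subsection \<open>The odd theta function and its zeros\<close>

lemma vartheta_add_1: "vartheta \<tau> (w + 1) = - vartheta \<tau> w"
  using theta_char_add_int[of "1/2" "1/2" w 1 \<tau>] by (simp add: vartheta_def)

lemma vartheta_add_tau:
  "vartheta \<tau> (w + \<tau>) = - exp (- (of_real pi * \<i> * \<tau> + 2 * of_real pi * \<i> * w)) * vartheta \<tau> w"
proof -
  have "- (of_real pi * \<i> * \<tau> + 2 * of_real pi * \<i> * (w + 1/2)) =
        - (of_real pi * \<i> * \<tau> + 2 * of_real pi * \<i> * w) + - (of_real pi * \<i>)"
    by (simp add: algebra_simps)
  moreover have "exp (- (complex_of_real pi * \<i>)) = - 1"
    by (simp add: exp_minus)
  ultimately have "exp (- (of_real pi * \<i> * \<tau> + 2 * of_real pi * \<i> * (w + 1/2))) =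
      - exp (- (of_real pi * \<i> * \<tau> + 2 * of_real pi * \<i> * w))"
    by (simp only: exp_add mult_minus_right mult_1_right)
  then show ?thesis
    using theta_char_shift[of "1/2" "1/2" w 1 \<tau>] theta_char_int_char[of "1/2" 1 "1/2" w \<tau>]
    by (simp add: vartheta_def)
qed

text \<open>The characteristics 1/2 and -1/2 differ by integers. Changing the upper one is free,
  while changing the lower one is a shift of the argument by 1 and costs
  \<open>exp (- (pi * \<i>))\<close>, that is, the sign.\<close>

lemma vartheta_minus: "vartheta \<tau> (- w) = - vartheta \<tau> w"
proof -
  have "vartheta \<tau> (- w) = theta_char (- (1/2) + of_int 1) (- (1/2) + 1) (- w) \<tau>"
    by (simp add: vartheta_def)
  also have "\<dots> = theta_char (- (1/2)) (- (1/2)) (- w + of_int 1) \<tau>"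
    unfolding theta_char_int_char theta_char_add_char by simp
  also have "\<dots> = - theta_char (- (1/2)) (- (1/2)) (- w) \<tau>"
    using theta_char_add_int[of "-(1/2)" "-(1/2)" "-w" 1 \<tau>] by (simp add: exp_minus)
  finally show ?thesis
    using theta_char_minus[of "1/2" "1/2" w \<tau>] by (simp add: vartheta_def)
qed

lemma vartheta_0 [simp]: "vartheta \<tau> 0 = 0"
  using vartheta_minus[of \<tau> 0] by simp

lemma holomorphic_vartheta [holomorphic_intros]:
  "Im \<tau> > 0 \<Longrightarrow> f holomorphic_on A \<Longrightarrow> (\<lambda>z. vartheta \<tau> (f z)) holomorphic_on A"
  unfolding vartheta_def by (rule holomorphic_theta_char)

lemma vartheta_nonzero:
  assumes "Im \<tau> > 0"
  obtains z where "vartheta \<tau> z \<noteq> 0"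
proof -
  obtain z where "theta_char 0 0 z \<tau> \<noteq> 0"
    using theta_char_0_0_nonzero[OF assms] .
  then have "vartheta \<tau> (z - 1/2 - 1/2 * \<tau>) \<noteq> 0"
    unfolding vartheta_def by (subst theta_char_reduce) (simp add: algebra_simps)
  then show ?thesis by (rule that)
qed

lemma vartheta_zero_period_lattice: "x \<in> period_lattice \<tau> \<Longrightarrow> vartheta \<tau> x = 0"
  using zero_iff_mod_lattice[of "vartheta \<tau>" \<tau> x 0]
  by (simp add: vartheta_add_1 vartheta_add_tau)

section \<open>The infinite product and the zeros of \<open>vartheta\<close>\<close>

definition qpoch :: "complex \<Rightarrow> complex \<Rightarrow> complex" where
  "qpoch p x = (\<Prod>n. 1 - p ^ n * x)"

lemma qpoch_convergent:
  fixes p x :: complex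
  assumes "norm p < 1"
  shows "convergent_prod (\<lambda>n. 1 - p ^ n * x)"
proof -
  have "summable (\<lambda>n. norm x * norm p ^ n)"
    using assms by (intro summable_mult summable_geometric) auto
  moreover have "norm x * norm p ^ n = norm (1 - p ^ n * x - 1)" for n
    by (simp add: norm_mult norm_power mult.commute)
  ultimately have "summable (\<lambda>n. norm (1 - p ^ n * x - 1))"
    by (simp only:)
  then have "abs_convergent_prod (\<lambda>n. 1 - p ^ n * x)"
    by (rule summable_imp_abs_convergent_prod)
  then show ?thesis
    by (rule abs_convergent_prod_imp_convergent_prod)
qed

lemma qpoch_rec:
  assumes "norm p < 1"
  shows "qpoch p x = (1 - x) * qpoch p (p * x)"
proof -
  have "(\<lambda>n. 1 - p ^ n * x) has_prod ((\<Prod>k<1. 1 - p ^ k * x) * (\<Prod>k. 1 - p ^ (k + 1) * x))"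
    by (rule has_prod_ignore_initial_segment'[OF qpoch_convergent[OF assms]])
  then have "qpoch p x = (\<Prod>k<1. 1 - p ^ k * x) * (\<Prod>k. 1 - p ^ (k + 1) * x)"
    unfolding qpoch_def by (rule has_prod_unique[symmetric])
  then show ?thesis
    by (simp add: qpoch_def mult_ac)
qed

lemma qpoch_eq_0:
  assumes "norm p < 1" "qpoch p x = 0"
  obtains n where "p ^ n * x = 1"
proof (rule ccontr)
  assume "\<not> thesis"
  then have "1 - p ^ n * x \<noteq> 0" for n using that[of n] by auto
  then have "qpoch p x \<noteq> 0"
    unfolding qpoch_def by (rule prodinf_nonzero[OF qpoch_convergent[OF assms(1)]])
  then show False using assms(2) by contradiction
qed

lemma holomorphic_qpoch:
  assumes "norm p < 1"
  shows "qpoch p holomorphic_on UNIV"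
proof (rule holomorphic_uniform_sequence[where f = "\<lambda>N x. \<Prod>n<N. 1 - p ^ n * x"])
  fix x :: complex
  have "uniformly_convergent_on (cball x 1) (\<lambda>N x. \<Sum>n<N. norm (1 - p ^ n * x - 1))"
  proof (rule Weierstrass_m_test'[where M = "\<lambda>n. (norm x + 1) * norm p ^ n"])
    fix n y assume "y \<in> cball x 1"
    then have "norm y \<le> norm x + 1"
      using norm_triangle_ineq4[of x "x - y"] by (simp add: dist_norm)
    then show "norm (norm (1 - p ^ n * y - 1)) \<le> (norm x + 1) * norm p ^ n"
      by (simp add: norm_mult norm_power mult.commute mult_left_mono mult_right_mono)
  next
    show "summable (\<lambda>n. (norm x + 1) * norm p ^ n)"
      using assms by (intro summable_mult summable_geometric) auto
  qed
  then have "uniformly_convergent_on (cball x 1) (\<lambda>N x. \<Prod>n<N. 1 - p ^ n * x)"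
    by (intro uniformly_convergent_on_prod') (auto intro!: continuous_intros)
  then obtain g where g: "uniform_limit (cball x 1) (\<lambda>N x. \<Prod>n<N. 1 - p ^ n * x) g sequentially"
    by (auto simp: uniformly_convergent_on_def)
  have geq: "g y = qpoch p y" if y: "y \<in> cball x 1" for y
  proof -
    have "(\<lambda>N. \<Prod>n<Suc N. 1 - p ^ n * y) \<longlonglongrightarrow> g y"
      using tendsto_uniform_limitI[OF g y] by (rule LIMSEQ_Suc)
    moreover have "(\<lambda>N. \<Prod>n<Suc N. 1 - p ^ n * y) \<longlonglongrightarrow> qpoch p y"
      using convergent_prod_LIMSEQ[OF qpoch_convergent[OF assms, of y]]
      by (simp add: qpoch_def lessThan_Suc_atMost)
    ultimately show ?thesis using LIMSEQ_unique by blast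
  qed
  have "uniform_limit (cball x 1) (\<lambda>N x. \<Prod>n<N. 1 - p ^ n * x) g sequentially \<longleftrightarrow>
    uniform_limit (cball x 1) (\<lambda>N x. \<Prod>n<N. 1 - p ^ n * x) (qpoch p) sequentially"
    by (intro uniform_limit_cong' refl geq)
  then have "uniform_limit (cball x 1) (\<lambda>N x. \<Prod>n<N. 1 - p ^ n * x) (qpoch p) sequentially"
    using g by simp
  then show "\<exists>d>0. cball x d \<subseteq> UNIV \<and> uniform_limit (cball x d) (\<lambda>N x. \<Prod>n<N. 1 - p ^ n * x) (qpoch p) sequentially"
    by (intro exI[of _ 1]) auto
qed (auto intro!: holomorphic_intros)

text \<open>Up to the factor \<open>exp (- \<pi> i w)\<close> and a constant, this is the Jacobi triple product for
  \<open>\<vartheta>\<close>; its zeros can be read off.\<close>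
definition theta_prod :: "complex \<Rightarrow> complex \<Rightarrow> complex" where
  "theta_prod \<tau> w = qpoch (exp (2 * of_real pi * \<i> * \<tau>)) (exp (2 * of_real pi * \<i> * w)) *
     qpoch (exp (2 * of_real pi * \<i> * \<tau>)) (exp (2 * of_real pi * \<i> * \<tau>) * exp (- (2 * of_real pi * \<i> * w)))"

context
  fixes \<tau> :: complex
  assumes tau: "Im \<tau> > 0"
begin

private lemma norm_nome: "norm (exp (2 * of_real pi * \<i> * \<tau>)) < 1"
  using tau by simp

lemma holomorphic_theta_prod: "theta_prod \<tau> holomorphic_on UNIV"
  unfolding theta_prod_def[abs_def]
  by (intro holomorphic_on_mult holomorphic_on_compose_entire[OF holomorphic_qpoch[OF norm_nome]])
     (intro holomorphic_intros)+

lemma theta_prod_add_1: "theta_prod \<tau> (w + 1) = theta_prod \<tau> w"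
proof -
  have "exp (2 * of_real pi * \<i> * (w + 1)) = exp (2 * of_real pi * \<i> * w)"
    by (simp add: distrib_left exp_add)
  moreover have "exp (- (2 * of_real pi * \<i> * (w + 1))) = exp (- (2 * of_real pi * \<i> * w))"
    by (simp only: exp_minus calculation)
  ultimately show ?thesis
    by (simp only: theta_prod_def)
qed

text \<open>Replacing \<open>x\<close> by \<open>p * x\<close> removes the factor
  \<open>1 - x\<close> from the first product and adds \<open>1 - 1 / x\<close> to the second; their
  quotient is \<open>- 1 / x\<close>.\<close>

lemma theta_prod_add_tau: "theta_prod \<tau> (w + \<tau>) = - exp (- (2 * of_real pi * \<i> * w)) * theta_prod \<tau> w"
proof -
  define p where "p = exp (2 * of_real pi * \<i> * \<tau>)"
  define x where "x = exp (2 * of_real pi * \<i> * w)"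
  have x: "x \<noteq> 0" "p \<noteq> 0" "norm p < 1" by (auto simp: x_def p_def tau)
  have "theta_prod \<tau> (w + \<tau>) = qpoch p (p * x) * qpoch p (1 / x)"
  proof -
    have "exp (2 * of_real pi * \<i> * (w + \<tau>)) = p * x"
      unfolding x_def p_def exp_add[symmetric] by (simp add: algebra_simps)
    moreover have "p * exp (- (2 * of_real pi * \<i> * (w + \<tau>))) = 1 / x"
      using x unfolding exp_minus calculation by (simp add: field_simps)
    ultimately show ?thesis unfolding theta_prod_def p_def[symmetric] by simp
  qed
  also have "\<dots> = qpoch p (p * x) * ((1 - 1 / x) * qpoch p (p * (1 / x)))"
    using qpoch_rec[OF x(3), of "1 / x"] by simp
  also have "\<dots> = - (1 / x) * ((1 - x) * qpoch p (p * x) * qpoch p (p * (1 / x)))"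
    using x by (simp add: field_simps)
  also have "\<dots> = - (1 / x) * (qpoch p x * qpoch p (p * (1 / x)))"
    by (subst qpoch_rec[OF x(3), of x]) simp
  also have "1 / x = exp (- (2 * of_real pi * \<i> * w))"
    by (simp add: x_def exp_minus field_simps)
  finally show ?thesis
    by (simp add: theta_prod_def x_def p_def)
qed

lemma theta_prod_zero_imp:
  assumes "theta_prod \<tau> w = 0"
  shows "w \<in> period_lattice \<tau>"
proof -
  let ?p = "exp (2 * of_real pi * \<i> * \<tau>)"
  have mem: "w \<in> period_lattice \<tau>" if "exp (2 * of_real pi * \<i> * (of_int n * \<tau> + w)) = 1" for n w
  proof -
    have "exp (2 * of_real pi * \<i> * (of_int n * \<tau> + w)) = exp 0" using that by simp
    then obtain m where "2 * of_real pi * \<i> * (of_int n * \<tau> + w) = 0 + complex_of_real (real_of_int (2 * m) * pi) * \<i>"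
      unfolding exp_eq by blast
    then have "2 * of_real pi * \<i> * (of_int n * \<tau> + w) = 2 * of_real pi * \<i> * of_int m"
      by (simp add: mult_ac)
    then have "w = of_int m + of_int (- n) * \<tau>"
      by (subst (asm) mult_cancel_left) (simp add: algebra_simps)
    then show ?thesis unfolding period_lattice_iff by blast
  qed
  from assms consider "qpoch ?p (exp (2 * of_real pi * \<i> * w)) = 0"
    | "qpoch ?p (?p * exp (- (2 * of_real pi * \<i> * w))) = 0"
    by (auto simp: theta_prod_def)
  then show ?thesis
  proof cases
    case 1
    then obtain n where "?p ^ n * exp (2 * of_real pi * \<i> * w) = 1"
      using qpoch_eq_0[OF norm_nome] by blast
    then have "exp (2 * of_real pi * \<i> * (of_int (int n) * \<tau> + w)) = 1"
      unfolding exp_of_nat_mult[symmetric] exp_add[symmetric] by (simp add: algebra_simps)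
    then show ?thesis by (rule mem)
  next
    case 2
    then obtain n where "?p ^ n * (?p * exp (- (2 * of_real pi * \<i> * w))) = 1"
      using qpoch_eq_0[OF norm_nome] by blast
    \<comment> \<open>\<open>Suc n\<close> comes from the additional factor \<open>p\<close> in the
      argument of the second product.\<close>
    then have "exp (2 * of_real pi * \<i> * (of_int (int (Suc n)) * \<tau> + (- w))) = 1"
      unfolding exp_of_nat_mult[symmetric] exp_add[symmetric] by (simp add: algebra_simps)
    then have "- w \<in> period_lattice \<tau>" by (rule mem)
    then show ?thesis by (simp add: period_lattice_minus_iff)
  qed
qed

text \<open>Splitting off \<open>1 - exp (2 * pi * \<i> * w)\<close>, which vanishes to first order
  at 0, leaves a cofactor with value \<open>qpoch p p\<close> squared at 0, and this is nonzero. The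
  multipliers carry the result to the whole lattice.\<close>

lemma theta_prod_simple_zero:
  assumes "w \<in> period_lattice \<tau>"
  shows "theta_prod \<tau> w = 0" "deriv (theta_prod \<tau>) w \<noteq> 0"
proof -
  define p where "p = exp (2 * of_real pi * \<i> * \<tau>)"
  have np: "norm p < 1" by (simp add: p_def tau)
  define F where "F = (\<lambda>w. qpoch p (p * exp (2 * of_real pi * \<i> * w)) * qpoch p (p * exp (- (2 * of_real pi * \<i> * w))))"
  have F: "theta_prod \<tau> w = (1 - exp (2 * of_real pi * \<i> * w)) * F w" for w
    unfolding theta_prod_def F_def p_def by (subst qpoch_rec[OF norm_nome]) simp
  have "qpoch p p \<noteq> 0"
  proof
    assume "qpoch p p = 0"
    then obtain n where "p ^ n * p = 1" using qpoch_eq_0[OF np] by blast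
    then have "norm p ^ Suc n = 1"
      by (metis norm_one norm_power power_Suc2)
    then show False using np power_Suc_less_one[of "norm p" n]
      by (metis less_irrefl norm_ge_zero power_less_one_iff zero_less_Suc)
  qed
  then have F0: "F 0 \<noteq> 0" by (simp add: F_def)
  have "F holomorphic_on UNIV"
    unfolding F_def
    by (intro holomorphic_on_mult holomorphic_on_compose_entire[OF holomorphic_qpoch[OF np]])
     (intro holomorphic_intros)+
  then have "(F has_field_derivative deriv F 0) (at 0)"
    by (auto intro: holomorphic_derivI)
  then have "((\<lambda>w. (1 - exp (2 * of_real pi * \<i> * w)) * F w) has_field_derivative
      (- (2 * of_real pi * \<i>) * F 0)) (at 0)"
    by (auto intro!: derivative_eq_intros)
  then have "deriv (theta_prod \<tau>) 0 = - (2 * of_real pi * \<i>) * F 0"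
    by (intro DERIV_imp_deriv) (simp add: F[abs_def])
  then have zero: "theta_prod \<tau> 0 = 0 \<and> deriv (theta_prod \<tau>) 0 \<noteq> 0"
    using F0 by (simp add: F)
  define Z where "Z = (\<lambda>s. theta_prod \<tau> s = 0 \<and> deriv (theta_prod \<tau>) s \<noteq> 0)"
  have Z1: "Z (s + 1) = Z s" for s
    unfolding Z_def
    by (rule simple_zero_shift[OF holomorphic_theta_prod, of "\<lambda>_. 1"]) (auto simp: theta_prod_add_1)
  have Zt: "Z (s + \<tau>) = Z s" for s
    unfolding Z_def
    by (rule simple_zero_shift[OF holomorphic_theta_prod, of "\<lambda>w. - exp (- (2 * of_real pi * \<i> * w))"])
       (auto simp: theta_prod_add_tau intro!: holomorphic_intros)
  obtain m n where w: "w = (0 + of_int m * 1) + of_int n * \<tau>"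
    using assms by (auto simp: period_lattice_iff)
  have "Z w = Z 0"
    unfolding w shift_of_int[of Z, OF Zt] shift_of_int[of Z, OF Z1] ..
  then show "theta_prod \<tau> w = 0" "deriv (theta_prod \<tau>) w \<noteq> 0"
    using zero by (auto simp: Z_def)
qed

text \<open>\<open>vartheta\<close> visibly vanishes at the known simple zeros of the product, so
  the quotient is entire. The factor \<open>exp (pi * \<i> * w)\<close> makes
  \<open>vartheta\<close> periodic under \<open>w + 1\<close> and aligns both multipliers; the
  quotient is then elliptic, hence constant. The converse inclusion of zeros follows from
  \<open>C \<noteq> 0\<close>.\<close>

lemma vartheta_eq_theta_prod:
  obtains C where "C \<noteq> 0" "\<And>w. vartheta \<tau> w = C * exp (- (of_real pi * \<i> * w)) * theta_prod \<tau> w"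
proof -
  define V where "V = (\<lambda>w. vartheta \<tau> w * exp (of_real pi * \<i> * w))"
  have V: "V holomorphic_on UNIV"
    unfolding V_def by (intro holomorphic_intros tau)
  obtain z0 where z0: "vartheta \<tau> z0 \<noteq> 0" using vartheta_nonzero[OF tau] .
  then have P0: "theta_prod \<tau> z0 \<noteq> 0"
    using theta_prod_zero_imp vartheta_zero_period_lattice by blast
  obtain q where q: "q holomorphic_on UNIV" "\<And>w. V w = q w * theta_prod \<tau> w"
  proof (rule entire_quotient[OF holomorphic_theta_prod P0 V])
    show "deriv (theta_prod \<tau>) s \<noteq> 0" if "theta_prod \<tau> s = 0" for s
      using that theta_prod_zero_imp theta_prod_simple_zero by blast
    show "V s = 0" if "theta_prod \<tau> s = 0" for s
      using that theta_prod_zero_imp vartheta_zero_period_lattice by (simp add: V_def)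
  qed blast
  have "V (w + 1) = 1 * (1 * V w)" for w
    by (simp add: V_def vartheta_add_1 distrib_left exp_add)
  then have q1: "q (w + 1) = 1 * q w" for w
    using quotient_multiplier[OF holomorphic_theta_prod P0 q, of 1 1 "\<lambda>_. 1"]
    by (simp add: theta_prod_add_1)
  have "V (w + \<tau>) = 1 * (- exp (- (2 * of_real pi * \<i> * w)) * V w)" for w
  proof -
    have "exp (- (of_real pi * \<i> * \<tau> + 2 * of_real pi * \<i> * w)) * exp (of_real pi * \<i> * (w + \<tau>)) =
          exp (- (2 * of_real pi * \<i> * w)) * exp (of_real pi * \<i> * w)"
      unfolding exp_add[symmetric] by (simp add: algebra_simps)
    then show ?thesis by (simp add: V_def vartheta_add_tau mult_ac)
  qed
  then have qt: "q (w + \<tau>) = 1 * q w" for w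
    by (rule quotient_multiplier[OF holomorphic_theta_prod P0 q, where c = \<tau>]) (auto simp: theta_prod_add_tau)
  have "q w = q 0" for w
    by (rule periodic_entire_const[OF tau q(1)]) (simp_all only: q1 qt mult_1)
  then have qV: "vartheta \<tau> w * exp (of_real pi * \<i> * w) = q 0 * theta_prod \<tau> w" for w
    using q(2) unfolding V_def by metis
  have *: "vartheta \<tau> w = q 0 * exp (- (of_real pi * \<i> * w)) * theta_prod \<tau> w" for w
  proof -
    have "vartheta \<tau> w = (vartheta \<tau> w * exp (of_real pi * \<i> * w)) * exp (- (of_real pi * \<i> * w))"
      unfolding mult.assoc exp_add[symmetric] by simp
    then show ?thesis unfolding qV by (simp only: mult_ac)
  qed
  then have "q 0 \<noteq> 0" using z0 by auto
  then show ?thesis using * by (rule that)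
qed

lemma vartheta_eq_0_iff: "vartheta \<tau> w = 0 \<longleftrightarrow> w \<in> period_lattice \<tau>"
proof -
  obtain C where "C \<noteq> 0" "\<And>w. vartheta \<tau> w = C * exp (- (of_real pi * \<i> * w)) * theta_prod \<tau> w"
    using vartheta_eq_theta_prod by blast
  then show ?thesis using theta_prod_zero_imp theta_prod_simple_zero by auto
qed

lemma deriv_vartheta_nonzero:
  assumes "vartheta \<tau> w = 0"
  shows "deriv (vartheta \<tau>) w \<noteq> 0"
proof -
  obtain C where C: "C \<noteq> 0" "\<And>w. vartheta \<tau> w = C * exp (- (of_real pi * \<i> * w)) * theta_prod \<tau> w"
    using vartheta_eq_theta_prod by blast
  have w: "w \<in> period_lattice \<tau>" using assms vartheta_eq_0_iff by blast
  have "(theta_prod \<tau> has_field_derivative deriv (theta_prod \<tau>) w) (at w)"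
    using holomorphic_theta_prod by (auto intro: holomorphic_derivI)
  then have "((\<lambda>w. C * exp (- (of_real pi * \<i> * w)) * theta_prod \<tau> w) has_field_derivative
     C * exp (- (of_real pi * \<i> * w)) * deriv (theta_prod \<tau>) w) (at w)"
    using theta_prod_simple_zero(1)[OF w] by (auto intro!: derivative_eq_intros)
  then have "deriv (vartheta \<tau>) w = C * exp (- (of_real pi * \<i> * w)) * deriv (theta_prod \<tau>) w"
    by (intro DERIV_imp_deriv) (simp add: C(2)[abs_def])
  then show ?thesis using C(1) theta_prod_simple_zero(2)[OF w] by simp
qed

end

subsection \<open>Theta functions of order one\<close>

text \<open>An even function with the multipliers of \<open>\<vartheta>\<close> vanishes at the half period \<open>1/2\<close>, so the
  quotient by \<open>\<vartheta> (w - 1/2)\<close> is entire with multipliers \<open>1\<close> and \<open>-1\<close>, hence zero.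
  An odd one is divisible by \<open>\<vartheta>\<close> itself.\<close>
lemma vartheta_unique:
  assumes tau: "Im \<tau> > 0" and f: "f holomorphic_on UNIV"
    and f1: "\<And>w. f (w + 1) = - f w"
    and ft: "\<And>w. f (w + \<tau>) = - exp (- (of_real pi * \<i> * \<tau> + 2 * of_real pi * \<i> * w)) * f w"
  obtains C where "\<And>w. f w = C * vartheta \<tau> w"
proof -
  let ?B = "\<lambda>w. - exp (- (of_real pi * \<i> * \<tau> + 2 * of_real pi * \<i> * w))"
  obtain z0 where z0: "vartheta \<tau> z0 \<noteq> 0" using vartheta_nonzero[OF tau] .
  have hol: "vartheta \<tau> holomorphic_on UNIV"
    using holomorphic_vartheta[OF tau holomorphic_on_ident] .
  have g1: "f (- (w + 1)) = - f (- w)" for w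
    using f1[of "- w - 1"] by simp
  \<comment> \<open>The reflected function obeys the same law: apply \<open>ft\<close> at
    \<open>- w - \<tau>\<close> and invert the exponential.\<close>
  have gt: "f (- (w + \<tau>)) = ?B w * f (- w)" for w
  proof -
    define X where "X = of_real pi * \<i> * \<tau> + 2 * of_real pi * \<i> * w"
    have "- (of_real pi * \<i> * \<tau> + 2 * of_real pi * \<i> * (- w - \<tau>)) = X"
      by (simp add: X_def algebra_simps)
    moreover have "- w - \<tau> = - (w + \<tau>)" "- w - \<tau> + \<tau> = - w" by simp_all
    ultimately have "f (- w) = - exp X * f (- (w + \<tau>))"
      using ft[of "- w - \<tau>"] by metis
    then have "f (- (w + \<tau>)) = - exp (- X) * f (- w)"
      by (simp add: exp_minus)
    then show ?thesis unfolding X_def .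
  qed
  have fm: "(\<lambda>w. f (- w)) holomorphic_on UNIV"
    by (intro holomorphic_on_compose_entire[OF f] holomorphic_intros)
  have even: "f w + f (- w) = 0" for w
  proof -
    define E where "E = (\<lambda>w. f w + f (- w))"
    have E: "E holomorphic_on UNIV" unfolding E_def by (intro holomorphic_intros f fm)
    have E1: "E (w + 1) = - E w" for w by (simp only: E_def f1 g1) simp
    have Et: "E (w + \<tau>) = ?B w * E w" for w by (simp only: E_def ft gt distrib_left)
    have "E (- (1/2)) = E (1/2)" "- (1/2) + 1 = (1/2 :: complex)" by (simp_all add: E_def)
    then have "2 * E (1/2) = 0" using E1[of "- (1/2)"] by (metis add.right_inverse mult_2)
    then have "E (1/2) = 0" by simp
    then have zero: "E s = 0" if "s - 1/2 \<in> period_lattice \<tau>" for s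
      using zero_iff_mod_lattice[of E \<tau> s "1/2"] that E1 Et by simp
    define P where "P = (\<lambda>w. vartheta \<tau> (w - 1/2))"
    have P: "P holomorphic_on UNIV" "P (z0 + 1/2) \<noteq> 0"
      using z0 by (auto simp: P_def intro!: holomorphic_intros tau)
    have dP: "deriv P s = deriv (vartheta \<tau>) (s - 1/2)" for s
    proof (rule DERIV_imp_deriv)
      have "(vartheta \<tau> has_field_derivative deriv (vartheta \<tau>) (s - 1/2)) (at (s + - (1/2)))"
        by (auto intro!: holomorphic_derivI[OF hol])
      then show "(P has_field_derivative deriv (vartheta \<tau>) (s - 1/2)) (at s)"
        unfolding DERIV_shift P_def by simp
    qed
    obtain q where q: "q holomorphic_on UNIV" "\<And>w. E w = q w * P w"
    proof (rule entire_quotient[OF P E])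
      show "deriv P s \<noteq> 0" if "P s = 0" for s
        using that deriv_vartheta_nonzero[OF tau, of "s - 1/2"] unfolding dP by (simp add: P_def)
      show "E s = 0" if "P s = 0" for s
        using that zero vartheta_eq_0_iff[OF tau] unfolding P_def by blast
    qed blast
    have P1: "P (w + 1) = - 1 * P w" for w
      using vartheta_add_1[of \<tau> "w - 1/2"] by (simp add: P_def)
    \<comment> \<open>Translating \<open>vartheta\<close> by 1/2 multiplies its \<tau>-multiplier by
      \<open>exp (pi * \<i>)\<close>; this sign is what leaves -1 for the quotient.\<close>
    have Pt: "P (w + \<tau>) = - ?B w * P w" for w
    proof -
      have "P (w + \<tau>) = ?B (w - 1/2) * P w"
        using vartheta_add_tau[of \<tau> "w - 1/2"] by (simp add: P_def algebra_simps)
      moreover have "- (of_real pi * \<i> * \<tau> + 2 * of_real pi * \<i> * (w - 1/2)) =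
          - (of_real pi * \<i> * \<tau> + 2 * of_real pi * \<i> * w) + of_real pi * \<i>"
        by (simp add: algebra_simps)
      ultimately show ?thesis by (simp only: exp_add exp_pi_i) simp
    qed
    have q1: "q (w + 1) = 1 * q w" for w
      by (rule quotient_multiplier[OF P q, where B = "\<lambda>_. - 1"]) (use E1 P1 in auto)
    have qt: "q (w + \<tau>) = - 1 * q w" for w
      by (rule quotient_multiplier[OF P q, where B = "\<lambda>w. - ?B w"]) (use Et Pt in auto)
    have "1/2 \<notin> period_lattice \<tau>"
    proof
      assume "1/2 \<in> period_lattice \<tau>"
      then obtain m n where mn: "1/2 = of_int m + of_int n * \<tau>"
        by (auto simp: period_lattice_iff)
      have "real_of_int n * Im \<tau> = 0" using arg_cong[OF mn, of Im] by simp
      then have "n = 0" using tau by simp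
      then have "real_of_int (2 * m) = 1" using arg_cong[OF mn, of Re] by simp
      then have "2 * m = 1" by linarith
      then show False by presburger
    qed
    then have "q w = 0"
      by (intro quasi_periodic_entire_zero[OF tau q(1), where s = "1/2"]) (use q1 qt in \<open>auto simp: mult.commute\<close>)
    then show ?thesis using q(2)[of w] by (simp add: E_def)
  qed
  then have odd: "f (- w) = - f w" for w by (simp add: eq_neg_iff_add_eq_0 add.commute)
  have "f 0 = 0" using odd[of 0] by simp
  then have zero: "f s = 0" if "s \<in> period_lattice \<tau>" for s
    using zero_iff_mod_lattice[of f \<tau> s 0] that f1 ft by simp
  obtain q where q: "q holomorphic_on UNIV" "\<And>w. f w = q w * vartheta \<tau> w"
    by (rule entire_quotient[OF hol z0 f])
       (use zero vartheta_eq_0_iff[OF tau] deriv_vartheta_nonzero[OF tau] in blast)+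
  have q1: "q (w + 1) = 1 * q w" for w
    by (rule quotient_multiplier[OF hol z0 q, where B = "\<lambda>_. - 1"]) (use f1 vartheta_add_1 in auto)
  have qt: "q (w + \<tau>) = 1 * q w" for w
    by (rule quotient_multiplier[OF hol z0 q, where B = ?B]) (use ft vartheta_add_tau in auto)
  have "q w = q 0" for w
    by (rule periodic_entire_const[OF tau q(1)]) (simp_all only: q1 qt mult_1)
  then show ?thesis using q(2) that[of "q 0"] by metis
qed

subsection \<open>Theta functions of order \<open>N\<close>\<close>

text \<open>Finitely many translates of the countable lattice cannot cover the plane.\<close>

lemma vartheta_avoid:
  assumes tau: "Im \<tau> > 0" and "finite I"
  obtains w where "\<And>i. i \<in> I \<Longrightarrow> vartheta \<tau> (w - x i) \<noteq> 0"
proof -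
  have "period_lattice \<tau> = (\<lambda>(m, n). of_int m + of_int n * \<tau>) ` UNIV"
    by (auto simp: period_lattice_def)
  then have "countable (period_lattice \<tau>)"
    by simp
  then have "countable (\<Union>i\<in>I. (\<lambda>l. l + x i) ` period_lattice \<tau>)"
    using assms(2) by (intro countable_UN countable_image) (auto intro: countable_finite)
  then obtain w where w: "w \<notin> (\<Union>i\<in>I. (\<lambda>l. l + x i) ` period_lattice \<tau>)"
    using uncountable_UNIV_complex by (metis UNIV_eq_I)
  have "vartheta \<tau> (w - x i) \<noteq> 0" if "i \<in> I" for i
  proof
    assume "vartheta \<tau> (w - x i) = 0"
    then have "w - x i \<in> period_lattice \<tau>" by (simp add: vartheta_eq_0_iff[OF tau])
    then have "w \<in> (\<lambda>l. l + x i) ` period_lattice \<tau>" by (intro image_eqI[of _ _ "w - x i"]) auto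
    then show False using w that by blast
  qed
  then show ?thesis by (rule that)
qed

lemma vartheta_prod_add_1:
  "finite I \<Longrightarrow> (\<Prod>i\<in>I. vartheta \<tau> (w + 1 - x i)) = (-1) ^ card I * (\<Prod>i\<in>I. vartheta \<tau> (w - x i))"
proof -
  have "vartheta \<tau> (w + 1 - x i) = - 1 * vartheta \<tau> (w - x i)" for i
    using vartheta_add_1[of \<tau> "w - x i"] by (simp add: algebra_simps)
  then show ?thesis by (simp only: prod.distrib prod_constant)
qed

lemma vartheta_prod_add_tau:
  assumes "finite I"
  shows "(\<Prod>i\<in>I. vartheta \<tau> (w + \<tau> - x i)) =
    (-1) ^ card I * exp (- (of_real pi * \<i> * of_nat (card I) * \<tau> + 2 * of_real pi * \<i> * of_nat (card I) * w))
     * exp (2 * of_real pi * \<i> * (\<Sum>i\<in>I. x i)) * (\<Prod>i\<in>I. vartheta \<tau> (w - x i))"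
proof -
  have "vartheta \<tau> (w + \<tau> - x i) =
      - 1 * exp (- (of_real pi * \<i> * \<tau> + 2 * of_real pi * \<i> * (w - x i))) * vartheta \<tau> (w - x i)" for i
    using vartheta_add_tau[of \<tau> "w - x i"] by (simp add: algebra_simps)
  then have "(\<Prod>i\<in>I. vartheta \<tau> (w + \<tau> - x i)) =
      (-1) ^ card I * exp (\<Sum>i\<in>I. - (of_real pi * \<i> * \<tau> + 2 * of_real pi * \<i> * (w - x i)))
        * (\<Prod>i\<in>I. vartheta \<tau> (w - x i))"
    by (simp only: prod.distrib prod_constant exp_sum[OF assms])
  also have "(\<Sum>i\<in>I. - (of_real pi * \<i> * \<tau> + 2 * of_real pi * \<i> * (w - x i))) =
      - (of_real pi * \<i> * of_nat (card I) * \<tau> + 2 * of_real pi * \<i> * of_nat (card I) * w) + 2 * of_real pi * \<i> * (\<Sum>i\<in>I. x i)"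
    by (simp add: sum.distrib sum_subtractf sum_negf sum_distrib_left[symmetric] algebra_simps)
      (simp add: sum_distrib_right)
  finally show ?thesis
    by (simp only: exp_add mult.assoc)
qed

text \<open>The quotient of \<open>f\<close> by \<open>\<Prod>i. \<vartheta> (w - x i)\<close> is entire with multipliers \<open>1\<close> and
  \<open>exp (- 2 \<pi> i \<Sum>x)\<close>.\<close>
lemma theta_order_vanish:
  fixes x :: "'n::finite \<Rightarrow> complex"
  assumes tau: "Im \<tau> > 0" and f: "f holomorphic_on UNIV"
    and f1: "\<And>w. f (w + 1) = (-1) ^ CARD('n) * f w"
    and ft: "\<And>w. f (w + \<tau>) = (-1) ^ CARD('n) *
        exp (- (of_real pi * \<i> * of_nat CARD('n) * \<tau> + 2 * of_real pi * \<i> * of_nat CARD('n) * w)) * f w"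
    and x: "\<And>i j. i \<noteq> j \<Longrightarrow> x i - x j \<notin> period_lattice \<tau>"
    and sum: "(\<Sum>i\<in>UNIV. x i) \<notin> period_lattice \<tau>"
    and zero: "\<And>i. f (x i) = 0"
  shows "f w = 0"
proof -
  define P where "P = (\<lambda>w. \<Prod>i\<in>UNIV. vartheta \<tau> (w - x i))"
  obtain w0 where "\<And>i. i \<in> UNIV \<Longrightarrow> vartheta \<tau> (w0 - x i) \<noteq> 0"
    using vartheta_avoid[OF tau finite[of "UNIV :: 'n set"]] by blast
  then have P0: "P w0 \<noteq> 0" by (simp add: P_def)
  have P: "P holomorphic_on UNIV"
    unfolding P_def by (intro holomorphic_intros tau)
  have hol: "vartheta \<tau> holomorphic_on UNIV"
    using holomorphic_vartheta[OF tau holomorphic_on_ident] .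
  obtain q where q: "q holomorphic_on UNIV" "\<And>w. f w = q w * P w"
  proof (rule entire_quotient[OF P P0 f])
    fix s assume "P s = 0"
    then obtain i where i: "vartheta \<tau> (s - x i) = 0" by (auto simp: P_def)
    then have si: "s - x i \<in> period_lattice \<tau>" by (simp add: vartheta_eq_0_iff[OF tau])
    show "f s = 0"
      using zero_iff_mod_lattice[of f \<tau> s "x i"] si f1 ft zero[of i] by simp
    \<comment> \<open>The nodes are incongruent, so only one factor of \<open>P\<close> vanishes at
      \<open>s\<close> and the zero is simple.\<close>
    have "vartheta \<tau> (s - x k) \<noteq> 0" if "k \<noteq> i" for k
    proof
      assume "vartheta \<tau> (s - x k) = 0"
      then have "s - x k - (s - x i) \<in> period_lattice \<tau>"
        using si unfolding vartheta_eq_0_iff[OF tau] by (rule period_lattice_diff)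
      then show False using x[of i k] that by simp
    qed
    then have nz: "(\<Prod>k\<in>UNIV - {i}. vartheta \<tau> (s - x k)) \<noteq> 0" by simp
    define G where "G = (\<lambda>w. \<Prod>k\<in>UNIV - {i}. vartheta \<tau> (w - x k))"
    have PG: "P = (\<lambda>w. vartheta \<tau> (w - x i) * G w)"
      unfolding P_def G_def by (intro ext prod.remove) auto
    have "G holomorphic_on UNIV" unfolding G_def by (intro holomorphic_intros tau)
    then have G: "(G has_field_derivative deriv G s) (at s)" by (auto intro: holomorphic_derivI)
    have "(vartheta \<tau> has_field_derivative deriv (vartheta \<tau>) (s - x i)) (at (s + - x i))"
      by (auto intro!: holomorphic_derivI[OF hol])
    then have "((\<lambda>w. vartheta \<tau> (w - x i)) has_field_derivative deriv (vartheta \<tau>) (s - x i)) (at s)"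
      unfolding DERIV_shift by simp
    from DERIV_mult[OF this G] have "deriv P s = deriv (vartheta \<tau>) (s - x i) * G s"
      unfolding PG by (intro DERIV_imp_deriv) (simp add: i)
    then show "deriv P s \<noteq> 0"
      using nz deriv_vartheta_nonzero[OF tau i] by (simp add: G_def)
  qed blast
  let ?B = "\<lambda>w. (-1) ^ CARD('n) * exp (- (of_real pi * \<i> * of_nat CARD('n) * \<tau> + 2 * of_real pi * \<i> * of_nat CARD('n) * w))
     * exp (2 * of_real pi * \<i> * (\<Sum>i\<in>UNIV. x i))"
  have q1: "q (w + 1) = 1 * q w" for w
    by (rule quotient_multiplier[OF P P0 q, where B = "\<lambda>_. (-1) ^ CARD('n)"])
       (use f1 in \<open>auto simp: P_def vartheta_prod_add_1\<close>)
  have qt: "q (w + \<tau>) = exp (2 * of_real pi * \<i> * (- (\<Sum>i\<in>UNIV. x i))) * q w" for w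
  proof (rule quotient_multiplier[OF P P0 q, where B = ?B])
    show "P (w + \<tau>) = ?B w * P w" for w
      unfolding P_def by (rule vartheta_prod_add_tau) simp
    show "f (w + \<tau>) = exp (2 * of_real pi * \<i> * (- (\<Sum>i\<in>UNIV. x i))) * (?B w * f w)" for w
      by (simp add: ft exp_minus)
  qed auto
  have "q w = 0"
    by (rule quasi_periodic_entire_zero[OF tau q(1) _ qt])
       (use q1 sum in \<open>auto simp: period_lattice_minus_iff\<close>)
  then show ?thesis using q(2) by simp
qed

text \<open>The functions \<open>\<theta>[1/2 - n/N; N/2](x | N \<tau>)\<close> making up the columns of \<open>g\<close>, indexed by
  integers so that the shift \<open>x \<mapsto> x + \<tau>\<close> acts by \<open>n \<mapsto> n - 1\<close>.\<close>
definition theta_vec :: "nat \<Rightarrow> complex \<Rightarrow> int \<Rightarrow> complex \<Rightarrow> complex" where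
  "theta_vec N \<tau> n x = theta_char (1/2 - of_int n / of_nat N) (of_nat N / 2) x (of_nat N * \<tau>)"

lemma exp_pi_i_nat: "exp (of_real pi * \<i> * of_nat N) = (-1) ^ N"
  using exp_of_nat_mult[of N "of_real pi * \<i>"] by (simp add: mult.commute)

lemma exp_2pi_i_int: "exp (2 * of_real pi * \<i> * of_int n) = 1"
  using exp_integer_2pi[of "of_int n"] by (simp add: mult_ac)

context
  fixes N :: nat and \<tau> :: complex
  assumes N: "N > 0"
begin

lemma theta_vec_cong:
  assumes "n mod int N = m mod int N"
  shows "theta_vec N \<tau> n x = theta_vec N \<tau> m x"
proof -
  obtain k where "n = m + int N * k"
    using assms unfolding mod_eq_dvd_iff dvd_def by (metis add.commute diff_add_cancel)
  then have "1/2 - of_int n / of_nat N = 1/2 - of_int m / of_nat N + (of_int (- k) :: complex)"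
    using N by (simp add: field_simps)
  then show ?thesis
    unfolding theta_vec_def by (simp only: theta_char_int_char)
qed

lemma theta_vec_add_1:
  "theta_vec N \<tau> n (x + 1) = - exp (- (2 * of_real pi * \<i> * of_int n / of_nat N)) * theta_vec N \<tau> n x"
proof -
  have "2 * of_real pi * \<i> * (1/2 - of_int n / of_nat N) * of_int 1 =
      of_real pi * \<i> + - (2 * of_real pi * \<i> * of_int n / of_nat N)"
    by (simp add: algebra_simps)
  then have "exp (2 * of_real pi * \<i> * (1/2 - of_int n / of_nat N) * of_int 1) =
      - exp (- (2 * of_real pi * \<i> * of_int n / of_nat N))"
    by (simp only: exp_add exp_pi_i) simp
  then show ?thesis
    using theta_char_add_int[of "1/2 - of_int n / of_nat N" "of_nat N / 2" x 1 "of_nat N * \<tau>"]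
    by (simp add: theta_vec_def)
qed

text \<open>The step \<tau> is one \<open>N\<close>-th of the period of these functions, so it
  changes the upper characteristic by \<open>1 / N\<close>, that is, the index by -1. The sign comes
  from the lower characteristic \<open>N / 2\<close>.\<close>

lemma theta_vec_add_tau:
  "theta_vec N \<tau> n (x + \<tau>) =
     - exp (- (of_real pi * \<i> * \<tau> / of_nat N + 2 * of_real pi * \<i> * x / of_nat N)) * theta_vec N \<tau> (n - 1) x"
proof -
  have "x + \<tau> = x + 1 / of_nat N * (of_nat N * \<tau>)"
    using N by simp
  moreover have "1/2 - of_int n / of_nat N + 1 / of_nat N = 1/2 - of_int (n - 1) / (of_nat N :: complex)"
    by (simp add: diff_divide_distrib)
  moreover have "- (of_real pi * \<i> * (of_nat N * \<tau>) * (1 / of_nat N)\<^sup>2 + 2 * of_real pi * \<i> * (1 / of_nat N) * (x + of_nat N / 2)) =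
      - (of_real pi * \<i> * \<tau> / of_nat N + 2 * of_real pi * \<i> * x / of_nat N) + - (of_real pi * \<i>)"
    using N by (simp add: field_simps power2_eq_square)
  moreover have "exp (- (complex_of_real pi * \<i>)) = - 1"
    by (simp add: exp_minus)
  ultimately show ?thesis
    unfolding theta_vec_def by (simp only: theta_char_shift exp_add mult_minus_right mult_1_right)
qed

text \<open>In the variable \<open>w\<close> with \<open>x = N * w\<close>, this and the next lemma
  give the multipliers of a theta function of order \<open>N\<close>; they are the same for all
  \<open>n\<close>, so linear combinations share them.\<close>

lemma theta_vec_add_N: "theta_vec N \<tau> n (x + of_nat N) = (-1) ^ N * theta_vec N \<tau> n x"
proof -
  have "2 * of_real pi * \<i> * (1/2 - of_int n / of_nat N) * of_nat N =
      of_real pi * \<i> * of_nat N + 2 * of_real pi * \<i> * of_int (- n)"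
    using N by (simp add: field_simps)
  then have "exp (2 * of_real pi * \<i> * (1/2 - of_int n / of_nat N) * of_nat N) = (-1) ^ N"
    by (simp only: exp_add exp_2pi_i_int exp_pi_i_nat mult_1_right)
  then show ?thesis
    using theta_char_add_int[of "1/2 - of_int n / of_nat N" "of_nat N / 2" x "int N" "of_nat N * \<tau>"]
    by (simp add: theta_vec_def)
qed

lemma theta_vec_add_N_tau:
  "theta_vec N \<tau> n (x + of_nat N * \<tau>) =
     (-1) ^ N * exp (- (of_real pi * \<i> * of_nat N * \<tau> + 2 * of_real pi * \<i> * x)) * theta_vec N \<tau> n x"
proof -
  have "- (of_real pi * \<i> * (of_nat N * \<tau>) * 1\<^sup>2 + 2 * of_real pi * \<i> * 1 * (x + of_nat N / 2)) =
     - (of_real pi * \<i> * of_nat N) + - (of_real pi * \<i> * of_nat N * \<tau> + 2 * of_real pi * \<i> * x)"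
    by (simp add: algebra_simps)
  moreover have "exp (- (of_real pi * \<i> * of_nat N)) = ((-1) ^ N :: complex)"
    unfolding exp_minus exp_pi_i_nat by (simp add: power_inverse[symmetric])
  ultimately have "exp (- (of_real pi * \<i> * (of_nat N * \<tau>) * 1\<^sup>2 + 2 * of_real pi * \<i> * 1 * (x + of_nat N / 2))) =
     (-1) ^ N * exp (- (of_real pi * \<i> * of_nat N * \<tau> + 2 * of_real pi * \<i> * x))"
    by (simp only: exp_add)
  then show ?thesis
    using theta_char_shift[of "1/2 - of_int n / of_nat N" "of_nat N / 2" x 1 "of_nat N * \<tau>"]
      theta_char_int_char[of "1/2 - of_int n / of_nat N" 1 "of_nat N / 2" x "of_nat N * \<tau>"]
    by (simp add: theta_vec_def)
qed

end

context
  fixes N :: nat and \<tau> :: complex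
  assumes N: "N > 0" and tau: "Im \<tau> > 0"
begin

lemma Im_Ntau: "Im (of_nat N * \<tau>) > 0"
  using N tau by simp

lemma holomorphic_theta_vec [holomorphic_intros]:
  "f holomorphic_on A \<Longrightarrow> (\<lambda>z. theta_vec N \<tau> n (f z)) holomorphic_on A"
  unfolding theta_vec_def by (rule holomorphic_theta_char[OF Im_Ntau])

lemma theta_vec_nonzero:
  obtains x where "theta_vec N \<tau> n x \<noteq> 0"
proof -
  obtain z where "theta_char 0 0 z (of_nat N * \<tau>) \<noteq> 0"
    using theta_char_0_0_nonzero[OF Im_Ntau] .
  then have "theta_vec N \<tau> n (z - of_nat N / 2 - (1/2 - of_int n / of_nat N) * (of_nat N * \<tau>)) \<noteq> 0"
    unfolding theta_vec_def by (subst theta_char_reduce) simp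
  then show ?thesis by (rule that)
qed

text \<open>Up to a translation, the assumed multipliers are those of the odd theta function for the
  lattice generated by 1 and \<open>N * \<tau>\<close>. Both \<open>f\<close> and
  \<open>theta_vec\<close> with index 0 are compared with that function.\<close>

lemma theta_vec_0_unique:
  assumes f: "f holomorphic_on UNIV" and f1: "\<And>x. f (x + 1) = - f x"
    and ft: "\<And>x. f (x + of_nat N * \<tau>) =
        (-1) ^ N * exp (- (of_real pi * \<i> * of_nat N * \<tau> + 2 * of_real pi * \<i> * (x + y))) * f x"
  obtains C where "\<And>x. f x = C * theta_vec N \<tau> 0 (x + y)"
proof -
  have unique: "\<exists>C. \<forall>x. F x = C * vartheta (of_nat N * \<tau>) (x + of_nat (N - 1) / 2 + y)"
    if F: "F holomorphic_on UNIV" "\<And>x. F (x + 1) = - F x"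
      "\<And>x. F (x + of_nat N * \<tau>) =
        (-1) ^ N * exp (- (of_real pi * \<i> * of_nat N * \<tau> + 2 * of_real pi * \<i> * (x + y))) * F x" for F y
  proof -
    \<comment> \<open>The summand \<open>y\<close> removes \<open>y\<close> from the exponent; the
      half-integer part contributes \<open>(-1) ^ (N - 1)\<close> and so turns
      \<open>(-1) ^ N\<close> into the sign -1 of \<open>vartheta\<close>.\<close>
    define c where "c = of_nat (N - 1) / 2 + y"
    define F' where "F' = (\<lambda>x. F (x - c))"
    have "F' holomorphic_on UNIV"
      unfolding F'_def by (intro holomorphic_on_compose_entire[OF F(1)] holomorphic_intros)
    moreover have "F' (x + 1) = - F' x" for x
      using F(2)[of "x - c"] by (simp add: F'_def algebra_simps)
    moreover have "F' (x + of_nat N * \<tau>) =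
        - exp (- (of_real pi * \<i> * (of_nat N * \<tau>) + 2 * of_real pi * \<i> * x)) * F' x" for x
    proof -
      have "- (of_real pi * \<i> * of_nat N * \<tau> + 2 * of_real pi * \<i> * (x - c + y)) =
          of_real pi * \<i> * of_nat (N - 1) + - (of_real pi * \<i> * (of_nat N * \<tau>) + 2 * of_real pi * \<i> * x)"
        by (simp add: c_def algebra_simps)
      then have "F' (x + of_nat N * \<tau>) = ((-1) ^ N * (-1) ^ (N - 1)) *
          exp (- (of_real pi * \<i> * (of_nat N * \<tau>) + 2 * of_real pi * \<i> * x)) * F' x"
        using F(3)[of "x - c"] by (simp only: exp_add exp_pi_i_nat F'_def) (simp add: algebra_simps)
      also have "(-1) ^ N * (-1) ^ (N - 1) = (- 1 :: complex)"
        using N by (simp add: odd_pos flip: power_add)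
      finally show ?thesis by simp
    qed
    ultimately obtain C where "\<And>x. F' x = C * vartheta (of_nat N * \<tau>) x"
      using vartheta_unique[OF Im_Ntau, of F'] by blast
    then have "F x = C * vartheta (of_nat N * \<tau>) (x + c)" for x
      by (metis F'_def add_diff_cancel_right')
    then show ?thesis by (auto simp: c_def add.assoc)
  qed
  obtain C where C: "\<And>x. f x = C * vartheta (of_nat N * \<tau>) (x + of_nat (N - 1) / 2 + y)"
    using unique[OF f f1 ft] by blast
  have "theta_vec N \<tau> 0 (x + 1) = - theta_vec N \<tau> 0 x" for x
    using theta_vec_add_1[OF N, of \<tau> 0 x] by simp
  then obtain D where D: "\<And>x. theta_vec N \<tau> 0 x = D * vartheta (of_nat N * \<tau>) (x + of_nat (N - 1) / 2)"
    using unique[of "theta_vec N \<tau> 0" 0] theta_vec_add_N_tau[OF N, of \<tau> 0] holomorphic_theta_vec[of "\<lambda>x. x"]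
    by (auto simp: holomorphic_on_ident)
  have "D \<noteq> 0" using theta_vec_nonzero[of 0] D by (metis mult_zero_left)
  then have "f x = C / D * theta_vec N \<tau> 0 (x + y)" for x
    using C[of x] D[of "x + y"] by (simp add: add_ac)
  then show ?thesis by (rule that)
qed

text \<open>The shift by \<open>\<tau>\<close> recovers all components of the vector from the one with index \<open>0\<close>.\<close>
lemma theta_vec_unique:
  fixes V :: "int \<Rightarrow> complex \<Rightarrow> complex"
  assumes V: "\<And>n. V n holomorphic_on UNIV"
    and V1: "\<And>n x. V n (x + 1) = - exp (- (2 * of_real pi * \<i> * of_int n / of_nat N)) * V n x"
    and Vt: "\<And>n x. V n (x + \<tau>) =
       - exp (- (of_real pi * \<i> * \<tau> / of_nat N + 2 * of_real pi * \<i> * (x + y) / of_nat N)) * V (n - 1) x"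
    and VN: "\<And>n x. V (n - int N) x = V n x"
  obtains C where "\<And>n x. V n x = C * theta_vec N \<tau> n (x + y)"
proof -
  let ?e = "\<lambda>x. - exp (- (of_real pi * \<i> * \<tau> / of_nat N + 2 * of_real pi * \<i> * (x + y) / of_nat N))"
  have iter: "V n (x + of_nat k * \<tau>) = (\<Prod>m<k. ?e (x + of_nat m * \<tau>)) * V (n - int k) x" for n k x
  proof (induction k arbitrary: n)
    case (Suc k)
    have "V n (x + of_nat (Suc k) * \<tau>) = V n ((x + of_nat k * \<tau>) + \<tau>)"
      by (simp add: algebra_simps)
    also have "\<dots> = ?e (x + of_nat k * \<tau>) * V (n - 1) (x + of_nat k * \<tau>)"
      by (rule Vt)
    also have "\<dots> = (\<Prod>m<Suc k. ?e (x + of_nat m * \<tau>)) * V (n - int (Suc k)) x"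
      unfolding Suc.IH prod.lessThan_Suc by (simp add: algebra_simps)
    finally show ?case .
  qed simp
  have iter': "theta_vec N \<tau> n (x + of_nat k * \<tau> + y) =
      (\<Prod>m<k. ?e (x + of_nat m * \<tau>)) * theta_vec N \<tau> (n - int k) (x + y)" for n k x
  proof (induction k arbitrary: n)
    case (Suc k)
    have "theta_vec N \<tau> n (x + of_nat (Suc k) * \<tau> + y) = theta_vec N \<tau> n ((x + of_nat k * \<tau> + y) + \<tau>)"
      by (simp add: algebra_simps)
    also have "\<dots> = ?e (x + of_nat k * \<tau>) * theta_vec N \<tau> (n - 1) (x + of_nat k * \<tau> + y)"
      by (rule theta_vec_add_tau[OF N])
    also have "\<dots> = (\<Prod>m<Suc k. ?e (x + of_nat m * \<tau>)) * theta_vec N \<tau> (n - int (Suc k)) (x + y)"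
      unfolding Suc.IH prod.lessThan_Suc by (simp add: algebra_simps)
    finally show ?case .
  qed simp
  have tN: "theta_vec N \<tau> (n - int N) x = theta_vec N \<tau> n x" for n x
    by (rule theta_vec_cong[OF N]) simp
  \<comment> \<open>The product of the \<open>N\<close> multipliers is read off from
    \<open>theta_vec\<close> itself: the iterated shift and \<open>theta_vec_add_N_tau\<close>
    describe the same function, which is then cancelled.\<close>
  have "(\<Prod>m<N. ?e (x + of_nat m * \<tau>)) =
      (-1) ^ N * exp (- (of_real pi * \<i> * of_nat N * \<tau> + 2 * of_real pi * \<i> * (x + y)))" for x
  proof -
    have "(\<Prod>m<N. ?e (x + of_nat m * \<tau>)) * theta_vec N \<tau> 0 (x + y) =
        (-1) ^ N * exp (- (of_real pi * \<i> * of_nat N * \<tau> + 2 * of_real pi * \<i> * (x + y))) * theta_vec N \<tau> 0 (x + y)" for x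
      using iter'[of 0 x N] tN[of 0 "x + y"] theta_vec_add_N_tau[OF N, of \<tau> 0 "x + y"] by (simp add: add_ac)
    moreover obtain x0 where "theta_vec N \<tau> 0 (x0 - y + y) \<noteq> 0"
      using theta_vec_nonzero[of 0] by auto
    ultimately show ?thesis
      by (intro entire_cancel[where P = "\<lambda>x. theta_vec N \<tau> 0 (x + y)" and ?z0.0 = "x0 - y"
            and f = "\<lambda>x. \<Prod>m<N. ?e (x + of_nat m * \<tau>)"
            and g = "\<lambda>x. (-1) ^ N * exp (- (of_real pi * \<i> * of_nat N * \<tau> + 2 * of_real pi * \<i> * (x + y)))"])
         (auto intro!: holomorphic_intros simp: N)
  qed
  then have V0t: "V 0 (x + of_nat N * \<tau>) =
      (-1) ^ N * exp (- (of_real pi * \<i> * of_nat N * \<tau> + 2 * of_real pi * \<i> * (x + y))) * V 0 x" for x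
    using iter[of 0 x N] VN[of 0 x] by (simp only: mult.assoc)
  have V01: "V 0 (x + 1) = - V 0 x" for x
    using V1[of 0 x] by simp
  obtain C where C: "\<And>x. V 0 x = C * theta_vec N \<tau> 0 (x + y)"
    using theta_vec_0_unique[OF V V01 V0t] by blast
  \<comment> \<open>Evaluate index 0 at \<open>x + k * \<tau>\<close> and cancel the nonvanishing
    product of multipliers.\<close>
  have neg: "V (- int k) x = C * theta_vec N \<tau> (- int k) (x + y)" for k x
  proof -
    let ?P = "\<Prod>m<k. ?e (x + of_nat m * \<tau>)"
    have "?P * V (- int k) x = ?P * (C * theta_vec N \<tau> (- int k) (x + y))"
      using iter[of 0 x k] iter'[of 0 x k] C[of "x + of_nat k * \<tau>"] by (simp only: diff_0 mult.left_commute)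
    moreover have "?P \<noteq> 0" by simp
    ultimately show ?thesis using mult_left_cancel[of ?P] by blast
  qed
  have Vshift: "V (n - int N * int k) x = V n x" for n k x
  proof (induction k)
    case (Suc k)
    then show ?case using VN[of "n - int N * int k" x] by (simp add: algebra_simps)
  qed simp
  have tshift: "theta_vec N \<tau> (n - int N * int k) x = theta_vec N \<tau> n x" for n k x
    by (rule theta_vec_cong[OF N]) (simp add: mod_eq_dvd_iff)
  have "V n x = C * theta_vec N \<tau> n (x + y)" for n x
  proof -
    \<comment> \<open>Iterated shifts reach only nonpositive indices; subtracting
      \<open>N * \<bar>n\<bar>\<close> brings every \<open>n\<close> there.\<close>
    have "n \<le> int N * int (nat \<bar>n\<bar>)" using N
      by (smt (verit) int_nat_eq mult_less_cancel_right2 of_nat_0_less_iff)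
    then have "n - int N * int (nat \<bar>n\<bar>) = - int (nat (int N * int (nat \<bar>n\<bar>) - n))" by simp
    then show ?thesis using neg Vshift tshift by metis
  qed
  then show ?thesis by (rule that)
qed

end

subsection \<open>The matrix \<open>g\<close> and its inverse\<close>

lemma ix_cong_iff:
  fixes ix :: "'n::finite \<Rightarrow> nat"
  assumes ix: "bij_betw ix UNIV {1..CARD('n)}"
  shows "int CARD('n) dvd int (ix i) - int (ix j) \<longleftrightarrow> i = j"
proof
  assume "int CARD('n) dvd int (ix i) - int (ix j)"
  moreover have "ix i \<in> {1..CARD('n)}" "ix j \<in> {1..CARD('n)}"
    using ix by (auto simp: bij_betw_def)
  then have "\<bar>int (ix i) - int (ix j)\<bar> < int CARD('n)" by auto
  ultimately have "int (ix i) - int (ix j) = 0"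
    using zdvd_not_zless[of "\<bar>int (ix i) - int (ix j)\<bar>" "int CARD('n)"] by (auto simp: zero_less_abs_iff)
  then show "i = j" using ix by (auto simp: bij_betw_def inj_on_def)
qed simp

lemma root_of_unity_sum:
  assumes N: "N > 0"
  shows "(\<Sum>m<N. exp (2 * of_real pi * \<i> * of_int d * of_nat m / of_nat N)) =
    (if int N dvd d then of_nat N else 0 :: complex)"
proof -
  define r where "r = exp (2 * of_real pi * \<i> * of_int d / of_nat N)"
  have sum: "(\<Sum>m<N. exp (2 * of_real pi * \<i> * of_int d * of_nat m / of_nat N)) = (\<Sum>m<N. r ^ m)"
    by (intro sum.cong refl) (simp add: r_def mult_ac flip: exp_of_nat_mult)
  have "r ^ N = exp (2 * of_real pi * \<i> * of_int d)"
    unfolding r_def exp_of_nat_mult[symmetric] using N by simp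
  then have rN: "r ^ N = 1" by (simp only: exp_2pi_i_int)
  show ?thesis
  proof (cases "int N dvd d")
    case True
    then obtain k where "d = int N * k" by (auto simp: dvd_def)
    then have "r = exp (2 * of_real pi * \<i> * of_int k)"
      using N by (simp add: r_def mult.assoc)
    then have "r = 1" by (simp only: exp_2pi_i_int)
    then show ?thesis using True sum by simp
  next
    case False
    have "r \<noteq> 1"
    proof
      assume "r = 1"
      then have "exp (2 * of_real pi * \<i> * of_int d / of_nat N) = exp 0" by (simp add: r_def)
      then obtain k where "2 * of_real pi * \<i> * of_int d / of_nat N = 0 + complex_of_real (real_of_int (2 * k) * pi) * \<i>"
        unfolding exp_eq by blast
      then have "complex_of_int d = of_int k * of_nat N"
        using N by (simp add: field_simps)
      then have "d = k * int N"
        by (metis of_int_eq_iff of_int_mult of_int_of_nat_eq)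
      then show False using False by simp
    qed
    then have "(\<Sum>m<N. r ^ m) = 0" using rN by (simp add: geometric_sum)
    then show ?thesis using False sum by simp
  qed
qed

lemma invertible_if_left_kernel_trivial:
  fixes M :: "complex^'n^'n"
  assumes "\<And>r. (\<And>j. (\<Sum>i\<in>UNIV. r $ i * M $ i $ j) = 0) \<Longrightarrow> r = 0"
  shows "invertible M"
proof -
  have "\<forall>r. transpose M *v r = 0 \<longrightarrow> r = 0"
  proof (intro allI impI)
    fix r :: "complex^'n" assume r: "transpose M *v r = 0"
    have "(\<Sum>i\<in>UNIV. r $ i * M $ i $ j) = (transpose M *v r) $ j" for j
      by (simp add: matrix_vector_mult_def transpose_def mult.commute)
    then show "r = 0" using assms[of r] unfolding r by simp
  qed
  then obtain B where "B ** transpose M = mat 1"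
    using matrix_left_invertible_ker[of "transpose M"] by blast
  then show ?thesis
    using left_invertible_transpose[of M] invertible_right_inverse[of M] by blast
qed

lemma matrix_inv_eq:
  fixes M :: "complex^'n^'n"
  assumes "M ** B = mat 1"
  shows "matrix_inv M = B"
proof -
  have "B ** M = mat 1" using assms matrix_left_right_inverse by blast
  moreover have "M ** matrix_inv M = mat 1"
    using assms calculation someI[of "\<lambda>B. M ** B = mat 1 \<and> B ** M = mat 1" B]
    unfolding matrix_inv_def by blast
  ultimately show ?thesis
    by (metis matrix_mul_assoc matrix_mul_lid matrix_mul_rid)
qed

definition node :: "complex^'n \<Rightarrow> complex \<Rightarrow> 'n::finite \<Rightarrow> complex" where
  "node u z j = z / of_nat CARD('n) + u $ j - (\<Sum>m\<in>UNIV. u $ m) / of_nat CARD('n)"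

text \<open>This makes the condition on the sum in \<open>theta_order_vanish\<close> a condition on
  \<open>z\<close> alone; it is where \<open>g\<close> may degenerate.\<close>

lemma sum_node: "(\<Sum>j\<in>UNIV. node u z j) = z" for u :: "complex^'n::finite"
proof -
  have "(\<Sum>j\<in>(UNIV :: 'n set). node u z j) =
      of_nat CARD('n) * (z / of_nat CARD('n)) + (\<Sum>m\<in>UNIV. u $ m)
       - of_nat CARD('n) * ((\<Sum>m\<in>UNIV. u $ m) / of_nat CARD('n))"
    by (simp only: node_def sum.distrib sum_subtractf sum_constant)
  then show ?thesis by simp
qed

lemma node_diff: "node u z i - node u z j = u $ i - u $ j"
  by (simp add: node_def)

lemma g_mat_eq:
  "g_mat ix \<tau> z u $ i $ j = theta_vec CARD('n) \<tau> (int (ix i)) (of_nat CARD('n) * node u z j)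
     / (\<Prod>k\<in>UNIV - {j}. vartheta \<tau> (u $ k - u $ j))" for u :: "complex^'n::finite"
proof -
  have "z + of_nat CARD('n) * u $ j - (\<Sum>m\<in>UNIV. u $ m) = of_nat CARD('n) * node u z j"
    by (simp add: node_def algebra_simps)
  then show ?thesis by (simp add: g_mat_def theta_vec_def)
qed

context
  fixes ix :: "'n::finite \<Rightarrow> nat" and \<tau> :: complex
  assumes ix: "bij_betw ix UNIV {1..CARD('n)}" and tau: "Im \<tau> > 0"
begin

private abbreviation (input) "T i \<equiv> theta_vec CARD('n) \<tau> (int (ix i))"

text \<open>The components are eigenfunctions of the shift by \<open>1\<close> with distinct eigenvalues.\<close>
lemma theta_vec_independent:
  assumes "\<And>y. (\<Sum>i\<in>UNIV. r i * T i y) = 0"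
  shows "r k = 0"
proof -
  let ?N = "CARD('n)"
  let ?e = "\<lambda>n m. exp (2 * of_real pi * \<i> * of_int n * of_nat m / of_nat ?N)"
  have shift: "T i (y + of_nat m) = (-1) ^ m * ?e (- int (ix i)) m * T i y" for i m y
  proof (induction m)
    case (Suc m)
    have "T i (y + of_nat (Suc m)) = T i (y + of_nat m + 1)" by (simp add: algebra_simps)
    also have "\<dots> = - (exp (- (2 * of_real pi * \<i> * of_int (int (ix i)) / of_nat ?N)) * ?e (- int (ix i)) m) * (-1) ^ m * T i y"
      unfolding theta_vec_add_1[OF zero_less_card_finite] Suc.IH by simp
    also have "exp (- (2 * of_real pi * \<i> * of_int (int (ix i)) / of_nat ?N)) * ?e (- int (ix i)) m = ?e (- int (ix i)) (Suc m)"
      unfolding exp_add[symmetric] by (simp add: field_simps)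
    finally show ?case by simp
  qed simp
  have zero: "(\<Sum>i\<in>UNIV. r i * ?e (- int (ix i)) m * T i y) = 0" for m y
  proof -
    have "0 = (\<Sum>i\<in>UNIV. r i * T i (y + of_nat m))" using assms by simp
    also have "\<dots> = (-1) ^ m * (\<Sum>i\<in>UNIV. r i * ?e (- int (ix i)) m * T i y)"
      unfolding shift sum_distrib_left by (intro sum.cong refl) (simp add: mult_ac)
    finally show ?thesis by simp
  qed
  have "r k * T k y = 0" for y
  proof -
    \<comment> \<open>Discrete Fourier projection: weighting with the character of \<open>k\<close>
      over a full period isolates the \<open>k\<close>-th term.\<close>
    have "0 = (\<Sum>m<?N. ?e (int (ix k)) m * (\<Sum>i\<in>UNIV. r i * ?e (- int (ix i)) m * T i y))"
      unfolding zero by simp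
    also have "\<dots> = (\<Sum>i\<in>UNIV. r i * T i y * (\<Sum>m<?N. ?e (int (ix k) - int (ix i)) m))"
      unfolding sum_distrib_left
      by (subst sum.swap, intro sum.cong refl) (simp add: diff_divide_distrib algebra_simps flip: exp_add)
    also have "\<dots> = (\<Sum>i\<in>UNIV. if i = k then r i * T i y * of_nat ?N else 0)"
      unfolding root_of_unity_sum[OF zero_less_card_finite] ix_cong_iff[OF ix] by (intro sum.cong refl) auto
    also have "\<dots> = r k * T k y * of_nat ?N" by simp
    finally show ?thesis by simp
  qed
  moreover obtain y where "T k y \<noteq> 0" using theta_vec_nonzero[OF zero_less_card_finite tau] by blast
  ultimately show ?thesis by (metis mult_eq_0_iff)
qed

context
  fixes u :: "complex^'n"
  assumes u: "\<And>i j. i \<noteq> j \<Longrightarrow> u $ i - u $ j \<notin> period_lattice \<tau>"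
begin

private abbreviation (input) "g z \<equiv> g_mat ix \<tau> z u"
private abbreviation (input) "x \<equiv> node u"
private abbreviation (input) "d j \<equiv> \<Prod>k\<in>UNIV - {j}. vartheta \<tau> (u $ k - u $ j)"

lemma vandermonde_factor_nonzero: "d j \<noteq> 0"
  using u by (simp add: vartheta_eq_0_iff[OF tau])

lemma theta_combination_multipliers:
  "(\<Sum>i\<in>UNIV. r i * T i (of_nat CARD('n) * (w + 1))) =
     (-1) ^ CARD('n) * (\<Sum>i\<in>UNIV. r i * T i (of_nat CARD('n) * w))"
  "(\<Sum>i\<in>UNIV. r i * T i (of_nat CARD('n) * (w + \<tau>))) = (-1) ^ CARD('n) *
     exp (- (of_real pi * \<i> * of_nat CARD('n) * \<tau> + 2 * of_real pi * \<i> * of_nat CARD('n) * w)) *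
     (\<Sum>i\<in>UNIV. r i * T i (of_nat CARD('n) * w))"
  unfolding sum_distrib_left distrib_left[of "of_nat CARD('n)"] mult_1_right
    theta_vec_add_N[OF zero_less_card_finite] theta_vec_add_N_tau[OF zero_less_card_finite]
  by (intro sum.cong refl; simp only: mult_ac)+

text \<open>A combination of the components that vanishes at the \<open>N\<close> incongruent nodes
  is zero identically, since the nodes sum to \<open>z\<close>, which is off the lattice;
  independence then kills the coefficients.\<close>

lemma theta_node_left_kernel:
  assumes z: "z \<notin> period_lattice \<tau>"
    and r: "\<And>j. (\<Sum>i\<in>UNIV. r i * T i (of_nat CARD('n) * x z j)) = 0"
  shows "r k = 0"
proof (rule theta_vec_independent)
  have "(\<Sum>i\<in>UNIV. r i * T i (of_nat CARD('n) * w)) = 0" for w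
  proof (rule theta_order_vanish[OF tau, where x = "x z" and f = "\<lambda>w. \<Sum>i\<in>UNIV. r i * T i (of_nat CARD('n) * w)"])
    show "(\<lambda>w. \<Sum>i\<in>UNIV. r i * T i (of_nat CARD('n) * w)) holomorphic_on UNIV"
      by (intro holomorphic_intros holomorphic_theta_vec[OF zero_less_card_finite tau])
  qed (use z u in \<open>simp_all only: theta_combination_multipliers node_diff sum_node r not_False_eq_True\<close>)
  from this[of "y / of_nat CARD('n)" for y] show "(\<Sum>i\<in>UNIV. r i * T i y) = 0" for y by simp
qed

lemma invertible_g_mat:
  assumes "z \<notin> period_lattice \<tau>"
  shows "invertible (g z)"
proof (rule invertible_if_left_kernel_trivial)
  fix r :: "complex^'n" assume r: "\<And>j. (\<Sum>i\<in>UNIV. r $ i * g z $ i $ j) = 0"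
  have "(\<Sum>i\<in>UNIV. r $ i * T i (of_nat CARD('n) * x z j)) = 0" for j
    using r[of j] vandermonde_factor_nonzero[of j]
    by (simp add: g_mat_eq flip: sum_divide_distrib)
  then show "r = 0"
    using theta_node_left_kernel[OF assms, of "($) r"] by (simp add: vec_eq_iff)
qed

text \<open>Besides the other nodes, the extra zero in \<open>w\<close> lies at
  \<open>x z j - z\<close>. It makes the \<open>N\<close> zeros sum to 0, so the multipliers agree
  with those of the components of \<open>g\<close>, and at the node \<open>x z j\<close> the extra
  factor takes the value \<open>vartheta \<tau> z\<close>. The sign converts the remaining product
  there into the denominator \<open>d j\<close> of \<open>g\<close>.\<close>

definition lagrange :: "complex \<Rightarrow> complex \<Rightarrow> 'n \<Rightarrow> complex" where
  "lagrange w z j = (-1) ^ (CARD('n) - 1) * vartheta \<tau> (w - x z j + z) * (\<Prod>k\<in>UNIV - {j}. vartheta \<tau> (w - x z k))"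

lemma lagrange_alt:
  "lagrange w z j = (-1) ^ (CARD('n) - 1) * (\<Prod>k\<in>UNIV. vartheta \<tau> (w - (if k = j then x z j - z else x z k)))"
proof -
  have "(\<Prod>k\<in>UNIV. vartheta \<tau> (w - (if k = j then x z j - z else x z k))) =
      vartheta \<tau> (w - (x z j - z)) * (\<Prod>k\<in>UNIV - {j}. vartheta \<tau> (w - (if k = j then x z j - z else x z k)))"
    by (subst prod.remove[of _ j]) auto
  also have "(\<Prod>k\<in>UNIV - {j}. vartheta \<tau> (w - (if k = j then x z j - z else x z k))) =
      (\<Prod>k\<in>UNIV - {j}. vartheta \<tau> (w - x z k))"
    by (intro prod.cong) auto
  finally show ?thesis by (simp add: lagrange_def algebra_simps)
qed

lemma holomorphic_lagrange [holomorphic_intros]: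
  "f holomorphic_on A \<Longrightarrow> h holomorphic_on A \<Longrightarrow> (\<lambda>z. lagrange (f z) (h z) j) holomorphic_on A"
  unfolding lagrange_def node_def by (intro holomorphic_intros tau) auto

lemma holomorphic_g_mat [holomorphic_intros]:
  "f holomorphic_on A \<Longrightarrow> (\<lambda>z. g (f z) $ i $ j) holomorphic_on A"
  unfolding g_mat_eq node_def
  by (intro holomorphic_intros holomorphic_theta_vec[OF zero_less_card_finite tau]) (use vandermonde_factor_nonzero[of j] in auto)

lemma lagrange_multipliers:
  "lagrange (w + 1) z j = (-1) ^ CARD('n) * lagrange w z j"
  "lagrange (w + \<tau>) z j = (-1) ^ CARD('n) *
     exp (- (of_real pi * \<i> * of_nat CARD('n) * \<tau> + 2 * of_real pi * \<i> * of_nat CARD('n) * w)) * lagrange w z j"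
proof -
  have "(\<Sum>k\<in>UNIV. if k = j then x z j - z else x z k) = (\<Sum>k\<in>UNIV. x z k - (if k = j then z else 0))"
    by (intro sum.cong) auto
  also have "\<dots> = 0" by (simp add: sum_subtractf sum_node)
  finally have sum: "(\<Sum>k\<in>UNIV. if k = j then x z j - z else x z k) = 0" .
  show "lagrange (w + 1) z j = (-1) ^ CARD('n) * lagrange w z j"
    unfolding lagrange_alt by (subst vartheta_prod_add_1) (auto simp: mult_ac)
  show "lagrange (w + \<tau>) z j = (-1) ^ CARD('n) *
     exp (- (of_real pi * \<i> * of_nat CARD('n) * \<tau> + 2 * of_real pi * \<i> * of_nat CARD('n) * w)) * lagrange w z j"
    unfolding lagrange_alt by (subst vartheta_prod_add_tau) (auto simp: sum mult_ac)
qed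

lemma lagrange_node: "lagrange (x z m) z j = (if m = j then vartheta \<tau> z * d j else 0)"
proof (cases "m = j")
  case True
  have "vartheta \<tau> (x z j - x z k) = - 1 * vartheta \<tau> (u $ k - u $ j)" for k
    using vartheta_minus[of \<tau> "u $ k - u $ j"] by (simp add: node_diff)
  then have "(\<Prod>k\<in>UNIV - {j}. vartheta \<tau> (x z j - x z k)) = (-1) ^ (CARD('n) - 1) * d j"
    by (simp only: prod.distrib prod_constant card_Diff_singleton UNIV_I finite)
  then have "lagrange (x z j) z j = ((-1) ^ (CARD('n) - 1) * (-1) ^ (CARD('n) - 1)) * (vartheta \<tau> z * d j)"
    by (simp add: lagrange_def)
  also have "(-1) ^ (CARD('n) - 1) * (-1) ^ (CARD('n) - 1) = (1 :: complex)"
    by (simp flip: power_mult_distrib)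
  finally show ?thesis using True by simp
next
  case False
  then have "(\<Prod>k\<in>UNIV - {j}. vartheta \<tau> (x z m - x z k)) = 0"
    by (intro prod_zero) (auto intro!: bexI[of _ m])
  then show ?thesis using False by (simp add: lagrange_def)
qed

text \<open>Lagrange interpolation of theta functions of order \<open>N\<close> at the nodes.\<close>
lemma g_mat_lagrange:
  "(\<Sum>j\<in>UNIV. g z $ i $ j * lagrange w z j) = vartheta \<tau> z * T i (of_nat CARD('n) * w)"
proof -
  have *: "(\<Sum>j\<in>UNIV. g z $ i $ j * lagrange w z j) - vartheta \<tau> z * T i (of_nat CARD('n) * w) = 0"
    if z: "z \<notin> period_lattice \<tau>" for z
  proof (rule theta_order_vanish[OF tau, where x = "x z"
        and f = "\<lambda>w. (\<Sum>j\<in>UNIV. g z $ i $ j * lagrange w z j) - vartheta \<tau> z * T i (of_nat CARD('n) * w)"])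
    show "(\<lambda>w. (\<Sum>j\<in>UNIV. g z $ i $ j * lagrange w z j) - vartheta \<tau> z * T i (of_nat CARD('n) * w)) holomorphic_on UNIV"
      by (intro holomorphic_intros holomorphic_theta_vec[OF zero_less_card_finite tau])
    show "(\<Sum>j\<in>UNIV. g z $ i $ j * lagrange (w + 1) z j) - vartheta \<tau> z * T i (of_nat CARD('n) * (w + 1)) =
      (-1) ^ CARD('n) * ((\<Sum>j\<in>UNIV. g z $ i $ j * lagrange w z j) - vartheta \<tau> z * T i (of_nat CARD('n) * w))" for w
      unfolding lagrange_multipliers distrib_left mult_1_right theta_vec_add_N[OF zero_less_card_finite]
      by (simp add: right_diff_distrib sum_distrib_left mult_ac)
    show "(\<Sum>j\<in>UNIV. g z $ i $ j * lagrange (w + \<tau>) z j) - vartheta \<tau> z * T i (of_nat CARD('n) * (w + \<tau>)) =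
      (-1) ^ CARD('n) * exp (- (of_real pi * \<i> * of_nat CARD('n) * \<tau> + 2 * of_real pi * \<i> * of_nat CARD('n) * w)) *
      ((\<Sum>j\<in>UNIV. g z $ i $ j * lagrange w z j) - vartheta \<tau> z * T i (of_nat CARD('n) * w))" for w
      unfolding lagrange_multipliers distrib_left[of "of_nat CARD('n)"] theta_vec_add_N_tau[OF zero_less_card_finite]
        right_diff_distrib sum_distrib_left
      by (intro arg_cong2[of _ _ _ _ "(-)"] sum.cong refl) (simp_all only: mult_ac)
    show "(\<Sum>j\<in>UNIV. g z $ i $ j * lagrange (x z m) z j) - vartheta \<tau> z * T i (of_nat CARD('n) * x z m) = 0" for m
    proof -
      have "(\<Sum>j\<in>UNIV. g z $ i $ j * lagrange (x z m) z j) = (\<Sum>j\<in>UNIV. if m = j then g z $ i $ j * (vartheta \<tau> z * d j) else 0)"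
        unfolding lagrange_node by (intro sum.cong) auto
      also have "\<dots> = g z $ i $ m * (vartheta \<tau> z * d m)" by simp
      also have "\<dots> = vartheta \<tau> z * T i (of_nat CARD('n) * x z m)"
        using vandermonde_factor_nonzero[of m] unfolding g_mat_eq by (simp only: times_divide_eq_left times_divide_eq_right) simp
      finally show ?thesis by simp
    qed
  qed (use z u in \<open>auto simp: node_diff sum_node\<close>)
  \<comment> \<open>The vanishing theorem needs \<open>z\<close> off the lattice; the identity
    theorem in \<open>z\<close> adds the lattice points, among them \<open>z = 0\<close>.\<close>
  obtain z0 where z0: "vartheta \<tau> z0 \<noteq> 0" using vartheta_nonzero[OF tau] .
  show ?thesis
  proof (rule entire_cancel[where P = "vartheta \<tau>"
        and f = "\<lambda>z. \<Sum>j\<in>UNIV. g z $ i $ j * lagrange w z j" and g = "\<lambda>z. vartheta \<tau> z * T i (of_nat CARD('n) * w)"])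
    show "(\<Sum>j\<in>UNIV. g z $ i $ j * lagrange w z j) * vartheta \<tau> z = vartheta \<tau> z * T i (of_nat CARD('n) * w) * vartheta \<tau> z" for z
      using *[of z] vartheta_eq_0_iff[OF tau, of z] by (cases "z \<in> period_lattice \<tau>") auto
  qed (use z0 in \<open>auto intro!: holomorphic_intros tau holomorphic_on_ident\<close>)
qed

text \<open>At \<open>z = 0\<close> the extra factor of the \<open>j\<close>-th interpolation
  function is exactly the factor missing from its product, so all these functions coincide and
  factor out, while the interpolated value carries \<open>vartheta \<tau> 0 = 0\<close>.\<close>

lemma g_mat_0_row_sum: "(\<Sum>j\<in>UNIV. g 0 $ i $ j) = 0"
proof -
  obtain w where w: "\<And>k. vartheta \<tau> (w - x 0 k) \<noteq> 0"
    using vartheta_avoid[OF tau finite[of "UNIV :: 'n set"], of "x 0"] by auto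
  define c where "c = (-1) ^ (CARD('n) - 1) * (\<Prod>k\<in>UNIV. vartheta \<tau> (w - x 0 k))"
  have "c \<noteq> 0" using w by (simp add: c_def)
  have "lagrange w 0 j = c" for j
    unfolding lagrange_alt c_def by (intro arg_cong2[of _ _ _ _ "(*)"] prod.cong) auto
  then have "(\<Sum>j\<in>UNIV. g 0 $ i $ j) * c = 0"
    using g_mat_lagrange[of 0 i w] by (simp add: sum_distrib_right)
  then show ?thesis using \<open>c \<noteq> 0\<close> by simp
qed

text \<open>\<open>A\<close> is an adjugate of \<open>g\<close> up to scaling. The interpolation
  identity is sampled at the nodes of a fixed \<open>z0\<close> off the lattice, which makes the
  sampled theta matrix \<open>M\<close> invertible and independent of \<open>z\<close>. The rows of
  \<open>A 0\<close> agree because the interpolation functions coincide at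
  \<open>z = 0\<close>.\<close>

lemma g_mat_adjoint:
  obtains A :: "complex \<Rightarrow> complex^'n^'n" where
    "\<And>i j. (\<lambda>z. A z $ i $ j) holomorphic_on UNIV"
    "\<And>z. g z ** A z = mat_scale (vartheta \<tau> z) (mat 1)"
    "\<And>z. A z ** g z = mat_scale (vartheta \<tau> z) (mat 1)"
    "\<And>i i' j. A 0 $ i $ j = A 0 $ i' $ j"
proof -
  obtain z0 where z0: "vartheta \<tau> z0 \<noteq> 0" using vartheta_nonzero[OF tau] .
  then have z0L: "z0 \<notin> period_lattice \<tau>" by (simp add: vartheta_eq_0_iff[OF tau])
  define M where "M = (\<chi> i m. T i (of_nat CARD('n) * x z0 m))"
  have "invertible M"
  proof (rule invertible_if_left_kernel_trivial)
    fix r :: "complex^'n" assume "\<And>j. (\<Sum>i\<in>UNIV. r $ i * M $ i $ j) = 0"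
    then show "r = 0"
      using theta_node_left_kernel[OF z0L, of "($) r"] by (simp add: M_def vec_eq_iff)
  qed
  define K where "K = (\<lambda>z. \<chi> j m. lagrange (x z0 m) z j)"
  obtain M' where M': "M ** M' = mat 1"
    using \<open>invertible M\<close> unfolding invertible_def by blast
  define A where "A = (\<lambda>z. K z ** M')"
  have hol: "(\<lambda>z. A z $ i $ j) holomorphic_on UNIV" for i j
    unfolding A_def K_def matrix_matrix_mult_def by (simp, intro holomorphic_intros)
  have gK: "g z ** K z = mat_scale (vartheta \<tau> z) M" for z
    by (simp add: vec_eq_iff matrix_matrix_mult_def K_def M_def mat_scale_def g_mat_lagrange)
  have gA: "g z ** A z = mat_scale (vartheta \<tau> z) (mat 1)" for z
  proof -
    have "g z ** A z = mat_scale (vartheta \<tau> z) M ** M'"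
      by (simp add: A_def gK matrix_mul_assoc)
    also have "\<dots> = mat_scale (vartheta \<tau> z) (M ** M')"
      by (simp add: vec_eq_iff matrix_matrix_mult_def mat_scale_def sum_distrib_left mult.assoc)
    also have "M ** M' = mat 1" by (rule M')
    finally show ?thesis .
  qed
  have "(A z ** g z) $ i $ j = mat_scale (vartheta \<tau> z) (mat 1) $ i $ j" for z i j
  proof (rule entire_cancel[where P = "vartheta \<tau>" and f = "\<lambda>z. (A z ** g z) $ i $ j"
        and g = "\<lambda>z. mat_scale (vartheta \<tau> z) (mat 1) $ i $ j"])
    show "(\<lambda>z. (A z ** g z) $ i $ j) holomorphic_on UNIV"
      unfolding matrix_matrix_mult_def by (simp, intro holomorphic_intros hol)
    show "(\<lambda>z. mat_scale (vartheta \<tau> z) (mat 1) $ i $ j) holomorphic_on UNIV"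
      unfolding mat_scale_def by (simp, intro holomorphic_intros tau)
    show "(A z ** g z) $ i $ j * vartheta \<tau> z = mat_scale (vartheta \<tau> z) (mat 1) $ i $ j * vartheta \<tau> z" for z
    proof (cases "vartheta \<tau> z = 0")
      case False
      have "g z ** mat_scale (1 / vartheta \<tau> z) (A z) = mat_scale (1 / vartheta \<tau> z) (g z ** A z)"
        by (simp add: vec_eq_iff matrix_matrix_mult_def mat_scale_def sum_distrib_left mult_ac)
      also have "\<dots> = mat 1"
        unfolding gA using False by (simp add: vec_eq_iff mat_scale_def)
      finally have "mat_scale (1 / vartheta \<tau> z) (A z) ** g z = mat 1"
        using matrix_left_right_inverse by blast
      moreover have "mat_scale (1 / vartheta \<tau> z) (A z) ** g z = mat_scale (1 / vartheta \<tau> z) (A z ** g z)"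
        by (simp add: vec_eq_iff matrix_matrix_mult_def mat_scale_def sum_distrib_left mult_ac)
      ultimately have "1 / vartheta \<tau> z * (A z ** g z) $ i $ j = mat 1 $ i $ j"
        by (simp add: vec_eq_iff mat_scale_def)
      then show ?thesis using False by (simp add: mat_scale_def field_simps)
    qed simp
  qed (use z0 in \<open>auto intro!: holomorphic_intros tau holomorphic_on_ident\<close>)
  then have Ag: "A z ** g z = mat_scale (vartheta \<tau> z) (mat 1)" for z
    by (simp add: vec_eq_iff)
  have lag: "lagrange w 0 i = lagrange w 0 i'" for w i i'
    unfolding lagrange_alt by (intro arg_cong2[of _ _ _ _ "(*)"] prod.cong) auto
  have "A 0 $ i $ j = A 0 $ i' $ j" for i i' j
    by (simp add: A_def K_def matrix_matrix_mult_def lag[of _ i i'])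
  then show ?thesis
    by (rule that[OF hol gA Ag])
qed

text \<open>\<rho> is the common row of \<open>A 0\<close> divided by the derivative of
  \<open>vartheta\<close> at 0, and \<gamma> is the derivative of the row sums of \<open>g\<close>
  at 0. Summing a row of \<open>A h ** g h\<close> over its columns gives
  \<open>vartheta \<tau> h\<close>; dividing by \<open>h\<close> and letting \<open>h\<close> tend
  to 0 gives the normalization.\<close>

lemma g_breve_properties:
  obtains \<rho> \<gamma> :: "'n \<Rightarrow> complex" where
    "\<And>j l. g_breve ix \<tau> u $ j $ l = \<rho> l"
    "\<And>i. (\<Sum>l\<in>UNIV. \<rho> l * g 0 $ l $ i) = 0"
    "\<And>l. ((\<lambda>h. (\<Sum>i\<in>UNIV. g h $ l $ i) / h) \<longlongrightarrow> \<gamma> l) (at 0)"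
    "(\<Sum>l\<in>UNIV. \<rho> l * \<gamma> l) = 1"
proof -
  obtain A :: "complex \<Rightarrow> complex^'n^'n" where A: "\<And>i j. (\<lambda>z. A z $ i $ j) holomorphic_on UNIV"
    and gA: "\<And>z. g z ** A z = mat_scale (vartheta \<tau> z) (mat 1)"
    and Ag: "\<And>z. A z ** g z = mat_scale (vartheta \<tau> z) (mat 1)"
    and A0: "\<And>i i' j. A 0 $ i $ j = A 0 $ i' $ j"
    using g_mat_adjoint by blast
  define c where "c = deriv (vartheta \<tau>) 0"
  have c: "c \<noteq> 0" using deriv_vartheta_nonzero[OF tau vartheta_0] by (simp add: c_def)
  have hol: "vartheta \<tau> holomorphic_on UNIV"
    using holomorphic_vartheta[OF tau holomorphic_on_ident] .
  have "(vartheta \<tau> has_field_derivative c) (at 0)"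
    using hol by (auto simp: c_def intro: holomorphic_derivI)
  then have quot: "((\<lambda>h. vartheta \<tau> h / h) \<longlongrightarrow> c) (at 0)"
    by (simp add: has_field_derivative_iff)
  have lim: "(f \<longlongrightarrow> f 0) (at 0)" if "f holomorphic_on UNIV" for f :: "complex \<Rightarrow> complex"
    using holomorphic_on_imp_continuous_on[OF that] by (metis UNIV_I continuous_on_def)
  obtain z0 where z0: "vartheta \<tau> z0 \<noteq> 0" using vartheta_nonzero[OF tau] .
  obtain r where r: "r > 0" "\<And>z. z \<in> ball 0 r - {0} \<Longrightarrow> vartheta \<tau> z \<noteq> 0"
    using isolated_zeros[OF hol open_UNIV connected_UNIV UNIV_I vartheta_0 UNIV_I z0] by metis
  have inv: "matrix_inv (g z) $ i $ j = A z $ i $ j / vartheta \<tau> z" if "vartheta \<tau> z \<noteq> 0" for z i j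
  proof -
    have "g z ** mat_scale (1 / vartheta \<tau> z) (A z) = mat_scale (1 / vartheta \<tau> z) (g z ** A z)"
      by (simp add: vec_eq_iff matrix_matrix_mult_def mat_scale_def sum_distrib_left mult_ac)
    also have "\<dots> = mat 1"
      unfolding gA using that by (simp add: vec_eq_iff mat_scale_def)
    finally show ?thesis
      using matrix_inv_eq by (fastforce simp: mat_scale_def)
  qed
  have breve: "g_breve ix \<tau> u $ i $ j = A 0 $ i $ j / c" for i j
  proof -
    have "residue (\<lambda>z. matrix_inv (g z) $ i $ j) 0 = A 0 $ i $ j / c"
    proof (rule residue_simple'[of "ball 0 r"])
      have "(\<lambda>z. A z $ i $ j / vartheta \<tau> z) holomorphic_on ball 0 r - {0}"
        using r by (intro holomorphic_intros holomorphic_on_subset[OF A] holomorphic_on_subset[OF hol]) auto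
      then show "(\<lambda>z. matrix_inv (g z) $ i $ j) holomorphic_on ball 0 r - {0}"
        by (rule holomorphic_transform) (use r inv in auto)
      have "((\<lambda>z. A z $ i $ j / (vartheta \<tau> z / z)) \<longlongrightarrow> A 0 $ i $ j / c) (at 0)"
        by (intro tendsto_divide lim[OF A] quot c)
      moreover have "eventually (\<lambda>z. A z $ i $ j / (vartheta \<tau> z / z) = matrix_inv (g z) $ i $ j * (z - 0)) (at 0)"
        using eventually_at_in_open[of "ball 0 r" 0] r by (auto elim!: eventually_mono simp: inv)
      ultimately show "((\<lambda>z. matrix_inv (g z) $ i $ j * (z - 0)) \<longlongrightarrow> A 0 $ i $ j / c) (at 0)"
        by (rule Lim_transform_eventually)
    qed (use r in auto)
    then show ?thesis by (simp add: g_breve_def)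
  qed
  \<comment> \<open>\<open>undefined\<close> serves as an arbitrary fixed row index; the choice is
    immaterial at 0, where all rows agree.\<close>
  define \<rho> where "\<rho> = (\<lambda>l. A 0 $ undefined $ l / c)"
  define S where "S = (\<lambda>l h. \<Sum>i\<in>UNIV. g h $ l $ i)"
  define \<gamma> where "\<gamma> = (\<lambda>l. deriv (S l) 0)"
  have S: "S l holomorphic_on UNIV" for l
    unfolding S_def by (intro holomorphic_intros)
  have Sl: "((\<lambda>h. S l h / h) \<longlongrightarrow> \<gamma> l) (at 0)" for l
  proof -
    have "(S l has_field_derivative \<gamma> l) (at 0)"
      using S by (auto simp: \<gamma>_def intro: holomorphic_derivI)
    moreover have "S l 0 = 0" by (simp add: S_def g_mat_0_row_sum)
    ultimately show ?thesis by (simp add: has_field_derivative_iff)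
  qed
  have ASeq: "(\<Sum>l\<in>UNIV. A h $ undefined $ l * (S l h / h)) = vartheta \<tau> h / h" for h
  proof -
    have "(\<Sum>l\<in>UNIV. A h $ undefined $ l * S l h) = (\<Sum>i\<in>UNIV. \<Sum>l\<in>UNIV. A h $ undefined $ l * g h $ l $ i)"
      unfolding S_def sum_distrib_left by (rule sum.swap)
    also have "\<dots> = (\<Sum>i\<in>UNIV. (A h ** g h) $ undefined $ i)"
      by (simp add: matrix_matrix_mult_def)
    also have "\<dots> = (\<Sum>i\<in>(UNIV :: 'n set). if undefined = i then vartheta \<tau> h else 0)"
      by (rule sum.cong[OF refl]) (simp add: Ag mat_scale_def mat_def)
    also have "\<dots> = vartheta \<tau> h" by simp
    finally show ?thesis by (simp flip: sum_divide_distrib)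
  qed
  have ASlim: "((\<lambda>h. \<Sum>l\<in>UNIV. A h $ undefined $ l * (S l h / h)) \<longlongrightarrow> (\<Sum>l\<in>UNIV. A 0 $ undefined $ l * \<gamma> l)) (at 0)"
    by (intro tendsto_sum tendsto_mult lim[OF A] Sl)
  have "(\<Sum>l\<in>UNIV. A 0 $ undefined $ l * \<gamma> l) = c"
    by (rule tendsto_unique[OF at_neq_bot ASlim[unfolded ASeq] quot])
  then have rg: "(\<Sum>l\<in>UNIV. \<rho> l * \<gamma> l) = 1"
    using c by (simp add: \<rho>_def flip: sum_divide_distrib)
  have r0: "(\<Sum>l\<in>UNIV. \<rho> l * g 0 $ l $ i) = 0" for i
  proof -
    have "(A 0 ** g 0) $ undefined $ i = 0" unfolding Ag by (simp add: mat_scale_def)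
    then show ?thesis by (simp add: \<rho>_def matrix_matrix_mult_def flip: sum_divide_distrib)
  qed
  show ?thesis
    by (rule that[of \<rho> \<gamma>]) (use breve A0 rg r0 Sl in \<open>auto simp: \<rho>_def S_def\<close>)
qed

end

end

subsection \<open>Entries of the R-matrix\<close>

lemma periodic_int_cong:
  fixes F :: "int \<Rightarrow> 'a"
  assumes "\<And>a. F (a + N) = F a" and "N dvd a - b"
  shows "F a = F b"
proof -
  have *: "F (b + k * N) = F b" for k
  proof (induction k rule: int_induct[where k = 0])
    case (step1 i)
    then show ?case using assms(1)[of "b + i * N"] by (simp add: algebra_simps)
  next
    case (step2 i)
    then show ?case using assms(1)[of "b + (i - 1) * N"] by (simp add: algebra_simps)
  qed simp
  obtain k where "a = b + k * N"
    using assms(2) unfolding dvd_def by (metis add.commute diff_add_cancel mult.commute)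
  then show ?thesis using * by simp
qed

lemma sum_periodic_shift:
  fixes F :: "int \<Rightarrow> 'a::comm_monoid_add"
  assumes N: "N > 0" and F: "\<And>a. F (a + N) = F a"
  shows "(\<Sum>a\<in>{0..<N}. F (a + 1)) = (\<Sum>a\<in>{0..<N}. F a)"
proof -
  have "F (a mod N) = F a" for a
    by (rule periodic_int_cong[where F = F and N = N, OF F]) (simp add: mod_eq_dvd_iff[symmetric])
  then show ?thesis
    using N
    by (intro sum.reindex_bij_witness[where j = "\<lambda>a. (a + 1) mod N" and i = "\<lambda>b. (b - 1) mod N"])
       (auto simp: mod_diff_left_eq mod_add_left_eq)
qed

lemma kronecker_phi_add_1: "kronecker_phi \<tau> z (x + 1) = kronecker_phi \<tau> z x"
  using vartheta_add_1[of \<tau> x] vartheta_add_1[of \<tau> "z + x"]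
  by (simp add: kronecker_phi_def add.assoc)

lemma kronecker_phi_add_tau: "kronecker_phi \<tau> z (x + \<tau>) = exp (- (2 * of_real pi * \<i> * z)) * kronecker_phi \<tau> z x"
proof -
  have "vartheta \<tau> (z + (x + \<tau>)) =
      - exp (- (of_real pi * \<i> * \<tau> + 2 * of_real pi * \<i> * x)) * (exp (- (2 * of_real pi * \<i> * z)) * vartheta \<tau> (z + x))"
    using vartheta_add_tau[of \<tau> "z + x"] by (simp add: algebra_simps exp_diff exp_add exp_minus divide_inverse)
  then show ?thesis
    unfolding kronecker_phi_def vartheta_add_tau by (simp add: mult_ac)
qed

text \<open>In an entry of R the power of \<open>Lambda_mat\<close> fixes \<open>a2\<close> modulo
  \<open>N\<close>, here called \<open>a\<close>, while the diagonal power of \<open>Q_mat\<close>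
  leaves a discrete Fourier sum over \<open>a1\<close> with frequency \<open>s\<close>.\<close>

definition R_coeff :: "nat \<Rightarrow> complex \<Rightarrow> complex \<Rightarrow> int \<Rightarrow> int \<Rightarrow> complex \<Rightarrow> complex" where
  "R_coeff N \<tau> z a s h = (\<Sum>a1\<in>{0..<int N}.
     exp (2 * of_real pi * \<i> * of_int (a1 * s) / of_nat N) * varphi_N N \<tau> a1 a h z) / of_nat N"

context
  fixes N :: nat and \<tau> z :: complex
  assumes N: "N > 0"
begin

lemma varphi_N_add_N1: "varphi_N N \<tau> (a1 + int N) a h z = varphi_N N \<tau> a1 a h z"
proof -
  have "(h + of_int (a1 + int N) + of_int a * \<tau>) / of_nat N = (h + of_int a1 + of_int a * \<tau>) / of_nat N + 1"
    using N by (simp add: field_simps)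
  then show ?thesis by (simp only: varphi_N_def kronecker_phi_add_1)
qed

text \<open>The factor \<open>exp (- (2 * pi * \<i> * z))\<close> from the quasi-period of the
  Kronecker function cancels against the exponential prefactor.\<close>

lemma varphi_N_add_N2: "varphi_N N \<tau> a1 (a + int N) h z = varphi_N N \<tau> a1 a h z"
proof -
  have "(h + of_int a1 + of_int (a + int N) * \<tau>) / of_nat N = (h + of_int a1 + of_int a * \<tau>) / of_nat N + \<tau>"
    using N by (simp add: field_simps)
  moreover have "2 * of_real pi * \<i> * of_int (a + int N) * z / of_nat N =
      2 * of_real pi * \<i> * of_int a * z / of_nat N + 2 * of_real pi * \<i> * z"
    using N by (simp add: field_simps)
  ultimately show ?thesis
    by (simp only: varphi_N_def kronecker_phi_add_tau exp_add) (simp add: exp_minus)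
qed

lemma exp_root_add_N: "exp (2 * of_real pi * \<i> * of_int (a + int N * b) / of_nat N) = exp (2 * of_real pi * \<i> * of_int a / of_nat N)"
proof -
  have "2 * of_real pi * \<i> * of_int (a + int N * b) / of_nat N =
      2 * of_real pi * \<i> * of_int a / of_nat N + 2 * of_real pi * \<i> * of_int b"
    using N by (simp add: field_simps)
  then show ?thesis by (simp only: exp_add exp_2pi_i_int mult_1_right)
qed

lemma R_coeff_cong:
  assumes "int N dvd a - a'" "int N dvd s - s'"
  shows "R_coeff N \<tau> z a s h = R_coeff N \<tau> z a' s' h"
proof -
  have "R_coeff N \<tau> z a s h = R_coeff N \<tau> z a' s h"
    by (rule periodic_int_cong[OF _ assms(1)]) (simp only: R_coeff_def varphi_N_add_N2)
  also have "\<dots> = R_coeff N \<tau> z a' s' h"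
  proof (rule periodic_int_cong[OF _ assms(2)])
    show "R_coeff N \<tau> z a' (s + int N) h = R_coeff N \<tau> z a' s h" for s
      unfolding R_coeff_def
    proof (intro arg_cong2[of _ _ _ _ "(/)"] sum.cong refl arg_cong2[of _ _ _ _ "(*)"])
      fix a1 :: int
      show "exp (2 * of_real pi * \<i> * of_int (a1 * (s + int N)) / of_nat N) =
          exp (2 * of_real pi * \<i> * of_int (a1 * s) / of_nat N)"
        using exp_root_add_N[of "a1 * s" a1] by (simp only: distrib_left mult.commute)
    qed
  qed
  finally show ?thesis .
qed

text \<open>Raising \<open>h\<close> by 1 is the same as raising \<open>a1\<close> by 1; reindexing
  the periodic Fourier sum costs a root of unity.\<close>

lemma R_coeff_add_1:
  "R_coeff N \<tau> z a s (h + 1) = exp (- (2 * of_real pi * \<i> * of_int s / of_nat N)) * R_coeff N \<tau> z a s h"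
proof -
  define F where "F = (\<lambda>a1. exp (2 * of_real pi * \<i> * of_int (a1 * s) / of_nat N) * varphi_N N \<tau> a1 a h z)"
  have F: "F (b + int N) = F b" for b
    using exp_root_add_N[of "b * s" s] unfolding F_def varphi_N_add_N1 by (simp only: distrib_right)
  have "exp (2 * of_real pi * \<i> * of_int (a1 * s) / of_nat N) * varphi_N N \<tau> a1 a (h + 1) z =
      exp (- (2 * of_real pi * \<i> * of_int s / of_nat N)) * F (a1 + 1)" for a1
  proof -
    have "2 * of_real pi * \<i> * of_int (a1 * s) / of_nat N =
        - (2 * of_real pi * \<i> * of_int s / of_nat N) + 2 * of_real pi * \<i> * of_int ((a1 + 1) * s) / (of_nat N :: complex)"
      using N by (simp add: field_simps)
    moreover have "varphi_N N \<tau> a1 a (h + 1) z = varphi_N N \<tau> (a1 + 1) a h z"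
      by (simp add: varphi_N_def add_ac)
    ultimately show ?thesis by (simp only: exp_add F_def mult.assoc)
  qed
  then have "R_coeff N \<tau> z a s (h + 1) =
      exp (- (2 * of_real pi * \<i> * of_int s / of_nat N)) * ((\<Sum>a1\<in>{0..<int N}. F (a1 + 1)) / of_nat N)"
    by (simp add: R_coeff_def sum_distrib_left)
  also have "(\<Sum>a1\<in>{0..<int N}. F (a1 + 1)) = (\<Sum>a1\<in>{0..<int N}. F a1)"
    using N F by (intro sum_periodic_shift) auto
  finally show ?thesis by (simp add: R_coeff_def F_def)
qed

text \<open>Raising \<open>h\<close> by \<tau> is the same as raising \<open>a\<close> by 1, up to
  the exponential prefactor of \<open>varphi_N\<close>.\<close>

lemma R_coeff_add_tau:
  "R_coeff N \<tau> z a s (h + \<tau>) = exp (- (2 * of_real pi * \<i> * z / of_nat N)) * R_coeff N \<tau> z (a + 1) s h"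
proof -
  have "varphi_N N \<tau> a1 a (h + \<tau>) z = exp (- (2 * of_real pi * \<i> * z / of_nat N)) * varphi_N N \<tau> a1 (a + 1) h z" for a1
  proof -
    have "2 * of_real pi * \<i> * of_int a * z / of_nat N =
        - (2 * of_real pi * \<i> * z / of_nat N) + 2 * of_real pi * \<i> * of_int (a + 1) * z / of_nat N"
      using N by (simp add: field_simps)
    moreover have "h + \<tau> + of_int a1 + of_int a * \<tau> = h + of_int a1 + of_int (a + 1) * \<tau>"
      by (simp add: algebra_simps)
    ultimately show ?thesis by (simp only: varphi_N_def exp_add mult.assoc)
  qed
  then show ?thesis
    by (simp add: R_coeff_def sum_distrib_left mult_ac)
qed

end

section \<open>Poles of the coefficients in \<open>h\<close>\<close>

context
  fixes N :: nat and \<tau> z :: complex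
  assumes N: "N > 0" and tau: "Im \<tau> > 0" and z: "z \<notin> period_lattice \<tau>"
begin

lemma torsion_point_lattice_iff:
  "(of_int a1 + of_int a * \<tau>) / of_nat N \<in> period_lattice \<tau> \<longleftrightarrow> int N dvd a1 \<and> int N dvd a"
proof
  assume "(of_int a1 + of_int a * \<tau>) / of_nat N \<in> period_lattice \<tau>"
  then obtain m n where "(of_int a1 + of_int a * \<tau>) / of_nat N = of_int m + of_int n * \<tau>"
    by (auto simp: period_lattice_iff)
  then have eq: "of_int a1 + of_int a * \<tau> = of_nat N * (of_int m + of_int n * \<tau>)"
    using N by (simp add: field_simps)
  have "real_of_int a * Im \<tau> = of_nat N * of_int n * Im \<tau>"
    using arg_cong[OF eq, of Im] by simp
  then have "real_of_int a = of_int (int N * n)" using tau by simp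
  then have a: "a = int N * n" by linarith
  have "real_of_int a1 = of_int (int N * m)"
    using arg_cong[OF eq, of Re] by (simp add: a algebra_simps)
  then have "a1 = int N * m" by linarith
  with a show "int N dvd a1 \<and> int N dvd a" by simp
next
  assume "int N dvd a1 \<and> int N dvd a"
  then obtain m n where "a1 = int N * m" "a = int N * n" by (auto simp: dvd_def)
  then have "(of_int a1 + of_int a * \<tau>) / of_nat N = of_int m + of_int n * \<tau>"
    using N by (simp add: field_simps)
  then show "(of_int a1 + of_int a * \<tau>) / of_nat N \<in> period_lattice \<tau>"
    unfolding period_lattice_iff by blast
qed

lemma vartheta_torsion_nonzero:
  assumes "vartheta \<tau> h \<noteq> 0"
  shows "vartheta \<tau> ((h + of_int a1 + of_int a * \<tau>) / of_nat N) \<noteq> 0"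
proof
  assume "vartheta \<tau> ((h + of_int a1 + of_int a * \<tau>) / of_nat N) = 0"
  then obtain m n where "(h + of_int a1 + of_int a * \<tau>) / of_nat N = of_int m + of_int n * \<tau>"
    by (auto simp: vartheta_eq_0_iff[OF tau] period_lattice_iff)
  then have "h = of_int (int N * m - a1) + of_int (int N * n - a) * \<tau>"
    using N by (simp add: field_simps)
  then have "h \<in> period_lattice \<tau>" unfolding period_lattice_iff by blast
  then show False using assms by (simp add: vartheta_eq_0_iff[OF tau])
qed

lemma holomorphic_R_coeff: "R_coeff N \<tau> z a s holomorphic_on {h. vartheta \<tau> h \<noteq> 0}"
  unfolding R_coeff_def[abs_def] varphi_N_def kronecker_phi_def
  by (intro holomorphic_intros tau)
     (use N z vartheta_torsion_nonzero in \<open>auto simp: vartheta_eq_0_iff[OF tau]\<close>)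

text \<open>Only for \<open>a1 = 0\<close> does the torsion point hit the lattice. There
  \<open>vartheta \<tau> (h / N)\<close> behaves like \<open>c * h / N\<close>, and \<open>c\<close>
  cancels against the derivative that normalizes the Kronecker function.\<close>

lemma varphi_N_residue:
  "((\<lambda>h. h * varphi_N N \<tau> a1 0 h z) \<longlongrightarrow> (if a1 = 0 then of_nat N else 0)) (at 0)" if "0 \<le> a1" "a1 < int N"
proof (cases "a1 = 0")
  case True
  define c where "c = deriv (vartheta \<tau>) 0"
  have c: "c \<noteq> 0" using deriv_vartheta_nonzero[OF tau vartheta_0] by (simp add: c_def)
  have zn: "vartheta \<tau> z \<noteq> 0" using z by (simp add: vartheta_eq_0_iff[OF tau])
  have hol: "vartheta \<tau> holomorphic_on UNIV"
    using holomorphic_vartheta[OF tau holomorphic_on_ident] .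
  have "(vartheta \<tau> has_field_derivative c) (at (0 / of_nat N))"
    using hol by (auto simp: c_def intro: holomorphic_derivI)
  then have "((\<lambda>h. vartheta \<tau> (h / of_nat N)) has_field_derivative c * (1 / of_nat N)) (at 0)"
    by (rule DERIV_chain2) (use N in \<open>auto intro!: derivative_eq_intros\<close>)
  then have quot: "((\<lambda>h. vartheta \<tau> (h / of_nat N) / h) \<longlongrightarrow> c / of_nat N) (at 0)"
    by (simp add: has_field_derivative_iff)
  have cont: "isCont (vartheta \<tau>) w" for w
    using holomorphic_on_imp_continuous_on[OF hol] by (simp add: continuous_on_eq_continuous_at)
  have "isCont (\<lambda>h. c * vartheta \<tau> (z + h / of_nat N) / vartheta \<tau> z) 0"
    using N zn by (intro continuous_intros isCont_o2[OF _ cont]) auto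
  then have "((\<lambda>h. c * vartheta \<tau> (z + h / of_nat N) / vartheta \<tau> z) \<longlongrightarrow> c) (at 0)"
    using zn unfolding isCont_def by simp
  then have "((\<lambda>h. c * vartheta \<tau> (z + h / of_nat N) / vartheta \<tau> z / (vartheta \<tau> (h / of_nat N) / h)) \<longlongrightarrow>
      c / (c / of_nat N)) (at 0)"
    using c N by (intro tendsto_divide quot) auto
  then show ?thesis
    using True c by (simp add: varphi_N_def kronecker_phi_def c_def mult_ac)
next
  case False
  have "(of_int a1 + of_int 0 * \<tau>) / of_nat N \<notin> period_lattice \<tau>"
    using False that zdvd_not_zless[of a1 "int N"] unfolding torsion_point_lattice_iff by auto
  then have nz: "vartheta \<tau> (of_int a1 / of_nat N) \<noteq> 0"
    by (simp add: vartheta_eq_0_iff[OF tau])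
  have zn: "vartheta \<tau> z \<noteq> 0" using z by (simp add: vartheta_eq_0_iff[OF tau])
  have cont: "isCont (vartheta \<tau>) w" for w
    using holomorphic_on_imp_continuous_on[OF holomorphic_vartheta[OF tau holomorphic_on_ident, of UNIV]]
    by (simp add: continuous_on_eq_continuous_at)
  have "isCont (\<lambda>h. h * varphi_N N \<tau> a1 0 h z) 0"
    unfolding varphi_N_def kronecker_phi_def
    using nz zn N by (intro continuous_intros isCont_o2[OF _ cont]) auto
  then have "((\<lambda>h. h * varphi_N N \<tau> a1 0 h z) \<longlongrightarrow> 0 * varphi_N N \<tau> a1 0 0 z) (at 0)"
    unfolding isCont_def .
  then show ?thesis using False by simp
qed

lemma varphi_N_regular:
  assumes "\<not> int N dvd a"
  shows "((\<lambda>h. h * varphi_N N \<tau> a1 a h z) \<longlongrightarrow> 0) (at 0)"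
proof -
  have "(of_int a1 + of_int a * \<tau>) / of_nat N \<notin> period_lattice \<tau>"
    using assms unfolding torsion_point_lattice_iff by auto
  then have nz: "vartheta \<tau> ((of_int a1 + of_int a * \<tau>) / of_nat N) \<noteq> 0"
    by (simp add: vartheta_eq_0_iff[OF tau])
  have zn: "vartheta \<tau> z \<noteq> 0" using z by (simp add: vartheta_eq_0_iff[OF tau])
  have cont: "isCont (vartheta \<tau>) w" for w
    using holomorphic_on_imp_continuous_on[OF holomorphic_vartheta[OF tau holomorphic_on_ident, of UNIV]]
    by (simp add: continuous_on_eq_continuous_at)
  have "isCont (\<lambda>h. h * varphi_N N \<tau> a1 a h z) 0"
    unfolding varphi_N_def kronecker_phi_def
    using nz zn N by (intro continuous_intros isCont_o2[OF _ cont]) auto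
  then show ?thesis
    unfolding isCont_def by simp
qed

text \<open>The limit does not depend on \<open>s\<close>, since only the term \<open>a1 = 0\<close>
  contributes and its character value is 1.\<close>

lemma R_coeff_residue:
  "((\<lambda>h. h * R_coeff N \<tau> z a s h) \<longlongrightarrow> (if int N dvd a then 1 else 0)) (at 0)"
proof -
  have eq: "h * R_coeff N \<tau> z a s h = (\<Sum>a1\<in>{0..<int N}.
     exp (2 * of_real pi * \<i> * of_int (a1 * s) / of_nat N) * (h * varphi_N N \<tau> a1 a h z)) / of_nat N" for a h
    by (simp add: R_coeff_def sum_distrib_left mult_ac)
  show ?thesis
  proof (cases "int N dvd a")
    case True
    then have "R_coeff N \<tau> z a s h = R_coeff N \<tau> z 0 s h" for h by (intro R_coeff_cong[OF N]) auto
    moreover have "((\<lambda>h. h * R_coeff N \<tau> z 0 s h) \<longlongrightarrow> (\<Sum>a1\<in>{0..<int N}.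
        exp (2 * of_real pi * \<i> * of_int (a1 * s) / of_nat N) * (if a1 = 0 then of_nat N else 0)) / of_nat N) (at 0)"
      unfolding eq using N by (intro tendsto_intros varphi_N_residue) auto
    moreover have "(\<Sum>a1\<in>{0..<int N}.
        exp (2 * of_real pi * \<i> * of_int (a1 * s) / of_nat N) * (if a1 = 0 then of_nat N else 0)) =
        (\<Sum>a1\<in>{0..<int N}. if a1 = 0 then of_nat N else (0::complex))"
      by (intro sum.cong) auto
    ultimately show ?thesis using True N by simp
  next
    case False
    have "((\<lambda>h. h * R_coeff N \<tau> z a s h) \<longlongrightarrow> (\<Sum>a1\<in>{0..<int N}.
        exp (2 * of_real pi * \<i> * of_int (a1 * s) / of_nat N) * 0) / of_nat N) (at 0)"
      unfolding eq using N False by (intro tendsto_intros varphi_N_regular) auto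
    then show ?thesis using False by simp
  qed
qed

end

subsection \<open>The matrices \<open>T\<close>\<close>

definition diag_mat :: "('n \<Rightarrow> complex) \<Rightarrow> complex^'n^'n" where
  "diag_mat f = (\<chi> k l. if k = l then f k else 0)"

lemma diag_mat_mult: "diag_mat f ** diag_mat f' = diag_mat (\<lambda>k. f k * f' k)"
proof -
  have "(\<Sum>j\<in>UNIV. (if k = j then f k else 0) * (if j = l then f' j else 0)) = (if k = l then f k * f' k else 0)" for k l
    using sum.delta[of UNIV k "\<lambda>j. f k * (if j = l then f' j else 0)"]
    by (simp add: if_distrib[of "\<lambda>x. x * _"] cong: if_cong)
  then show ?thesis
    by (simp add: diag_mat_def matrix_matrix_mult_def)
qed

lemma diag_mat_1: "mat 1 = diag_mat (\<lambda>_. 1)"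
  by (simp add: diag_mat_def mat_def)

text \<open>A closed form for all integer powers, negative ones included, follows from the
  homomorphism law alone.\<close>

lemma mat_power_hom:
  assumes "\<And>a b. M (a + b) = M a ** M b" "M 0 = mat 1"
  shows "mat_powi (M 1) a = M (a :: int)"
proof -
  have pow: "(((**) (M c)) ^^ n) (mat 1) = M (int n * c)" for n c
    by (induction n) (simp_all add: assms(2) assms(1)[symmetric] distrib_right)
  have "M 1 ** M (- 1) = mat 1" using assms(1)[of 1 "- 1"] assms(2) by simp
  then have "matrix_inv (M 1) = M (- 1)" by (rule matrix_inv_eq)
  then show ?thesis by (simp add: mat_powi_def pow)
qed

definition shift_mat :: "('n::finite \<Rightarrow> nat) \<Rightarrow> int \<Rightarrow> complex^'n^'n" where
  "shift_mat ix a = (\<chi> k l. if int CARD('n) dvd int (ix k) - int (ix l) + a then 1 else 0)"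

context
  fixes ix :: "'n::finite \<Rightarrow> nat"
  assumes ix: "bij_betw ix UNIV {1..CARD('n)}"
begin

lemma ix_residue:
  obtains p where "\<And>p'. int CARD('n) dvd q - int (ix p') \<longleftrightarrow> p' = p"
proof -
  \<comment> \<open>Labels run from 1 to \<open>N\<close>, not from 0, hence the shift before and
    after the reduction.\<close>
  define r where "r = (q - 1) mod int CARD('n) + 1"
  have "0 \<le> (q - 1) mod int CARD('n)" "(q - 1) mod int CARD('n) < int CARD('n)" by simp_all
  then have "0 < r" "r \<le> int CARD('n)" unfolding r_def by linarith+
  then have "nat r \<in> {1..CARD('n)}" by auto
  then obtain p where p: "ix p = nat r"
    using ix unfolding bij_betw_def by (metis imageE)
  have "q - r = (q - 1) - (q - 1) mod int CARD('n)" by (simp add: r_def)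
  then have "int CARD('n) dvd q - r" by (simp only: dvd_minus_mod)
  then have qp: "int CARD('n) dvd q - int (ix p)" using p \<open>0 < r\<close> by simp
  have "int CARD('n) dvd q - int (ix p') \<longleftrightarrow> p' = p" for p'
  proof -
    have "q - int (ix p') = (q - int (ix p)) + (int (ix p) - int (ix p'))" by simp
    then have "int CARD('n) dvd q - int (ix p') \<longleftrightarrow> int CARD('n) dvd int (ix p) - int (ix p')"
      by (simp only: dvd_add_right_iff[OF qp])
    then show ?thesis using ix_cong_iff[OF ix] by auto
  qed
  then show ?thesis by (rule that)
qed

lemma sum_residue_class:
  assumes "\<And>p. int CARD('n) dvd q - int (ix p) \<Longrightarrow> f p = (c :: complex)"
  shows "(\<Sum>p\<in>UNIV. if int CARD('n) dvd q - int (ix p) then f p else 0) = c"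
proof -
  obtain p where p: "\<And>p'. int CARD('n) dvd q - int (ix p') \<longleftrightarrow> p' = p" using ix_residue[of q] by blast
  then have "(\<Sum>p'\<in>UNIV. if int CARD('n) dvd q - int (ix p') then f p' else 0) = f p" by simp
  then show ?thesis using assms p by simp
qed

lemma Q_mat_powi: "mat_powi (Q_mat ix) a = diag_mat (\<lambda>k. exp (2 * of_real pi * \<i> * of_nat (ix k) * of_int a / of_nat CARD('n)))"
proof -
  have "Q_mat ix = diag_mat (\<lambda>k. exp (2 * of_real pi * \<i> * of_nat (ix k) * of_int 1 / of_nat CARD('n)))"
    by (simp add: Q_mat_def diag_mat_def)
  moreover have "mat_powi (diag_mat (\<lambda>k. exp (2 * of_real pi * \<i> * of_nat (ix k) * of_int 1 / of_nat CARD('n)))) a =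
      diag_mat (\<lambda>k. exp (2 * of_real pi * \<i> * of_nat (ix k) * of_int a / of_nat CARD('n)))"
    by (rule mat_power_hom[where M = "\<lambda>a. diag_mat (\<lambda>k. exp (2 * of_real pi * \<i> * of_nat (ix k) * of_int a / of_nat CARD('n)))"])
       (simp_all add: diag_mat_mult diag_mat_1 distrib_left add_divide_distrib exp_add)
  ultimately show ?thesis by simp
qed

lemma shift_mat_add: "shift_mat ix (a + b) = shift_mat ix a ** shift_mat ix b"
proof -
  have "(\<Sum>j\<in>UNIV. (if int CARD('n) dvd int (ix k) - int (ix j) + a then 1 else 0) *
      (if int CARD('n) dvd int (ix j) - int (ix l) + b then 1 else 0)) =
      (if int CARD('n) dvd int (ix k) - int (ix l) + (a + b) then 1 else (0 :: complex))" (is "?L = ?R") for k l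
  proof -
    have "?L = (\<Sum>j\<in>UNIV. if int CARD('n) dvd int (ix k) + a - int (ix j) then
      (if int CARD('n) dvd int (ix j) - int (ix l) + b then 1 else 0) else 0)"
      by (intro sum.cong) (auto simp: algebra_simps)
    also have "\<dots> = ?R"
    proof (rule sum_residue_class)
      fix j assume "int CARD('n) dvd int (ix k) + a - int (ix j)"
      then have "int CARD('n) dvd int (ix j) - int (ix l) + b \<longleftrightarrow>
          int CARD('n) dvd (int (ix k) + a - int (ix j)) + (int (ix j) - int (ix l) + b)"
        by (rule dvd_add_right_iff[symmetric])
      also have "(int (ix k) + a - int (ix j)) + (int (ix j) - int (ix l) + b) = int (ix k) - int (ix l) + (a + b)"
        by simp
      finally show "(if int CARD('n) dvd int (ix j) - int (ix l) + b then 1 else 0) = ?R" by simp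
    qed
    finally show ?thesis .
  qed
  then show ?thesis
    by (simp add: shift_mat_def matrix_matrix_mult_def)
qed

lemma Lambda_mat_powi: "mat_powi (Lambda_mat ix) a = shift_mat ix a"
proof -
  have "shift_mat ix 0 = mat 1"
    by (auto simp: shift_mat_def mat_def vec_eq_iff ix_cong_iff[OF ix])
  moreover have "Lambda_mat ix = shift_mat ix 1"
    by (simp add: Lambda_mat_def shift_mat_def dvd_eq_mod_eq_0)
  ultimately show ?thesis using mat_power_hom[of "shift_mat ix"] shift_mat_add by simp
qed

lemma T_mat_entry:
  "T_mat ix a1 a2 $ k $ l = (if int CARD('n) dvd int (ix k) - int (ix l) + a2
    then exp (of_real pi * \<i> * of_int a1 * of_int a2 / of_nat CARD('n)) *
      exp (2 * of_real pi * \<i> * of_nat (ix k) * of_int a1 / of_nat CARD('n)) else 0)"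
proof -
  have "(\<Sum>j\<in>UNIV. (if k = j then c else 0) * X j) = c * (X k :: complex)" for c X
    using sum.delta[of UNIV k "\<lambda>j. c * X j"] by (simp add: if_distrib[of "\<lambda>x. x * _"] cong: if_cong)
  then show ?thesis
    unfolding T_mat_def Q_mat_powi Lambda_mat_powi
    by (simp add: mat_scale_def diag_mat_def shift_mat_def matrix_matrix_mult_def)
qed

text \<open>The two congruences are replaced by the first one and their sum, which is free of
  \<open>a2\<close>: a conservation law for the labels. The two half phases
  \<open>a1 * a2 / 2\<close> add up, so the phase becomes a character of \<open>a1\<close>.\<close>

lemma T_tensor_entry:
  "(T_mat ix a1 a2 \<otimes>\<^sub>K T_mat ix (- a1) (- a2)) $ (k, l) $ (m, p) =
    (if int CARD('n) dvd int (ix k) - int (ix m) + a2 \<and> int CARD('n) dvd int (ix k) + int (ix l) - int (ix m) - int (ix p)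
     then exp (2 * of_real pi * \<i> * of_int (a1 * (a2 + int (ix k) - int (ix l))) / of_nat CARD('n)) else 0)"
proof -
  have "int CARD('n) dvd int (ix l) - int (ix p) + - a2 \<longleftrightarrow> int CARD('n) dvd int (ix k) + int (ix l) - int (ix m) - int (ix p)"
    if "int CARD('n) dvd int (ix k) - int (ix m) + a2"
  proof -
    have "int (ix k) + int (ix l) - int (ix m) - int (ix p) = (int (ix k) - int (ix m) + a2) + (int (ix l) - int (ix p) + - a2)"
      by simp
    then show ?thesis by (simp only: dvd_add_right_iff[OF that])
  qed
  moreover have "exp (of_real pi * \<i> * of_int a1 * of_int a2 / of_nat CARD('n)) *
      exp (2 * of_real pi * \<i> * of_nat (ix k) * of_int a1 / of_nat CARD('n)) *
      (exp (of_real pi * \<i> * of_int (- a1) * of_int (- a2) / of_nat CARD('n)) *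
      exp (2 * of_real pi * \<i> * of_nat (ix l) * of_int (- a1) / of_nat CARD('n))) =
      exp (2 * of_real pi * \<i> * of_int (a1 * (a2 + int (ix k) - int (ix l))) / of_nat CARD('n))"
    unfolding exp_add[symmetric] by (rule arg_cong[of _ _ exp]) (simp add: field_simps)
  ultimately show ?thesis
    by (auto simp: tensor_mat_def T_mat_entry)
qed

lemma mat_sum_entry: "sum M X $ i $ j = (\<Sum>x\<in>X. (M x :: 'a::comm_monoid_add^'b^'c) $ i $ j)"
  by (induction X rule: infinite_finite_induct) auto

lemma sum_int_residue:
  fixes f :: "int \<Rightarrow> complex"
  shows "(\<Sum>a\<in>{0..<int CARD('n)}. if int CARD('n) dvd a - b then f a else 0) = f (b mod int CARD('n))"
proof -
  have "int CARD('n) dvd a - b \<longleftrightarrow> a = b mod int CARD('n)" if "a \<in> {0..<int CARD('n)}" for a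
    using that unfolding mod_eq_dvd_iff[symmetric] by auto
  then have "(\<Sum>a\<in>{0..<int CARD('n)}. if int CARD('n) dvd a - b then f a else 0) = (\<Sum>a\<in>{0..<int CARD('n)}. if a = b mod int CARD('n) then f a else 0)"
    by (intro sum.cong) auto
  then show ?thesis by simp
qed

text \<open>The first congruence leaves one value of \<open>a2\<close>, namely
  \<open>b mod N\<close>; the frequency is then congruent to the difference of the labels of
  \<open>m\<close> and \<open>l\<close>.\<close>

lemma R_BB_entry:
  "R_BB ix \<tau> h z $ (k, l) $ (m, p) =
    (if int CARD('n) dvd int (ix k) + int (ix l) - int (ix m) - int (ix p)
     then R_coeff CARD('n) \<tau> z (int (ix m) - int (ix k)) (int (ix m) - int (ix l)) h else 0)"
proof -
  define D where "D \<longleftrightarrow> int CARD('n) dvd int (ix k) + int (ix l) - int (ix m) - int (ix p)"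
  define b where "b = int (ix m) - int (ix k)"
  let ?e = "\<lambda>s. exp (2 * of_real pi * \<i> * of_int s / of_nat CARD('n))"
  have dvd: "int CARD('n) dvd int (ix k) - int (ix m) + a2 \<longleftrightarrow> int CARD('n) dvd a2 - b" for a2
    by (simp add: b_def algebra_simps)
  have "R_BB ix \<tau> h z $ (k, l) $ (m, p) = (\<Sum>a1\<in>{0..<int CARD('n)}. \<Sum>a2\<in>{0..<int CARD('n)}.
      if int CARD('n) dvd a2 - b then (if D then ?e (a1 * (a2 + int (ix k) - int (ix l))) * varphi_N CARD('n) \<tau> a1 a2 h z else 0) else 0) / of_nat CARD('n)"
    unfolding R_BB_def sum.cartesian_product
    by (simp add: mat_scale_def mat_sum_entry case_prod_unfold T_tensor_entry dvd D_def[symmetric])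
       (intro arg_cong2[of _ _ _ _ "(/)"] refl sum.cong, auto)
  also have "\<dots> = (\<Sum>a1\<in>{0..<int CARD('n)}. if D then ?e (a1 * (b mod int CARD('n) + int (ix k) - int (ix l))) *
      varphi_N CARD('n) \<tau> a1 (b mod int CARD('n)) h z else 0) / of_nat CARD('n)"
    unfolding sum_int_residue ..
  also have "\<dots> = (if D then R_coeff CARD('n) \<tau> z (b mod int CARD('n)) (b mod int CARD('n) + int (ix k) - int (ix l)) h else 0)"
    by (simp add: R_coeff_def)
  also have "R_coeff CARD('n) \<tau> z (b mod int CARD('n)) (b mod int CARD('n) + int (ix k) - int (ix l)) h =
      R_coeff CARD('n) \<tau> z b (int (ix m) - int (ix l)) h"
  proof (rule R_coeff_cong[OF zero_less_card_finite])
    show *: "int CARD('n) dvd b mod int CARD('n) - b" by (simp flip: mod_eq_dvd_iff)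
    have "b mod int CARD('n) + int (ix k) - int (ix l) - (int (ix m) - int (ix l)) = b mod int CARD('n) - b"
      by (simp add: b_def)
    then show "int CARD('n) dvd b mod int CARD('n) + int (ix k) - int (ix l) - (int (ix m) - int (ix l))"
      using * by simp
  qed
  finally show ?thesis unfolding D_def b_def .
qed

lemma R_BB_residue:
  assumes tau: "Im \<tau> > 0" and z: "z \<notin> period_lattice \<tau>"
  shows "((\<lambda>h. h * R_BB ix \<tau> h z $ (k, l) $ (m, p)) \<longlongrightarrow> (if k = m \<and> l = p then 1 else 0)) (at 0)"
proof (cases "int CARD('n) dvd int (ix k) + int (ix l) - int (ix m) - int (ix p)")
  case True
  \<comment> \<open>Under the conservation law \<open>k = m\<close> already forces
    \<open>l = p\<close>, so the residue of R is the identity.\<close>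
  have "int CARD('n) dvd int (ix m) - int (ix k) \<longleftrightarrow> k = m \<and> l = p"
  proof
    assume *: "int CARD('n) dvd int (ix m) - int (ix k)"
    then have "k = m" using ix_cong_iff[OF ix] by auto
    then show "k = m \<and> l = p" using True ix_cong_iff[OF ix] by auto
  qed simp
  then show ?thesis
    using R_coeff_residue[OF zero_less_card_finite[where 'a = 'n] tau z, of "int (ix m) - int (ix k)" "int (ix m) - int (ix l)"] True
    by (simp add: R_BB_entry)
next
  case False
  then have "\<not> (k = m \<and> l = p)" by auto
  then have "(if k = m \<and> l = p then 1 else 0) = (0 :: complex)" by (rule if_not_P)
  then show ?thesis using False by (simp only: R_BB_entry if_False) simp
qed

end

subsection \<open>The intertwining relation\<close>

text \<open>A nonvanishing continuous multiplier does not affect whether a singularity is removable.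
  \<open>V'\<close> may differ from \<open>V\<close> because the shift by \<tau> changes the
  component index.\<close>

lemma pole_order_shift:
  fixes V V' e :: "complex \<Rightarrow> complex"
  assumes V: "\<And>w. V (w + c) = e w * V' w" and e: "isCont e s" "e s \<noteq> 0"
  shows "((\<lambda>w. (w - (s + c)) * V w) \<longlongrightarrow> 0) (at (s + c)) \<longleftrightarrow> ((\<lambda>w. (w - s) * V' w) \<longlongrightarrow> 0) (at s)"
proof
  assume "((\<lambda>w. (w - (s + c)) * V w) \<longlongrightarrow> 0) (at (s + c))"
  from LIM_offset[OF this, of c] have "((\<lambda>w. (w + c - (s + c)) * V (w + c)) \<longlongrightarrow> 0) (at s)" by simp
  then have "((\<lambda>w. (w + c - (s + c)) * V (w + c) / e w) \<longlongrightarrow> 0 / e s) (at s)"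
    using e unfolding isCont_def by (intro tendsto_divide)
  moreover have "eventually (\<lambda>w. e w \<noteq> 0) (at s)"
    using e unfolding isCont_def by (rule tendsto_imp_eventually_ne)
  then have "eventually (\<lambda>w. (w + c - (s + c)) * V (w + c) / e w = (w - s) * V' w) (at s)"
    by (rule eventually_mono) (simp add: V)
  ultimately show "((\<lambda>w. (w - s) * V' w) \<longlongrightarrow> 0) (at s)"
    using Lim_transform_eventually by fastforce
next
  assume "((\<lambda>w. (w - s) * V' w) \<longlongrightarrow> 0) (at s)"
  then have "((\<lambda>w. e w * ((w - s) * V' w)) \<longlongrightarrow> e s * 0) (at s)"
    using e(1) unfolding isCont_def by (intro tendsto_mult)
  then have "((\<lambda>w. (w + c - (s + c)) * V (w + c)) \<longlongrightarrow> 0) (at s)"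
    by (simp add: V mult_ac)
  from LIM_offset[OF this, of "- c"] show "((\<lambda>w. (w - (s + c)) * V w) \<longlongrightarrow> 0) (at (s + c))" by simp
qed

context
  fixes ix :: "'n::finite \<Rightarrow> nat" and \<tau> z :: complex and u :: "complex^'n" and \<rho> :: "'n \<Rightarrow> complex"
  assumes ix: "bij_betw ix UNIV {1..CARD('n)}" and tau: "Im \<tau> > 0" and z: "z \<notin> period_lattice \<tau>"
    and u: "\<And>i j. i \<noteq> j \<Longrightarrow> u $ i - u $ j \<notin> period_lattice \<tau>"
    and \<rho>: "\<And>i. (\<Sum>l\<in>UNIV. \<rho> l * g_mat ix \<tau> 0 u $ l $ i) = 0"
begin

private abbreviation (input) "y i \<equiv> of_nat CARD('n) * u $ i - (\<Sum>m\<in>UNIV. u $ m)"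
private abbreviation (input) "vdm i \<equiv> \<Prod>k\<in>UNIV - {i}. vartheta \<tau> (u $ k - u $ i)"

private lemma g_entry: "g_mat ix \<tau> h u $ p $ i = theta_vec CARD('n) \<tau> (int (ix p)) (h + y i) / vdm i"
  by (simp add: g_mat_def theta_vec_def add_diff_eq)

text \<open>The first tensor component of \<open>\<rho>\<^sub>2 R(h, z)\<close> applied to \<open>e\<^sub>m\<close> tensor the \<open>i\<close>-th column of
  \<open>g h\<close>, up to normalization. Summing over the integer residue class makes the index \<open>n\<close>
  an arbitrary integer.\<close>
definition contraction :: "'n \<Rightarrow> 'n \<Rightarrow> int \<Rightarrow> complex \<Rightarrow> complex" where
  "contraction m i n h = (\<Sum>l\<in>UNIV. \<rho> l *
     R_coeff CARD('n) \<tau> z (int (ix m) - n) (int (ix m) - int (ix l)) h *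
     theta_vec CARD('n) \<tau> (n + int (ix l) - int (ix m)) (h + y i))"

text \<open>The conservation law leaves one residue class for the label of \<open>p\<close>, and
  \<open>theta_vec\<close> depends only on that class.\<close>

lemma contraction_eq:
  "(\<Sum>l\<in>UNIV. \<Sum>p\<in>UNIV. \<rho> l * R_BB ix \<tau> h z $ (k, l) $ (m, p) * g_mat ix \<tau> h u $ p $ i) =
     contraction m i (int (ix k)) h / vdm i"
proof -
  have "(\<Sum>p\<in>UNIV. \<rho> l * R_BB ix \<tau> h z $ (k, l) $ (m, p) * g_mat ix \<tau> h u $ p $ i) =
      \<rho> l * R_coeff CARD('n) \<tau> z (int (ix m) - int (ix k)) (int (ix m) - int (ix l)) h *
      theta_vec CARD('n) \<tau> (int (ix k) + int (ix l) - int (ix m)) (h + y i) / vdm i" (is "_ = ?c") for l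
  proof -
    have "(\<Sum>p\<in>UNIV. \<rho> l * R_BB ix \<tau> h z $ (k, l) $ (m, p) * g_mat ix \<tau> h u $ p $ i) =
      (\<Sum>p\<in>UNIV. if int CARD('n) dvd (int (ix k) + int (ix l) - int (ix m)) - int (ix p)
        then \<rho> l * R_coeff CARD('n) \<tau> z (int (ix m) - int (ix k)) (int (ix m) - int (ix l)) h *
          theta_vec CARD('n) \<tau> (int (ix p)) (h + y i) / vdm i else 0)"
      by (intro sum.cong refl) (simp add: R_BB_entry[OF ix] g_entry)
    also have "\<dots> = ?c"
    proof (rule sum_residue_class[OF ix])
      fix p assume "int CARD('n) dvd int (ix k) + int (ix l) - int (ix m) - int (ix p)"
      then have "theta_vec CARD('n) \<tau> (int (ix k) + int (ix l) - int (ix m)) (h + y i) = theta_vec CARD('n) \<tau> (int (ix p)) (h + y i)"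
        by (intro theta_vec_cong[OF zero_less_card_finite]) (simp add: mod_eq_dvd_iff)
      then show "\<rho> l * R_coeff CARD('n) \<tau> z (int (ix m) - int (ix k)) (int (ix m) - int (ix l)) h *
          theta_vec CARD('n) \<tau> (int (ix p)) (h + y i) / vdm i = ?c" by simp
    qed
    finally show ?thesis .
  qed
  then show ?thesis by (simp add: contraction_def sum_divide_distrib)
qed

text \<open>The phases carry \<open>m - l\<close> from \<open>R_coeff\<close> and
  \<open>n + l - m\<close> from \<open>theta_vec\<close>, read as labels; they add up to
  \<open>n\<close>, so all summands over \<open>l\<close> share one factor.\<close>

lemma contraction_add_1:
  "contraction m i n (h + 1) = - exp (- (2 * of_real pi * \<i> * of_int n / of_nat CARD('n))) * contraction m i n h"
proof -
  have "R_coeff CARD('n) \<tau> z (int (ix m) - n) (int (ix m) - int (ix l)) (h + 1) *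
      theta_vec CARD('n) \<tau> (n + int (ix l) - int (ix m)) (h + 1 + y i) =
      - exp (- (2 * of_real pi * \<i> * of_int n / of_nat CARD('n))) *
      (R_coeff CARD('n) \<tau> z (int (ix m) - n) (int (ix m) - int (ix l)) h * theta_vec CARD('n) \<tau> (n + int (ix l) - int (ix m)) (h + y i))" for l
  proof -
    have h: "h + 1 + y i = (h + y i) + 1" by simp
    have "exp (- (2 * of_real pi * \<i> * of_int (int (ix m) - int (ix l)) / of_nat CARD('n))) *
        exp (- (2 * of_real pi * \<i> * of_int (n + int (ix l) - int (ix m)) / of_nat CARD('n))) =
        exp (- (2 * of_real pi * \<i> * of_int n / of_nat CARD('n)))"
      unfolding exp_add[symmetric] by (rule arg_cong[of _ _ exp]) (simp add: field_simps)
    then show ?thesis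
      unfolding h R_coeff_add_1[OF zero_less_card_finite] theta_vec_add_1[OF zero_less_card_finite]
      by (simp add: mult_ac)
  qed
  then show ?thesis
    unfolding contraction_def sum_distrib_left by (intro sum.cong refl) (simp only: mult.assoc, simp add: mult_ac)
qed

text \<open>Both index changes amount to replacing \<open>n\<close> by \<open>n - 1\<close>. The
  factor from \<open>R_coeff\<close> supplies \<open>z\<close> in the exponent and thereby moves the
  argument from \<open>y i\<close> to \<open>y i + z\<close>.\<close>

lemma contraction_add_tau:
  "contraction m i n (h + \<tau>) = - exp (- (of_real pi * \<i> * \<tau> / of_nat CARD('n) +
     2 * of_real pi * \<i> * (h + (y i + z)) / of_nat CARD('n))) * contraction m i (n - 1) h"
proof -
  have "R_coeff CARD('n) \<tau> z (int (ix m) - n) (int (ix m) - int (ix l)) (h + \<tau>) *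
      theta_vec CARD('n) \<tau> (n + int (ix l) - int (ix m)) (h + \<tau> + y i) =
      - exp (- (of_real pi * \<i> * \<tau> / of_nat CARD('n) + 2 * of_real pi * \<i> * (h + (y i + z)) / of_nat CARD('n))) *
      (R_coeff CARD('n) \<tau> z (int (ix m) - (n - 1)) (int (ix m) - int (ix l)) h * theta_vec CARD('n) \<tau> (n - 1 + int (ix l) - int (ix m)) (h + y i))" for l
  proof -
    have h: "h + \<tau> + y i = (h + y i) + \<tau>" by simp
    have n: "int (ix m) - n + 1 = int (ix m) - (n - 1)" "n + int (ix l) - int (ix m) - 1 = n - 1 + int (ix l) - int (ix m)"
      by simp_all
    have alg: "(a * r) * (- b * t) = - (a * b) * (r * t)" for a b r t :: complex
      by (simp add: mult_ac)
    have "exp (- (2 * of_real pi * \<i> * z / of_nat CARD('n))) *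
        exp (- (of_real pi * \<i> * \<tau> / of_nat CARD('n) + 2 * of_real pi * \<i> * (h + y i) / of_nat CARD('n))) =
        exp (- (of_real pi * \<i> * \<tau> / of_nat CARD('n) + 2 * of_real pi * \<i> * (h + (y i + z)) / of_nat CARD('n)))"
      unfolding exp_add[symmetric] by (rule arg_cong[of _ _ exp]) (simp add: field_simps)
    then show ?thesis
      unfolding h R_coeff_add_tau[OF zero_less_card_finite] theta_vec_add_tau[OF zero_less_card_finite] n alg
      by (simp only:)
  qed
  then show ?thesis
    unfolding contraction_def sum_distrib_left by (intro sum.cong refl) (simp only: mult.assoc, simp only: mult_ac mult_minus_left mult_minus_right)
qed

lemma contraction_minus_N: "contraction m i (n - int CARD('n)) h = contraction m i n h"
proof -
  have "R_coeff CARD('n) \<tau> z (int (ix m) - (n - int CARD('n))) s h = R_coeff CARD('n) \<tau> z (int (ix m) - n) s h" for s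
    by (rule R_coeff_cong[OF zero_less_card_finite]) auto
  moreover have "theta_vec CARD('n) \<tau> (n - int CARD('n) + int (ix l) - int (ix m)) x = theta_vec CARD('n) \<tau> (n + int (ix l) - int (ix m)) x" for l x
    by (rule theta_vec_cong[OF zero_less_card_finite]) (simp add: mod_eq_dvd_iff)
  ultimately show ?thesis by (simp add: contraction_def)
qed

text \<open>The residues of \<open>R_coeff\<close> are independent of \<open>l\<close>, so what
  remains is at most the pairing of \<rho> with a column of \<open>g\<close> at 0, up to the nonzero
  denominator.\<close>

lemma contraction_removable_0: "((\<lambda>h. h * contraction m i n h) \<longlongrightarrow> 0) (at 0)"
proof -
  have cont: "isCont (\<lambda>h. theta_vec CARD('n) \<tau> q (h + y i)) 0" for q
  proof -
    have "(\<lambda>h. theta_vec CARD('n) \<tau> q (h + y i)) holomorphic_on UNIV"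
      by (intro holomorphic_theta_vec[OF zero_less_card_finite tau] holomorphic_intros)
    from holomorphic_on_imp_continuous_on[OF this] show ?thesis
      by (simp add: continuous_on_eq_continuous_at)
  qed
  have "((\<lambda>h. \<Sum>l\<in>UNIV. \<rho> l * (h * R_coeff CARD('n) \<tau> z (int (ix m) - n) (int (ix m) - int (ix l)) h) *
      theta_vec CARD('n) \<tau> (n + int (ix l) - int (ix m)) (h + y i)) \<longlongrightarrow>
      (\<Sum>l\<in>UNIV. \<rho> l * (if int CARD('n) dvd int (ix m) - n then 1 else 0) * theta_vec CARD('n) \<tau> (n + int (ix l) - int (ix m)) (0 + y i))) (at 0)"
    by (intro tendsto_intros R_coeff_residue[OF zero_less_card_finite tau z] cont[unfolded isCont_def])
  also have "(\<lambda>h. \<Sum>l\<in>UNIV. \<rho> l * (h * R_coeff CARD('n) \<tau> z (int (ix m) - n) (int (ix m) - int (ix l)) h) *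
      theta_vec CARD('n) \<tau> (n + int (ix l) - int (ix m)) (h + y i)) = (\<lambda>h. h * contraction m i n h)"
    by (simp add: contraction_def sum_distrib_left mult_ac)
  also have "(\<Sum>l\<in>UNIV. \<rho> l * (if int CARD('n) dvd int (ix m) - n then 1 else 0) * theta_vec CARD('n) \<tau> (n + int (ix l) - int (ix m)) (0 + y i)) = 0"
  proof (cases "int CARD('n) dvd int (ix m) - n")
    case True
    have "theta_vec CARD('n) \<tau> (n + int (ix l) - int (ix m)) x = theta_vec CARD('n) \<tau> (int (ix l)) x" for l x
    proof (rule theta_vec_cong[OF zero_less_card_finite])
      have "n + int (ix l) - int (ix m) - int (ix l) = - (int (ix m) - n)" by simp
      then show "(n + int (ix l) - int (ix m)) mod int CARD('n) = int (ix l) mod int CARD('n)"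
        unfolding mod_eq_dvd_iff using True by (simp only: dvd_minus_iff)
    qed
    moreover have "(\<Sum>l\<in>UNIV. \<rho> l * theta_vec CARD('n) \<tau> (int (ix l)) (0 + y i)) = 0"
      using \<rho>[of i] vandermonde_factor_nonzero[OF ix tau u, of i]
      by (simp add: g_entry flip: sum_divide_distrib)
    ultimately show ?thesis by (simp add: True)
  qed simp
  finally show ?thesis .
qed

lemma contraction_removable:
  assumes "s \<in> period_lattice \<tau>"
  shows "((\<lambda>h. (h - s) * contraction m i n h) \<longlongrightarrow> 0) (at s)"
proof -
  \<comment> \<open>The predicate covers all \<open>n\<close> at once because the shift by \<tau>
    turns \<open>n\<close> into \<open>n - 1\<close>.\<close>
  define Z where "Z = (\<lambda>s. \<forall>n. ((\<lambda>h. (h - s) * contraction m i n h) \<longlongrightarrow> 0) (at s))"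
  have Z1: "Z (s + 1) = Z s" for s
  proof -
    have "((\<lambda>h. (h - (s + 1)) * contraction m i n h) \<longlongrightarrow> 0) (at (s + 1)) \<longleftrightarrow>
        ((\<lambda>h. (h - s) * contraction m i n h) \<longlongrightarrow> 0) (at s)" for n
      by (rule pole_order_shift[where e = "\<lambda>_. - exp (- (2 * of_real pi * \<i> * of_int n / of_nat CARD('n)))"])
         (auto simp: contraction_add_1)
    then show ?thesis unfolding Z_def by simp
  qed
  have Zt: "Z (s + \<tau>) = Z s" for s
  proof -
    have "((\<lambda>h. (h - (s + \<tau>)) * contraction m i n h) \<longlongrightarrow> 0) (at (s + \<tau>)) \<longleftrightarrow>
        ((\<lambda>h. (h - s) * contraction m i (n - 1) h) \<longlongrightarrow> 0) (at s)" for n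
      by (rule pole_order_shift[where e = "\<lambda>h. - exp (- (of_real pi * \<i> * \<tau> / of_nat CARD('n) +
            2 * of_real pi * \<i> * (h + (y i + z)) / of_nat CARD('n)))"])
         (auto simp only: contraction_add_tau intro!: continuous_intros; simp)+
    then show ?thesis
      unfolding Z_def by (metis diff_add_cancel add_diff_cancel_right')
  qed
  obtain a b where s: "s = (0 + of_int a * 1) + of_int b * \<tau>"
    using assms by (auto simp: period_lattice_iff)
  have "Z s = Z 0"
    unfolding s shift_of_int[of Z, OF Zt] shift_of_int[of Z, OF Z1] ..
  moreover have "Z 0" using contraction_removable_0 by (simp add: Z_def)
  ultimately show ?thesis by (simp add: Z_def)
qed

text \<open>Each component is extended separately, and the functional equations survive by the
  identity theorem; \<open>theta_vec_unique\<close> then yields one constant valid for all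
  \<open>n\<close>.\<close>

lemma contraction_proportional:
  obtains C where "\<And>h n. vartheta \<tau> h \<noteq> 0 \<Longrightarrow> contraction m i n h = C * theta_vec CARD('n) \<tau> n (h + z + y i)"
proof -
  have hol: "vartheta \<tau> holomorphic_on UNIV"
    using holomorphic_vartheta[OF tau holomorphic_on_ident] .
  obtain z0 where z0: "vartheta \<tau> z0 \<noteq> 0" using vartheta_nonzero[OF tau] .
  have "\<exists>V. V holomorphic_on UNIV \<and> (\<forall>h. vartheta \<tau> h \<noteq> 0 \<longrightarrow> V h = contraction m i n h)" for n
  proof -
    have "contraction m i n holomorphic_on {h. vartheta \<tau> h \<noteq> 0}"
      unfolding contraction_def[abs_def]
      by (intro holomorphic_intros holomorphic_theta_vec[OF zero_less_card_finite tau]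
          holomorphic_R_coeff[OF zero_less_card_finite tau z])
    then obtain V where "V holomorphic_on UNIV" "\<And>h. vartheta \<tau> h \<noteq> 0 \<Longrightarrow> V h = contraction m i n h"
      using entire_extension[OF hol z0, of "contraction m i n"] contraction_removable
      unfolding vartheta_eq_0_iff[OF tau] by metis
    then show ?thesis by blast
  qed
  then obtain V where V: "\<And>n. V n holomorphic_on UNIV"
    and Veq: "\<And>n h. vartheta \<tau> h \<noteq> 0 \<Longrightarrow> V n h = contraction m i n h"
    by metis
  have V1: "V n (h + 1) = - exp (- (2 * of_real pi * \<i> * of_int n / of_nat CARD('n))) * V n h" for n h
  proof (rule entire_cancel[OF hol z0, where f = "\<lambda>h. V n (h + 1)"
      and g = "\<lambda>h. - exp (- (2 * of_real pi * \<i> * of_int n / of_nat CARD('n))) * V n h"])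
    show "V n (h + 1) * vartheta \<tau> h = - exp (- (2 * of_real pi * \<i> * of_int n / of_nat CARD('n))) * V n h * vartheta \<tau> h" for h
      by (cases "vartheta \<tau> h = 0") (simp_all add: Veq vartheta_add_1 contraction_add_1)
  qed (intro holomorphic_intros holomorphic_on_compose_entire[OF V] V)+
  have Vt: "V n (h + \<tau>) = - exp (- (of_real pi * \<i> * \<tau> / of_nat CARD('n) +
     2 * of_real pi * \<i> * (h + (y i + z)) / of_nat CARD('n))) * V (n - 1) h" for n h
  proof (rule entire_cancel[OF hol z0, where f = "\<lambda>h. V n (h + \<tau>)"
      and g = "\<lambda>h. - exp (- (of_real pi * \<i> * \<tau> / of_nat CARD('n) + 2 * of_real pi * \<i> * (h + (y i + z)) / of_nat CARD('n))) * V (n - 1) h"])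
    show "V n (h + \<tau>) * vartheta \<tau> h = - exp (- (of_real pi * \<i> * \<tau> / of_nat CARD('n) +
     2 * of_real pi * \<i> * (h + (y i + z)) / of_nat CARD('n))) * V (n - 1) h * vartheta \<tau> h" for h
    proof (cases "vartheta \<tau> h = 0")
      case False
      then have "vartheta \<tau> (h + \<tau>) \<noteq> 0" by (simp add: vartheta_add_tau)
      then show ?thesis by (simp only: Veq[OF False] Veq contraction_add_tau not_False_eq_True)
    qed simp
  qed (intro holomorphic_intros holomorphic_on_compose_entire[OF V] V; simp)+
  have VN: "V (n - int CARD('n)) h = V n h" for n h
  proof (rule entire_cancel[OF hol z0, where f = "V (n - int CARD('n))" and g = "V n"])
    show "V (n - int CARD('n)) h * vartheta \<tau> h = V n h * vartheta \<tau> h" for h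
      by (cases "vartheta \<tau> h = 0") (simp_all only: Veq contraction_minus_N mult_zero_right not_False_eq_True)
  qed (rule V)+
  obtain C where "\<And>n h. V n h = C * theta_vec CARD('n) \<tau> n (h + (y i + z))"
    using theta_vec_unique[OF zero_less_card_finite tau V V1 Vt VN] by blast
  then have "contraction m i n h = C * theta_vec CARD('n) \<tau> n (h + z + y i)" if "vartheta \<tau> h \<noteq> 0" for h n
    using Veq[OF that, of n] by (simp add: add_ac)
  then show ?thesis by (rule that)
qed

text \<open>The proportionality constants are found by summing over the columns \<open>i\<close> and letting \<open>h\<close>
  tend to \<open>0\<close>.\<close>
lemma contracted_intertwining:
  fixes \<gamma> :: "'n \<Rightarrow> complex"
  assumes \<gamma>: "\<And>l. ((\<lambda>h. (\<Sum>i\<in>UNIV. g_mat ix \<tau> h u $ l $ i) / h) \<longlongrightarrow> \<gamma> l) (at 0)"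
    and \<rho>\<gamma>: "(\<Sum>l\<in>UNIV. \<rho> l * \<gamma> l) = 1" and h: "h \<notin> period_lattice \<tau>"
  shows "(\<Sum>l\<in>UNIV. \<Sum>p\<in>UNIV. \<rho> l * R_BB ix \<tau> h z $ (k, l) $ (m, p) * g_mat ix \<tau> h u $ p $ i) =
    g_mat ix \<tau> (z + h) u $ k $ i * matrix_inv (g_mat ix \<tau> z u) $ i $ m"
proof -
  have "\<exists>C. \<forall>h n. vartheta \<tau> h \<noteq> 0 \<longrightarrow> contraction m i n h = C * theta_vec CARD('n) \<tau> n (h + z + y i)" for m i
    using contraction_proportional[of m i] by metis
  then obtain C where C: "\<And>m i h n. vartheta \<tau> h \<noteq> 0 \<Longrightarrow> contraction m i n h = C m i * theta_vec CARD('n) \<tau> n (h + z + y i)"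
    by metis
  have eq: "(\<Sum>l\<in>UNIV. \<Sum>p\<in>UNIV. \<rho> l * R_BB ix \<tau> h z $ (k, l) $ (m, p) * g_mat ix \<tau> h u $ p $ i) =
      g_mat ix \<tau> (z + h) u $ k $ i * C m i" if "vartheta \<tau> h \<noteq> 0" for h k m i
    unfolding contraction_eq C[OF that] unfolding g_entry by (simp add: add_ac)
  have "(\<Sum>i\<in>UNIV. g_mat ix \<tau> z u $ k $ i * C m i) = (if k = m then 1 else 0)" for k m
  proof -
    have hol: "vartheta \<tau> holomorphic_on UNIV"
      using holomorphic_vartheta[OF tau holomorphic_on_ident] .
    obtain z0 where z0: "vartheta \<tau> z0 \<noteq> 0" using vartheta_nonzero[OF tau] .
    obtain r where r: "r > 0" "\<And>h. h \<in> ball 0 r - {0} \<Longrightarrow> vartheta \<tau> h \<noteq> 0"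
      using isolated_zeros[OF hol open_UNIV connected_UNIV UNIV_I vartheta_0 UNIV_I z0] by metis
    \<comment> \<open>Multiplying and dividing by \<open>h\<close> pairs the pole of R with the zero
      of the column sum, so that both factors have limits.\<close>
    have "(\<Sum>i\<in>UNIV. g_mat ix \<tau> (z + h) u $ k $ i * C m i) =
        (\<Sum>l\<in>UNIV. \<Sum>p\<in>UNIV. \<rho> l * (h * R_BB ix \<tau> h z $ (k, l) $ (m, p)) * ((\<Sum>i\<in>UNIV. g_mat ix \<tau> h u $ p $ i) / h))"
      if "h \<in> ball 0 r - {0}" for h
    proof -
      have "(\<Sum>i\<in>UNIV. g_mat ix \<tau> (z + h) u $ k $ i * C m i) =
          (\<Sum>i\<in>UNIV. \<Sum>l\<in>UNIV. \<Sum>p\<in>UNIV. \<rho> l * R_BB ix \<tau> h z $ (k, l) $ (m, p) * g_mat ix \<tau> h u $ p $ i)"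
        by (simp only: eq[OF r(2)[OF that]])
      also have "\<dots> = (\<Sum>l\<in>UNIV. \<Sum>i\<in>UNIV. \<Sum>p\<in>UNIV. \<rho> l * R_BB ix \<tau> h z $ (k, l) $ (m, p) * g_mat ix \<tau> h u $ p $ i)"
        by (rule sum.swap)
      also have "\<dots> = (\<Sum>l\<in>UNIV. \<Sum>p\<in>UNIV. \<Sum>i\<in>UNIV. \<rho> l * R_BB ix \<tau> h z $ (k, l) $ (m, p) * g_mat ix \<tau> h u $ p $ i)"
        by (intro sum.cong refl sum.swap)
      also have "\<dots> = (\<Sum>l\<in>UNIV. \<Sum>p\<in>UNIV. \<rho> l * (h * R_BB ix \<tau> h z $ (k, l) $ (m, p)) * ((\<Sum>i\<in>UNIV. g_mat ix \<tau> h u $ p $ i) / h))"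
        using that by (intro sum.cong refl) (simp flip: sum_distrib_left)
      finally show ?thesis .
    qed
    then have "eventually (\<lambda>h. (\<Sum>l\<in>UNIV. \<Sum>p\<in>UNIV. \<rho> l * (h * R_BB ix \<tau> h z $ (k, l) $ (m, p)) * ((\<Sum>i\<in>UNIV. g_mat ix \<tau> h u $ p $ i) / h)) =
        (\<Sum>i\<in>UNIV. g_mat ix \<tau> (z + h) u $ k $ i * C m i)) (at 0)"
      using eventually_at_in_open[of "ball 0 r" 0] r(1) by (auto elim!: eventually_mono)
    moreover have "((\<lambda>h. \<Sum>l\<in>UNIV. \<Sum>p\<in>UNIV. \<rho> l * (h * R_BB ix \<tau> h z $ (k, l) $ (m, p)) * ((\<Sum>i\<in>UNIV. g_mat ix \<tau> h u $ p $ i) / h)) \<longlongrightarrow>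
        (\<Sum>l\<in>UNIV. \<Sum>p\<in>UNIV. \<rho> l * (if k = m \<and> l = p then 1 else 0) * \<gamma> p)) (at 0)"
      by (intro tendsto_sum tendsto_mult tendsto_const R_BB_residue[OF ix tau z] \<gamma>)
    ultimately have L1: "((\<lambda>h. \<Sum>i\<in>UNIV. g_mat ix \<tau> (z + h) u $ k $ i * C m i) \<longlongrightarrow>
        (\<Sum>l\<in>UNIV. \<Sum>p\<in>UNIV. \<rho> l * (if k = m \<and> l = p then 1 else 0) * \<gamma> p)) (at 0)"
      by (rule Lim_transform_eventually[rotated])
    have "(\<lambda>h. \<Sum>i\<in>UNIV. g_mat ix \<tau> (z + h) u $ k $ i * C m i) holomorphic_on UNIV"
      by (intro holomorphic_intros holomorphic_g_mat[OF ix tau u])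
    from holomorphic_on_imp_continuous_on[OF this]
    have "isCont (\<lambda>h. \<Sum>i\<in>UNIV. g_mat ix \<tau> (z + h) u $ k $ i * C m i) 0"
      by (simp add: continuous_on_eq_continuous_at)
    then have L2: "((\<lambda>h. \<Sum>i\<in>UNIV. g_mat ix \<tau> (z + h) u $ k $ i * C m i) \<longlongrightarrow>
        (\<Sum>i\<in>UNIV. g_mat ix \<tau> (z + 0) u $ k $ i * C m i)) (at 0)"
      by (simp only: isCont_def)
    have "(\<Sum>l\<in>UNIV. \<Sum>p\<in>UNIV. \<rho> l * (if k = m \<and> l = p then 1 else 0) * \<gamma> p) =
        (\<Sum>l\<in>UNIV. if k = m then \<rho> l * \<gamma> l else 0)"
    proof (rule sum.cong[OF refl])
      fix l
      have "(\<Sum>p\<in>UNIV. \<rho> l * (if k = m \<and> l = p then 1 else 0) * \<gamma> p) =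
          (\<Sum>p\<in>UNIV. if l = p then (if k = m then \<rho> l * \<gamma> p else 0) else 0)"
        by (intro sum.cong) auto
      then show "(\<Sum>p\<in>UNIV. \<rho> l * (if k = m \<and> l = p then 1 else 0) * \<gamma> p) = (if k = m then \<rho> l * \<gamma> l else 0)"
        by simp
    qed
    also have "\<dots> = (if k = m then 1 else 0)" using \<rho>\<gamma> by simp
    finally show ?thesis
      using tendsto_unique[OF at_neq_bot L2 L1] by simp
  qed
  then have "g_mat ix \<tau> z u ** (\<chi> i m. C m i) = mat 1"
    by (simp add: matrix_matrix_mult_def mat_def)
  then have "matrix_inv (g_mat ix \<tau> z u) = (\<chi> i m. C m i)" by (rule matrix_inv_eq)
  then show ?thesis
    using eq[of h k m i] h by (simp add: vartheta_eq_0_iff[OF tau])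
qed

end

subsection \<open>Entries of tensor products\<close>

lemma sum_UNIV_prod:
  fixes f :: "'a::finite \<times> 'b::finite \<Rightarrow> 'c::comm_monoid_add"
  shows "(\<Sum>x\<in>UNIV. f x) = (\<Sum>a\<in>UNIV. \<Sum>b\<in>UNIV. f (a, b))"
  by (simp add: sum.cartesian_product UNIV_Times_UNIV[symmetric] del: UNIV_Times_UNIV)

lemma matrix_mult_entry: "(A ** B) $ i $ j = (\<Sum>k\<in>UNIV. A $ i $ k * B $ k $ j)"
  by (simp add: matrix_matrix_mult_def)

lemma in_first_entry: "in_first A $ (a, b) $ (a', b') = (if b = b' then A $ a $ a' else 0)"
  by (simp add: in_first_def tensor_mat_def mat_def)

lemma in_second_entry: "in_second A $ (a, b) $ (a', b') = (if a = a' then A $ b $ b' else 0)"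
  by (simp add: in_second_def tensor_mat_def mat_def)

lemma in_second_mult_entry:
  "(in_second A ** M) $ (k, j) $ q = (\<Sum>l\<in>UNIV. A $ j $ l * M $ (k, l) $ q)"
proof -
  have "(in_second A ** M) $ (k, j) $ q = (\<Sum>k'\<in>UNIV. if k = k' then (\<Sum>l\<in>UNIV. A $ j $ l * M $ (k, l) $ q) else 0)"
    unfolding matrix_mult_entry sum_UNIV_prod in_second_entry by (rule sum.cong[OF refl]) auto
  then show ?thesis by simp
qed

lemma mult_in_second_entry:
  "(M ** in_second A) $ q $ (m, p) = (\<Sum>b\<in>UNIV. M $ q $ (m, b) * A $ b $ p)"
proof -
  have "(M ** in_second A) $ q $ (m, p) = (\<Sum>a\<in>UNIV. if a = m then (\<Sum>b\<in>UNIV. M $ q $ (m, b) * A $ b $ p) else 0)"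
    unfolding matrix_mult_entry sum_UNIV_prod in_second_entry by (rule sum.cong[OF refl]) auto
  then show ?thesis by simp
qed

lemma mult_in_first_entry:
  "(M ** in_first A) $ q $ (m, p) = (\<Sum>a\<in>UNIV. M $ q $ (a, p) * A $ a $ m)"
proof -
  have "(\<Sum>b\<in>UNIV. M $ q $ (a, b) * (if b = p then A $ a $ m else 0)) = M $ q $ (a, p) * A $ a $ m" for a
    by (simp add: if_distrib cong: if_cong)
  then show ?thesis
    unfolding matrix_mult_entry sum_UNIV_prod in_first_entry by simp
qed

text \<open>The value does not depend on \<open>j\<close>, matching the equal rows of
  \<open>g_breve\<close>.\<close>

lemma O_mat_entry: "O_mat $ (c, j) $ (a, b) = (if c = a \<and> a = b then 1 else 0)"
proof -
  have "O_mat $ (c, j) $ (a, b) = (\<Sum>i\<in>UNIV. \<Sum>j'\<in>UNIV. if j' = j then (if i = c \<and> c = a \<and> a = b then 1 else 0) else 0)"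
    unfolding O_mat_def mat_sum_entry tensor_mat_def mat_unit_def by (simp, intro sum.cong refl) auto
  also have "\<dots> = (\<Sum>i\<in>UNIV. if i = c then (if c = a \<and> a = b then 1 else 0) else 0)"
    by (intro sum.cong) auto
  finally show ?thesis by simp
qed

lemma in_first_mult_O_mat_entry:
  "(in_first G ** O_mat) $ (k, j) $ (a, b) = (if a = b then G $ k $ a else 0)"
proof -
  have "(in_first G ** O_mat) $ (k, j) $ (a, b) = (\<Sum>c\<in>UNIV. \<Sum>l\<in>UNIV.
      if j = l then (if c = a then (if a = b then G $ k $ a else 0) else 0) else 0)"
    unfolding matrix_mult_entry sum_UNIV_prod in_first_entry O_mat_entry
    by (rule sum.cong[OF refl], rule sum.cong[OF refl]) auto
  then show ?thesis by simp
qed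

theorem mainTheorem4:
  fixes ix :: "'n::finite \<Rightarrow> nat" and \<tau> h z :: complex and u :: "complex^'n"
  assumes "bij_betw ix UNIV {1..CARD('n)}"
    and "Im \<tau> > 0"
    and "h \<notin> period_lattice \<tau>"
    and "z \<notin> period_lattice \<tau>"
    and "\<And>i j. i \<noteq> j \<Longrightarrow> u $ i - u $ j \<notin> period_lattice \<tau>"
  shows "in_second (g_breve ix \<tau> u) ** R_BB ix \<tau> h z =
         in_first (g_mat ix \<tau> (z + h) u) ** O_mat **
         in_second (matrix_inv (g_mat ix \<tau> h u)) ** in_first (matrix_inv (g_mat ix \<tau> z u))"
proof -
  let ?G = "g_mat ix \<tau> (z + h) u" and ?g = "g_mat ix \<tau> h u"
  let ?B = "matrix_inv ?g" and ?C = "matrix_inv (g_mat ix \<tau> z u)"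
  obtain \<rho> \<gamma> :: "'n \<Rightarrow> complex" where \<rho>: "\<And>j l. g_breve ix \<tau> u $ j $ l = \<rho> l"
    and \<rho>0: "\<And>i. (\<Sum>l\<in>UNIV. \<rho> l * g_mat ix \<tau> 0 u $ l $ i) = 0"
    and \<gamma>: "\<And>l. ((\<lambda>h. (\<Sum>i\<in>UNIV. g_mat ix \<tau> h u $ l $ i) / h) \<longlongrightarrow> \<gamma> l) (at 0)"
    and \<rho>\<gamma>: "(\<Sum>l\<in>UNIV. \<rho> l * \<gamma> l) = 1"
    using g_breve_properties[OF assms(1,2,5)] by blast
  have "invertible ?g" using invertible_g_mat[OF assms(1,2,5,3)] .
  then obtain B where B: "?g ** B = mat 1" unfolding invertible_def by blast
  then have gB: "?g ** ?B = mat 1" using matrix_inv_eq by blast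
  have "(in_second (g_breve ix \<tau> u) ** R_BB ix \<tau> h z) $ (k, j) $ (m, p) =
      (in_first ?G ** O_mat ** in_second ?B ** in_first ?C) $ (k, j) $ (m, p)" for k j m p
  proof -
    define X where "X = (\<lambda>p. \<Sum>l\<in>UNIV. \<rho> l * R_BB ix \<tau> h z $ (k, l) $ (m, p))"
    have X: "(\<Sum>q\<in>UNIV. X q * ?g $ q $ i) = ?G $ k $ i * ?C $ i $ m" for i
    proof -
      have "(\<Sum>q\<in>UNIV. X q * ?g $ q $ i) = (\<Sum>l\<in>UNIV. \<Sum>q\<in>UNIV. \<rho> l * R_BB ix \<tau> h z $ (k, l) $ (m, q) * ?g $ q $ i)"
        unfolding X_def sum_distrib_right by (rule sum.swap)
      then show ?thesis
        using contracted_intertwining[OF assms(1,2,4,5) \<rho>0 \<gamma> \<rho>\<gamma> assms(3)] by simp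
    qed
    have "(in_second (g_breve ix \<tau> u) ** R_BB ix \<tau> h z) $ (k, j) $ (m, p) = X p"
      by (simp add: in_second_mult_entry \<rho> X_def)
    \<comment> \<open>Inserting \<open>?g ** ?B = mat 1\<close> expresses the entry through the
      columns of \<open>?g\<close>, for which the contracted relation is known.\<close>
    also have "X p = (\<Sum>q\<in>UNIV. X q * (?g ** ?B) $ q $ p)"
      unfolding gB by (simp add: mat_def if_distrib cong: if_cong)
    also have "\<dots> = (\<Sum>q\<in>UNIV. \<Sum>i\<in>UNIV. X q * ?g $ q $ i * ?B $ i $ p)"
      by (simp add: matrix_matrix_mult_def sum_distrib_left mult.assoc)
    also have "\<dots> = (\<Sum>i\<in>UNIV. \<Sum>q\<in>UNIV. X q * ?g $ q $ i * ?B $ i $ p)"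
      by (rule sum.swap)
    also have "\<dots> = (\<Sum>i\<in>UNIV. ?G $ k $ i * ?C $ i $ m * ?B $ i $ p)"
      unfolding sum_distrib_right[symmetric] X ..
    also have "\<dots> = (in_first ?G ** O_mat ** in_second ?B ** in_first ?C) $ (k, j) $ (m, p)"
    proof -
      have "(in_first ?G ** O_mat ** in_second ?B) $ (k, j) $ (a, p) = ?G $ k $ a * ?B $ a $ p" for a
      proof -
        have "(in_first ?G ** O_mat ** in_second ?B) $ (k, j) $ (a, p) =
            (\<Sum>b\<in>UNIV. if a = b then ?G $ k $ a * ?B $ b $ p else 0)"
          unfolding mult_in_second_entry in_first_mult_O_mat_entry by (intro sum.cong) auto
        then show ?thesis by simp
      qed
      then show ?thesis
        unfolding mult_in_first_entry by (intro sum.cong refl) (simp add: mult_ac)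
    qed
    finally show ?thesis .
  qed
  then show ?thesis
    by (simp add: vec_eq_iff)
qed

end
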